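(* Let $p\ge 2$, and let $\Omega_\ell=\ell\omega_1\times\omega_2$, $\Omega_\infty=\mathbb{R}^m\times\omega_2$ and the matrix field $A$ be as in the context. Let $\lambda_D^1(\Omega_\ell)$ be the first Dirichlet eigenvalue on $\Omega_\ell$, let $\mu_1(\omega_2)$ be the first Dirichlet eigenvalue of the cross-section problem on $\omega_2$, and let $\Lambda_\infty$ be the infimum of the Rayleigh quotient on $\Omega_\infty$ (all defined in the context). Then there exists a constant $C$, depending only on $A$, $\omega_2$ and $p$, such that $$\mu_1(\omega_2)\le \lambda_D^1(\Omega_\ell)\le \mu_1(\omega_2)+\frac{C}{\ell}\qquad\text{for every }\ell>0.$$ Moreover, $\Lambda_\infty=\mu_1(\omega_2)$.
   Context: Let $1\le m<n$ be integers, and let $\omega_1\subset\mathbb{R}^m$ and $\omega_2\subset\mathbb{R}^{n-m}$ be bounded open sets. For $\ell>0$ set $\Omega_\ell=\ell\omega_1\times\omega_2\subset\mathbb{R}^n$, and set $\Omega_\infty=\mathbb{R}^m\times\omega_2$. Points of $\mathbb{R}^n$ are written $x=(X_1,X_2)$ with $X_1=(x_1,\dots,x_m)\in\mathbb{R}^m$ and $X_2=(x_{m+1},\dots,x_n)\in\mathbb{R}^{n-m}$; $\nabla$ and $\nabla_{X_2}$ denote the gradients in $x$ and in $X_2$. $A$ is a symmetric $n\times n$ matrix field on $\mathbb{R}^m\times\omega_2$ of the block form $$A=A(x)=\begin{pmatrix}A_{11}(x)&A_{12}(X_2)\\ A_{12}^t(X_2)&A_{22}(X_2)\end{pmatrix},$$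 where $A_{22}$ is an $(n-m)\times(n-m)$ matrix; thus $A_{12}$ and $A_{22}$ depend only on $X_2$. The block $A_{22}$ is of class $C^1$. There are positive constants $M,\lambda$ such that $\|A(x)\|\le M$ and $A(x)\xi\cdot\xi\ge\lambda|\xi|^2$ for a.e. $x\in\mathbb{R}^m\times\omega_2$ and all $\xi\in\mathbb{R}^n$. $\lambda_D^1(\Omega_\ell)$ is the first eigenvalue of $$-\mathrm{div}\big(|A\nabla u\cdot\nabla u|^{\frac{p-2}{2}}A\nabla u\big)=\lambda|u|^{p-2}u\ \text{ in }\Omega_\ell,\qquad u=0\ \text{ on }\partial\Omega_\ell,$$ understood weakly in $W_0^{1,p}(\Omega_\ell)$; equivalently $$\lambda_D^1(\Omega_\ell)=\inf_{u\in W_0^{1,p}(\Omega_\ell),\,u\ne0}\frac{\int_{\Omega_\ell}|A\nabla u\cdot\nabla u|^{p/2}}{\int_{\Omega_\ell}|u|^p}.$$ $\mu_1(\omega_2)$ is the first eigenvalue of $$-\mathrm{div}\big(|A_{22}(X_2)\nabla_{X_2} u\cdot\nabla_{X_2} u|^{\frac{p-2}{2}}A_{22}(X_2)\nabla_{X_2} u\big)=\mu|u|^{p-2}u\ \text{ in }\omega_2,\qquad u=0\ \text{ on }\partial\omega_2,$$ understood weakly in $W_0^{1,p}(\omega_2)$; equivalently $$\mu_1(\omega_2)=\inf_{u\in W_0^{1,p}(\omega_2),\,u\ne0}\frac{\int_{\omega_2}|A_{22}\nabla_{X_2}u\cdot\nabla_{X_2}u|^{p/2}}{\int_{\omega_2}|u|^p}.$$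 Finally, $$\Lambda_\infty=\inf_{u\in W_0^{1,p}(\Omega_\infty),\,u\ne0}\frac{\int_{\Omega_\infty}|A\nabla u\cdot\nabla u|^{p/2}}{\int_{\Omega_\infty}|u|^p}.$$
   Formalization: The upper bound fails as ℓ→0. Instead: with C depending only on A, ω2 and p it is stated for all ℓ ≥ ℓ0, where ℓ0 may depend on ω1; and for every ℓ0>0 it is stated for all ℓ ≥ ℓ0 with a constant that may also depend on ω1 and ℓ0. *)

theory Defs
  imports "HOL-Analysis.Analysis"
begin

text \<open>Smooth functions: every iterated partial derivative exists and is differentiable everywhere.\<close>

primrec iterated_partial ::
  "'a::euclidean_space list \<Rightarrow> ('a \<Rightarrow> real) \<Rightarrow> 'a \<Rightarrow> real" where
  "iterated_partial [] f = f"
| "iterated_partial (b # bs) f = (\<lambda>x. frechet_derivative (iterated_partial bs f) (at x) b)"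

definition smooth :: "('a::euclidean_space \<Rightarrow> real) \<Rightarrow> bool" where
  "smooth f \<longleftrightarrow>
     (\<forall>bs. set bs \<subseteq> Basis \<longrightarrow> (\<forall>x. iterated_partial bs f differentiable (at x)))"

definition test_functions :: "'a::euclidean_space set \<Rightarrow> ('a \<Rightarrow> real) set" where
  "test_functions \<Omega> =
     {\<phi>. smooth \<phi> \<and> compact (closure {x. \<phi> x \<noteq> 0}) \<and> closure {x. \<phi> x \<noteq> 0} \<subseteq> \<Omega>}"

definition gradient :: "('a::euclidean_space \<Rightarrow> real) \<Rightarrow> 'a \<Rightarrow> 'a" where
  "gradient f x = (\<Sum>b\<in>Basis. frechet_derivative f (at x) b *\<^sub>R b)"

definition Lp :: "real \<Rightarrow> 'a::euclidean_space set \<Rightarrow> ('a \<Rightarrow> 'b::euclidean_space) \<Rightarrow> bool" where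
  "Lp p \<Omega> u \<longleftrightarrow>
     u \<in> borel_measurable (lebesgue_on \<Omega>) \<and>
     integrable (lebesgue_on \<Omega>) (\<lambda>x. norm (u x) powr p)"

text \<open>A Sobolev function is represented by a pair consisting of the function and its weak gradient
  (which the function determines almost everywhere). Values outside the open set \<open>\<Omega>\<close> are
  irrelevant.\<close>

definition weak_gradient ::
  "'a::euclidean_space set \<Rightarrow> ('a \<Rightarrow> real) \<Rightarrow> ('a \<Rightarrow> 'a) \<Rightarrow> bool" where
  "weak_gradient \<Omega> u g \<longleftrightarrow>
     (\<forall>\<phi>\<in>test_functions \<Omega>. \<forall>b\<in>Basis.
        (\<integral>x. u x * frechet_derivative \<phi> (at x) b \<partial>lebesgue_on \<Omega>) =
        - (\<integral>x. (g x \<bullet> b) * \<phi> x \<partial>lebesgue_on \<Omega>))"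

definition W1p ::
  "real \<Rightarrow> 'a::euclidean_space set \<Rightarrow> ('a \<Rightarrow> real) \<Rightarrow> ('a \<Rightarrow> 'a) \<Rightarrow> bool" where
  "W1p p \<Omega> u g \<longleftrightarrow> Lp p \<Omega> u \<and> Lp p \<Omega> g \<and> weak_gradient \<Omega> u g"

text \<open>The closure of the test functions in the Sobolev norm.\<close>

definition W1p_0 ::
  "real \<Rightarrow> 'a::euclidean_space set \<Rightarrow> ('a \<Rightarrow> real) \<Rightarrow> ('a \<Rightarrow> 'a) \<Rightarrow> bool" where
  "W1p_0 p \<Omega> u g \<longleftrightarrow>
     W1p p \<Omega> u g \<and>
     (\<exists>\<phi>. (\<forall>k::nat. \<phi> k \<in> test_functions \<Omega>) \<and>
        (\<lambda>k. \<integral>x. \<bar>\<phi> k x - u x\<bar> powr p \<partial>lebesgue_on \<Omega>) \<longlonglongrightarrow> 0 \<and>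
        (\<lambda>k. \<integral>x. norm (gradient (\<phi> k) x - g x) powr p \<partial>lebesgue_on \<Omega>) \<longlonglongrightarrow> 0)"

text \<open>The infimum of the Rayleigh quotient over the nonzero elements of \<open>W\<^sub>0\<^sup>1\<^sup>,\<^sup>p(\<Omega>)\<close>. On a bounded open set this
  is the variational formula for the first Dirichlet eigenvalue of
  \<open>- div (|A \<nabla>u \<cdot> \<nabla>u|\<^bsup>(p-2)/2\<^esup> A \<nabla>u) = \<lambda> |u|\<^bsup>p-2\<^esup> u\<close>.
  The argument \<open>A x\<close> is the linear map given by the coefficient matrix at \<open>x\<close>.\<close>

definition rayleigh_inf ::
  "real \<Rightarrow> 'a::euclidean_space set \<Rightarrow> ('a \<Rightarrow> 'a \<Rightarrow> 'a) \<Rightarrow> real" where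
  "rayleigh_inf p \<Omega> A =
     Inf {(\<integral>x. \<bar>A x (g x) \<bullet> g x\<bar> powr (p / 2) \<partial>lebesgue_on \<Omega>) /
          (\<integral>x. \<bar>u x\<bar> powr p \<partial>lebesgue_on \<Omega>) | u g.
            W1p_0 p \<Omega> u g \<and> \<not> (AE x in lebesgue_on \<Omega>. u x = 0)}"

text \<open>The block matrix with rows \<open>(A11, A12)\<close> and \<open>(A12\<^sup>t, A22)\<close>, acting on
  \<open>\<real>\<^sup>n = \<real>\<^sup>m \<times> \<real>\<^bsup>n-m\<^esup>\<close>; points are pairs \<open>x = (X1, X2)\<close>.\<close>

definition block_field ::
  "((real^'m) \<times> (real^'k) \<Rightarrow> real^'m^'m) \<Rightarrow> (real^'k \<Rightarrow> real^'k^'m) \<Rightarrow> (real^'k \<Rightarrow> real^'k^'k)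
     \<Rightarrow> (real^'m) \<times> (real^'k) \<Rightarrow> (real^'m) \<times> (real^'k) \<Rightarrow> (real^'m) \<times> (real^'k)" where
  "block_field A11 A12 A22 x \<xi> =
     (A11 x *v fst \<xi> + A12 (snd x) *v snd \<xi>,
      transpose (A12 (snd x)) *v fst \<xi> + A22 (snd x) *v snd \<xi>)"

definition C1_on :: "'a::real_normed_vector set \<Rightarrow> ('a \<Rightarrow> 'b::real_normed_vector) \<Rightarrow> bool" where
  "C1_on S f \<longleftrightarrow>
     (\<exists>f' :: 'a \<Rightarrow> 'a \<Rightarrow>\<^sub>L 'b. continuous_on S f' \<and>
        (\<forall>x\<in>S. (f has_derivative blinfun_apply (f' x)) (at x)))"

definition cylinder ::
  "(real^'m) set \<Rightarrow> (real^'k) set \<Rightarrow> real \<Rightarrow> ((real^'m) \<times> (real^'k)) set" where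
  "cylinder \<omega>1 \<omega>2 l = ((\<lambda>X. l *\<^sub>R X) ` \<omega>1) \<times> \<omega>2"

end

theory Submission
  imports Defs
begin

text \<open>
  All infima are computed on test functions: these are competitors themselves, and they are dense
  (\<open>rayleigh_inf_le_test\<close>, \<open>rayleigh_inf_ge_test\<close>). The proof compares test functions on the strip with
  test functions on the cross-section in both directions.

  For the lower bound, the energy of \<open>u\<close> cannot simply be reduced to its part in the \<open>X\<^sub>2\<close>-directions,
  because the block \<open>A12\<close> couples the two groups of variables. Instead \<open>u\<close> is averaged to
  \<open>U(X\<^sub>2) = (\<integral> \<bar>u\<bar>\<^sup>p dX\<^sub>1)\<^bsup>1/p\<^esup>\<close>, which preserves the mass. The convex function
  \<open>\<xi> \<mapsto> (A \<xi> \<cdot> \<xi>)\<^bsup>p/2\<^esup>\<close> lies above its tangent at the vector \<open>(\<bar>u\<bar> / U) (0, \<nabla>U)\<close> (Picone's inequality), and the tangent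
  involves only \<open>A12\<close> and \<open>A22\<close>, evaluated at \<open>X\<^sub>2\<close>. When it is integrated over \<open>X\<^sub>1\<close>, the \<open>A12\<close>-term becomes the integral of an
  \<open>X\<^sub>1\<close>-derivative of \<open>\<bar>u\<bar>\<^sup>p\<close> and vanishes, and the \<open>A22\<close>-term reproduces \<open>\<nabla>(U\<^sup>p)\<close>. So \<open>U\<close> has at
  most the energy of \<open>u\<close>. Smoothness of the average is ensured by a regularisation that is removed at the end
  (\<open>energy_strip_ge_section\<close>, \<open>mu_le_on_strip\<close>).

  For the upper bound, the competitor on the cylinder is \<open>v(X\<^sub>1 / l) W(X\<^sub>2)\<close> with a fixed bump \<open>v\<close> and a
  nearly optimal \<open>W\<close>. The energy density is expanded to second order in the small part
  \<open>W \<nabla>v / l\<close> of the gradient (\<open>powr_quadratic_expansion\<close>). The first-order term is an \<open>X\<^sub>1\<close>-derivative of \<open>v\<^sup>p\<close> times a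
  function of \<open>X\<^sub>2\<close> and integrates to zero, so the error is \<open>O(l\<^bsup>-2\<^esup>) + O(l\<^bsup>-p\<^esup>)\<close>, with constants that stay bounded as \<open>W\<close>
  approaches the infimum (\<open>energy_product_le\<close>, \<open>rayleigh_inf_cylinder_le\<close>). Being \<open>o(1 / l)\<close>, the error is below
  \<open>C / l\<close> for large \<open>l\<close> with a constant that is common to all \<open>\<omega>\<^sub>1\<close>.

  The strip satisfies the lower bound too, and its infimum is at most that of any cylinder; letting
  \<open>l\<close> tend to infinity identifies it with that of the cross-section.
\<close>

section \<open>Calculus of smooth functions\<close>

abbreviation partial :: "'a::euclidean_space \<Rightarrow> ('a \<Rightarrow> real) \<Rightarrow> 'a \<Rightarrow> real" where
  "partial b f \<equiv> (\<lambda>x. frechet_derivative f (at x) b)"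

text \<open>
  The iterated partial derivatives in the definition of smoothness are peeled off from the outside, which
  is the wrong end for proving closure properties: the derivative of a product or of a composition is
  known only for the first differentiation. This recursion peels off the innermost derivative, so
  that closure of the smooth functions under an operation follows by induction on the order.
\<close>

primrec times_differentiable :: "nat \<Rightarrow> ('a::euclidean_space \<Rightarrow> real) \<Rightarrow> bool" where
  "times_differentiable 0 f = True"
| "times_differentiable (Suc n) f = ((\<forall>x. f differentiable (at x)) \<and> (\<forall>b\<in>Basis. times_differentiable n (partial b f)))"

lemma iterated_partial_snoc:
  "iterated_partial (bs @ [b]) f = iterated_partial bs (partial b f)"
  by (induction bs) auto

lemma times_differentiable_iff_iterated_partial:
  "times_differentiable n f \<longleftrightarrow> (\<forall>bs. set bs \<subseteq> Basis \<and> length bs < n \<longrightarrow> (\<forall>x. iterated_partial bs f differentiable (at x)))"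
proof (induction n arbitrary: f)
  case (Suc n)
  show ?case (is "?l \<longleftrightarrow> ?r")
  proof
    assume l: ?l
    show ?r
    proof (intro allI impI)
      fix bs :: "'a list" and x
      assume bs: "set bs \<subseteq> Basis \<and> length bs < Suc n"
      show "iterated_partial bs f differentiable (at x)"
      proof (cases bs rule: rev_cases)
        case Nil
        then show ?thesis using l by simp
      next
        case (snoc cs b)
        then have "times_differentiable n (partial b f)" "set cs \<subseteq> Basis \<and> length cs < n"
          using l bs by auto
        then show ?thesis
          using Suc.IH snoc by (auto simp: iterated_partial_snoc)
      qed
    qed
  next
    assume r: ?r
    have "f differentiable (at x)" for x
      using r[rule_format, of "[]" x] by simp
    moreover have "times_differentiable n (partial b f)" if "b \<in> Basis" for b
      unfolding Suc.IH
    proof (intro allI impI)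
      fix bs :: "'a list" and x
      assume "set bs \<subseteq> Basis \<and> length bs < n"
      then show "iterated_partial bs (partial b f) differentiable (at x)"
        using r[rule_format, of "bs @ [b]" x] that by (auto simp: iterated_partial_snoc)
    qed
    ultimately show ?l by simp
  qed
qed simp

lemma smooth_iff_times_differentiable: "smooth f \<longleftrightarrow> (\<forall>n. times_differentiable n f)"
  unfolding smooth_def times_differentiable_iff_iterated_partial by blast

lemma times_differentiable_Suc_imp: "times_differentiable (Suc n) f \<Longrightarrow> times_differentiable n f"
  by (induction n arbitrary: f) auto

lemma partial_eq:
  assumes "(f has_derivative f') (at x)"
  shows "frechet_derivative f (at x) b = f' b"
  using frechet_derivative_at[OF assms] by simp

text \<open>
  A derivative is linear, hence determined by its values on the basis, and these are the entries of the
  gradient.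
\<close>

lemma has_derivative_gradient:
  fixes f :: "'a::euclidean_space \<Rightarrow> real"
  assumes "f differentiable (at x)"
  shows "(f has_derivative (\<lambda>h. gradient f x \<bullet> h)) (at x)"
proof -
  have d: "(f has_derivative frechet_derivative f (at x)) (at x)"
    using assms frechet_derivative_works by blast
  then interpret l: linear "frechet_derivative f (at x)"
    by (rule has_derivative_linear)
  have "frechet_derivative f (at x) h = gradient f x \<bullet> h" for h
  proof -
    have "frechet_derivative f (at x) h = frechet_derivative f (at x) (\<Sum>b\<in>Basis. (h \<bullet> b) *\<^sub>R b)"
      by (simp add: euclidean_representation)
    also have "\<dots> = (\<Sum>b\<in>Basis. (h \<bullet> b) * frechet_derivative f (at x) b)"
      by (simp add: l.sum l.scaleR)
    also have "\<dots> = gradient f x \<bullet> h"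
      unfolding gradient_def inner_sum_left inner_scaleR_left
      by (intro sum.cong refl) (simp add: inner_commute)
    finally show ?thesis .
  qed
  then have "frechet_derivative f (at x) = (\<lambda>h. gradient f x \<bullet> h)" by blast
  then show ?thesis using d by simp
qed

lemma frechet_gradient:
  fixes f :: "'a::euclidean_space \<Rightarrow> real"
  assumes "f differentiable (at x)"
  shows "frechet_derivative f (at x) h = gradient f x \<bullet> h"
  by (rule partial_eq[OF has_derivative_gradient[OF assms]])

lemma gradient_eqI:
  fixes f :: "'a::euclidean_space \<Rightarrow> real"
  assumes "(f has_derivative (\<lambda>h. v \<bullet> h)) (at x)"
  shows "gradient f x = v"
  unfolding gradient_def partial_eq[OF assms] by (rule euclidean_representation)

lemma times_differentiable_const: "times_differentiable n (\<lambda>x. c)"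
proof (induction n arbitrary: c)
  case (Suc n)
  have "partial b (\<lambda>x::'a. c) = (\<lambda>x. 0)" for b
    by (rule ext, rule partial_eq) (rule has_derivative_const)
  then show ?case using Suc by simp
qed simp

lemma times_differentiable_add:
  assumes "times_differentiable n f" "times_differentiable n g"
  shows "times_differentiable n (\<lambda>x. f x + g x)"
  using assms
proof (induction n arbitrary: f g)
  case (Suc n)
  then have d: "f differentiable (at x)" "g differentiable (at x)" for x by auto
  have "partial b (\<lambda>x. f x + g x) = (\<lambda>x. partial b f x + partial b g x)" for b
    by (rule ext, rule partial_eq)
      (use d frechet_derivative_works in \<open>blast intro: has_derivative_add\<close>)
  then show ?case using Suc d by (auto intro: differentiable_add)
qed simp

lemma times_differentiable_mult:
  assumes "times_differentiable n f" "times_differentiable n g"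
  shows "times_differentiable n (\<lambda>x. f x * g x)"
  using assms
proof (induction n arbitrary: f g)
  case (Suc n)
  then have d: "f differentiable (at x)" "g differentiable (at x)" for x by auto
  have "partial b (\<lambda>x. f x * g x) = (\<lambda>x. f x * partial b g x + partial b f x * g x)" for b
    by (rule ext, rule partial_eq[OF has_derivative_mult])
      (use d frechet_derivative_works in blast)+
  moreover have "times_differentiable n f" "times_differentiable n g" using Suc.prems times_differentiable_Suc_imp by blast+
  ultimately show ?case using Suc d by (auto intro: differentiable_mult times_differentiable_add)
qed simp

lemma times_differentiable_sum: "(\<And>i. i \<in> I \<Longrightarrow> times_differentiable n (f i)) \<Longrightarrow> times_differentiable n (\<lambda>x. \<Sum>i\<in>I. f i x)"
  by (induction I rule: infinite_finite_induct) (auto intro: times_differentiable_add times_differentiable_const)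

lemma times_differentiable_bounded_linear:
  assumes "bounded_linear f" shows "times_differentiable n f"
proof (cases n)
  case (Suc k)
  have "(f has_derivative f) (at x)" for x
    using bounded_linear.has_derivative[OF assms has_derivative_ident] by simp
  then have "f differentiable (at x)" "partial b f = (\<lambda>x. f b)" for x b
    by (auto simp: differentiable_def partial_eq)
  then show ?thesis using Suc by (simp add: times_differentiable_const)
qed simp

lemma times_differentiable_compose_linear:
  fixes f :: "'b::euclidean_space \<Rightarrow> real" and L :: "'a::euclidean_space \<Rightarrow> 'b"
  assumes L: "bounded_linear L" and f: "times_differentiable n f"
  shows "times_differentiable n (\<lambda>x. f (L x))"
  using f
proof (induction n arbitrary: f)
  case (Suc n)
  then have d: "f differentiable (at x)" for x by auto
  have D: "((\<lambda>x. f (L x)) has_derivative (\<lambda>h. gradient f (L x) \<bullet> L h)) (at x)" for x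
    using has_derivative_compose[OF bounded_linear_imp_has_derivative[OF L] has_derivative_gradient[OF d]] .
  have "partial b (\<lambda>x. f (L x)) = (\<lambda>x. \<Sum>c\<in>Basis. (L b \<bullet> c) * partial c f (L x))" for b
    unfolding partial_eq[OF D] gradient_def inner_sum_left inner_scaleR_left
    by (intro ext sum.cong refl) (simp add: inner_commute)
  moreover have "times_differentiable n (\<lambda>x. \<Sum>c\<in>Basis. (L b \<bullet> c) * partial c f (L x))" for b
    by (intro times_differentiable_sum times_differentiable_mult times_differentiable_const Suc.IH) (use Suc.prems in auto)
  ultimately show ?case using D by (auto simp: differentiable_def)
qed simp

lemma partial_chain_real:
  assumes d: "f differentiable (at x)" and h: "(h has_real_derivative h' ) (at (f x))"
  shows "((\<lambda>x. h (f x)) has_derivative (\<lambda>v. h' * frechet_derivative f (at x) v)) (at x)"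
  using has_derivative_compose[OF d[unfolded frechet_derivative_works]
      h[unfolded has_field_derivative_def]] .

text \<open>
  A chain rule for all orders at once: instead of derivatives of every order of the outer function, a
  family closed under differentiation is prescribed, so that the induction on the order can move
  inside the family. For the powers of a positive function the family consists of all \<open>c t\<^sup>a\<close>.
\<close>

lemma times_differentiable_compose_family:
  fixes f :: "'a::euclidean_space \<Rightarrow> real"
  assumes H: "\<And>h. h \<in> H \<Longrightarrow> \<exists>h'\<in>H. \<forall>t\<in>S. (h has_real_derivative h' t) (at t)"
    and S: "\<And>x. f x \<in> S" and f: "times_differentiable n f" and h: "h \<in> H"
  shows "times_differentiable n (\<lambda>x. h (f x))"
  using f h
proof (induction n arbitrary: h)
  case (Suc n)
  then have d: "f differentiable (at x)" for x by auto
  obtain h' where h': "h' \<in> H" "\<forall>t\<in>S. (h has_real_derivative h' t) (at t)"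
    using H Suc.prems by blast
  have D: "((\<lambda>x. h (f x)) has_derivative (\<lambda>v. h' (f x) * frechet_derivative f (at x) v)) (at x)" for x
    by (rule partial_chain_real) (use d h' S in auto)
  have "partial b (\<lambda>x. h (f x)) = (\<lambda>x. h' (f x) * partial b f x)" for b
    unfolding partial_eq[OF D] ..
  moreover have "times_differentiable n (\<lambda>x. h' (f x) * partial b f x)" if "b \<in> Basis" for b
    using Suc h' times_differentiable_Suc_imp that by (intro times_differentiable_mult) auto
  ultimately show ?case using D by (auto simp: differentiable_def)
qed simp

lemma times_differentiable_powr:
  assumes "times_differentiable n f" "\<And>x. f x > 0"
  shows "times_differentiable n (\<lambda>x. f x powr a)"
proof -
  let ?H = "{h :: real \<Rightarrow> real. \<exists>c a. h = (\<lambda>t. c * t powr a)}"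
  have *: "\<exists>h'\<in>?H. \<forall>t\<in>{0<..}. (h has_real_derivative h' t) (at t)" if "h \<in> ?H" for h
  proof -
    obtain c a where h: "h = (\<lambda>t. c * t powr a)" using \<open>h \<in> ?H\<close> by blast
    have "(h has_real_derivative (c*a) * t powr (a-1)) (at t)" if "t > 0" for t
      unfolding h using that by (auto intro!: derivative_eq_intros simp: powr_diff)
    then show ?thesis
      by (intro bexI[of _ "\<lambda>t. (c*a) * t powr (a-1)"]) auto
  qed
  have "(\<lambda>t. 1 * t powr a) \<in> ?H" by blast
  from times_differentiable_compose_family[OF * _ assms(1) this] show ?thesis
    using assms(2) by simp
qed

text \<open>
  These functions are flat at the origin; the one with \<open>k = 0\<close> is the classical smooth function
  \<open>exp (- 1 / t)\<close> extended by zero, and the others are the terms that its derivatives are built of.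
\<close>

definition flat_exp :: "nat \<Rightarrow> real \<Rightarrow> real" where
  "flat_exp k t = (if t > 0 then (1/t)^k * exp (- (1/t)) else 0)"

lemma flat_exp_tendsto_0: "(flat_exp k \<longlongrightarrow> 0) (at_right 0)"
proof -
  have "((\<lambda>t::real. inverse t ^ k / exp (inverse t)) \<longlongrightarrow> 0) (at_right 0)"
    by (rule filterlim_compose[OF tendsto_power_div_exp_0 filterlim_inverse_at_top_right])
  moreover have "\<forall>\<^sub>F t in at_right 0. inverse t ^ k / exp (inverse t) = flat_exp k t"
    by (auto simp: eventually_at_filter flat_exp_def exp_minus divide_inverse)
  ultimately show ?thesis by (rule Lim_transform_eventually)
qed

text \<open>
  At the origin the difference quotient of the function with index \<open>k\<close> is the function with index \<open>k + 1\<close>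
  to the right and zero to the left, so it tends to zero as well.
\<close>

lemma flat_exp_derivative:
  "(flat_exp k has_real_derivative (flat_exp (k+2) t - real k * flat_exp (k+1) t)) (at t)"
proof -
  consider "t > 0" | "t < 0" | "t = 0" by linarith
  then show ?thesis
  proof cases
    case 1
    define s where "s = 1 / t"
    have inv: "((\<lambda>t. 1 / t) has_real_derivative - (s^2)) (at t)"
      using 1 by (auto intro!: derivative_eq_intros simp: s_def power2_eq_square)
    have "((\<lambda>t. (1/t)^k * exp (- (1/t))) has_real_derivative
        s^k * (exp (- s) * - (- (s^2))) + (real k * (- (s^2)) * s^(k - 1)) * exp (- s)) (at t)"
      unfolding s_def using inv[unfolded s_def]
      by (intro DERIV_mult' DERIV_chain2[OF DERIV_exp] DERIV_minus) (auto intro: DERIV_cong[OF DERIV_power[OF inv[unfolded s_def]]])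
    moreover have "s^k * (exp (- s) * - (- (s^2))) + (real k * (- (s^2)) * s^(k - 1)) * exp (- s)
        = flat_exp (k+2) t - real k * flat_exp (k+1) t"
      using 1 by (cases k) (simp_all add: flat_exp_def flip: s_def, simp_all add: algebra_simps power2_eq_square)
    ultimately have "((\<lambda>t. (1/t)^k * exp (- (1/t))) has_real_derivative (flat_exp (k+2) t - real k * flat_exp (k+1) t)) (at t)"
      by (rule DERIV_cong)
    then show ?thesis
      by (rule has_field_derivative_transform_within_open[where S="{0<..}"])
        (use 1 in \<open>auto simp: flat_exp_def\<close>)
  next
    case 2
    have "((\<lambda>t. 0) has_real_derivative 0) (at t)" by simp
    then show ?thesis
      by (rule has_field_derivative_transform_within_open[where S="{..<0}", THEN DERIV_cong])
        (use 2 in \<open>auto simp: flat_exp_def\<close>)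
  next
    case 3
    have "((\<lambda>h. flat_exp k h / h) \<longlongrightarrow> 0) (at 0)"
    proof (rule filterlim_split_at)
      show "((\<lambda>h. flat_exp k h / h) \<longlongrightarrow> 0) (at_left 0)"
        by (rule tendsto_eventually) (auto simp: eventually_at_filter flat_exp_def)
      have "\<forall>\<^sub>F h in at_right 0. flat_exp (Suc k) h = flat_exp k h / h"
        by (auto simp: eventually_at_filter flat_exp_def)
      then show "((\<lambda>h. flat_exp k h / h) \<longlongrightarrow> 0) (at_right 0)"
        using flat_exp_tendsto_0 by (rule Lim_transform_eventually[rotated])
    qed
    then show ?thesis using 3 by (simp add: DERIV_def flat_exp_def)
  qed
qed

lemma times_differentiable_flat_exp:
  fixes f :: "'a::euclidean_space \<Rightarrow> real"
  assumes "times_differentiable n f"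
  shows "times_differentiable n (\<lambda>x. flat_exp k (f x))"
  using assms
proof (induction n arbitrary: k)
  case (Suc n)
  then have d: "f differentiable (at x)" for x by auto
  have D: "((\<lambda>x. flat_exp k (f x)) has_derivative
      (\<lambda>v. (flat_exp (k+2) (f x) - real k * flat_exp (k+1) (f x)) * frechet_derivative f (at x) v)) (at x)" for x
    by (rule partial_chain_real[OF d flat_exp_derivative])
  have "partial b (\<lambda>x. flat_exp k (f x)) =
    (\<lambda>x. (flat_exp (k+2) (f x) + (- real k) * flat_exp (k+1) (f x)) * partial b f x)" for b
    unfolding partial_eq[OF D] by simp
  moreover have "times_differentiable n (\<lambda>x. (flat_exp (k+2) (f x) + (- real k) * flat_exp (k+1) (f x)) * partial b f x)"
    if "b \<in> Basis" for b
    using Suc.prems that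
    by (intro times_differentiable_mult times_differentiable_add times_differentiable_const Suc.IH times_differentiable_Suc_imp[OF Suc.prems]) simp
  moreover have "(\<lambda>x. flat_exp k (f x)) differentiable (at x)" for x
    using D unfolding differentiable_def by blast
  ultimately show ?case by simp
qed simp

lemma smooth_const: "smooth (\<lambda>x. c)"
  unfolding smooth_iff_times_differentiable by (simp add: times_differentiable_const)

lemma smooth_add: "smooth f \<Longrightarrow> smooth g \<Longrightarrow> smooth (\<lambda>x. f x + g x)"
  unfolding smooth_iff_times_differentiable by (simp add: times_differentiable_add)

lemma smooth_mult: "smooth f \<Longrightarrow> smooth g \<Longrightarrow> smooth (\<lambda>x. f x * g x)"
  unfolding smooth_iff_times_differentiable by (simp add: times_differentiable_mult)

lemma smooth_sum: "(\<And>i. i \<in> I \<Longrightarrow> smooth (F i)) \<Longrightarrow> smooth (\<lambda>x. \<Sum>i\<in>I. F i x)"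
  unfolding smooth_iff_times_differentiable by (simp add: times_differentiable_sum)

lemma smooth_bounded_linear: "bounded_linear f \<Longrightarrow> smooth f"
  unfolding smooth_iff_times_differentiable by (simp add: times_differentiable_bounded_linear)

lemma smooth_powr: "smooth f \<Longrightarrow> (\<And>x. f x > 0) \<Longrightarrow> smooth (\<lambda>x. f x powr a)"
  unfolding smooth_iff_times_differentiable by (simp add: times_differentiable_powr)

lemma smooth_flat_exp: "smooth f \<Longrightarrow> smooth (\<lambda>x. flat_exp k (f x))"
  unfolding smooth_iff_times_differentiable by (simp add: times_differentiable_flat_exp)

lemma smooth_compose_linear: "smooth f \<Longrightarrow> bounded_linear L \<Longrightarrow> smooth (\<lambda>x. f (L x))"
  by (simp add: smooth_iff_times_differentiable times_differentiable_compose_linear)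

lemma smooth_differentiable: "smooth f \<Longrightarrow> f differentiable (at x)"
  unfolding smooth_def by (auto dest: spec[of _ "[]"])

lemma smooth_partial_basis: "smooth f \<Longrightarrow> b \<in> Basis \<Longrightarrow> smooth (partial b f)"
  unfolding smooth_iff_times_differentiable by (metis times_differentiable.simps(2))

lemma smooth_has_derivative:
  "smooth f \<Longrightarrow> (f has_derivative (\<lambda>h. gradient f x \<bullet> h)) (at x)"
  by (rule has_derivative_gradient[OF smooth_differentiable])

lemma smooth_continuous: "smooth f \<Longrightarrow> continuous_on S f"
  by (meson continuous_at_imp_continuous_on differentiable_imp_continuous_within smooth_differentiable)

lemma smooth_continuous_gradient: "smooth f \<Longrightarrow> continuous_on S (gradient f)"
  unfolding gradient_def
  by (intro continuous_on_sum continuous_on_scaleR continuous_on_const smooth_continuous smooth_partial_basis)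

lemma smooth_gradient_measurable: "smooth f \<Longrightarrow> gradient f \<in> borel_measurable borel"
  by (intro borel_measurable_continuous_onI smooth_continuous_gradient)

lemma smooth_measurable: "smooth f \<Longrightarrow> f \<in> borel_measurable borel"
  by (intro borel_measurable_continuous_onI smooth_continuous)

text \<open>
  Differentiation under the integral sign. The compact box of integration keeps the derivative of the
  integrand uniformly continuous near a given parameter.
\<close>

lemma integral_parameter_has_derivative:
  fixes g :: "'a::euclidean_space \<times> 'b::euclidean_space \<Rightarrow> real"
  assumes g: "smooth g"
  shows "((\<lambda>y. integral (cbox a b) (\<lambda>x. g (x, y))) has_derivative
      (\<lambda>h. integral (cbox a b) (\<lambda>x. gradient g (x, y) \<bullet> (0, h)))) (at y)"
proof -
  let ?fx = "\<lambda>y x. blinfun_inner_left (snd (gradient g (x, y)))"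
  have "((\<lambda>y. integral (cbox a b) (\<lambda>x. g (x, y))) has_derivative integral (cbox a b) (?fx y)) (at y within UNIV)"
  proof (rule leibniz_rule)
    fix y :: 'b and x :: 'a
    have "((\<lambda>y. g (x, y)) has_derivative (\<lambda>h. gradient g (x, y) \<bullet> (0, h))) (at y)"
      by (rule has_derivative_compose[OF _ smooth_has_derivative[OF g], of "\<lambda>y. (x, y)"])
        (intro derivative_intros)
    moreover have "blinfun_apply (?fx y x) = (\<lambda>h. gradient g (x, y) \<bullet> (0, h))"
      by (auto simp: inner_prod_def inner_commute)
    ultimately show "((\<lambda>y. g (x, y)) has_derivative blinfun_apply (?fx y x)) (at y within UNIV)"
      by simp
  next
    fix y
    show "(\<lambda>x. g (x, y)) integrable_on cbox a b"
      by (intro integrable_continuous continuous_on_compose2[OF smooth_continuous[OF g, of UNIV]] continuous_intros) auto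
  next
    show "continuous_on (UNIV \<times> cbox a b) (\<lambda>(y, x). ?fx y x)"
      unfolding case_prod_beta
      by (intro bounded_linear.continuous_on[OF bounded_linear_blinfun_inner_left] continuous_intros
          continuous_on_compose2[OF smooth_continuous_gradient[OF g, of UNIV]]) auto
  qed auto
  moreover have "blinfun_apply (integral (cbox a b) (?fx y)) h = integral (cbox a b) (\<lambda>x. gradient g (x, y) \<bullet> (0, h))" for h
  proof -
    have i: "?fx y integrable_on cbox a b"
      by (intro integrable_continuous bounded_linear.continuous_on[OF bounded_linear_blinfun_inner_left] continuous_intros
          continuous_on_compose2[OF smooth_continuous_gradient[OF g, of UNIV]]) auto
    have "integral (cbox a b) (\<lambda>x. blinfun_apply (?fx y x) h) = blinfun_apply (integral (cbox a b) (?fx y)) h"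
      using integral_linear[OF i blinfun.bounded_linear_left[of h]] by (simp add: o_def)
    then show ?thesis by (simp add: inner_prod_def inner_commute)
  qed
  ultimately show ?thesis
    by (auto intro: has_derivative_eq_rhs)
qed

lemma smooth_integral_parameter:
  fixes g :: "'a::euclidean_space \<times> 'b::euclidean_space \<Rightarrow> real"
  assumes g: "smooth g"
  shows "smooth (\<lambda>y. integral (cbox a b) (\<lambda>x. g (x, y)))"
  unfolding smooth_iff_times_differentiable
proof
  fix n show "times_differentiable n (\<lambda>y. integral (cbox a b) (\<lambda>x. g (x, y)))"
    using g
  proof (induction n arbitrary: g)
    case (Suc n)
    note D = integral_parameter_has_derivative[OF Suc.prems, of a b]
    have "partial c (\<lambda>y. integral (cbox a b) (\<lambda>x. g (x, y))) = (\<lambda>y. integral (cbox a b) (\<lambda>x. partial (0,c) g (x, y)))" for c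
      unfolding partial_eq[OF D] frechet_gradient[OF smooth_differentiable[OF Suc.prems]] ..
    moreover have sm: "smooth (partial (0,c) g)" if "c \<in> Basis" for c
      using Suc.prems that by (intro smooth_partial_basis) (auto simp: Basis_prod_def)
    moreover have "(\<lambda>y. integral (cbox a b) (\<lambda>x. g (x, y))) differentiable (at y)" for y
      using D unfolding differentiable_def by blast
    moreover have "times_differentiable n (\<lambda>y. integral (cbox a b) (\<lambda>x. partial (0,c) g (x, y)))" if "c \<in> Basis" for c
      by (rule Suc.IH[OF sm[OF that]])
    ultimately show ?case by simp
  qed simp
qed

section \<open>Test functions and integration by parts\<close>

lemma integrable_continuous_compact_support:
  fixes f :: "'a::euclidean_space \<Rightarrow> 'b::{banach, second_countable_topology}"
  assumes "continuous_on UNIV f" "compact K" "\<And>x. x \<notin> K \<Longrightarrow> f x = 0"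
  shows "integrable lborel f"
proof -
  have "integrable lborel (\<lambda>x. indicator K x *\<^sub>R f x)"
    by (rule borel_integrable_compact[OF assms(2) continuous_on_subset[OF assms(1)]]) simp
  moreover have "(\<lambda>x. indicator K x *\<^sub>R f x) = f"
    using assms(3) by (auto simp: indicator_def)
  ultimately show ?thesis by simp
qed

lemma gradient_zero_outside:
  fixes f :: "'a::euclidean_space \<Rightarrow> real"
  assumes "closed K" "\<And>x. x \<notin> K \<Longrightarrow> f x = 0" "x \<notin> K"
  shows "gradient f x = 0"
proof (rule gradient_eqI)
  have "((\<lambda>x. 0::real) has_derivative (\<lambda>h. 0 \<bullet> h)) (at x)"
    by (auto simp: has_derivative_const)
  then show "(f has_derivative (\<lambda>h. 0 \<bullet> h)) (at x)"
    by (rule has_derivative_transform_within_open[where s="- K"]) (use assms in auto)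
qed

lemma test_functionsI:
  assumes "smooth \<phi>" "compact K" "K \<subseteq> \<Omega>" "\<And>x. x \<notin> K \<Longrightarrow> \<phi> x = 0"
  shows "\<phi> \<in> test_functions \<Omega>"
proof -
  have sub: "closure {x. \<phi> x \<noteq> 0} \<subseteq> K"
    by (rule closure_minimal[OF _ compact_imp_closed[OF assms(2)]]) (use assms(4) in blast)
  have "compact (K \<inter> closure {x. \<phi> x \<noteq> 0})"
    using assms(2) by (simp add: compact_Int_closed)
  then have "compact (closure {x. \<phi> x \<noteq> 0})"
    using sub by (simp add: Int_absorb1)
  then show ?thesis
    using assms(1) order_trans[OF sub assms(3)] by (simp add: test_functions_def)
qed

lemma test_function_support:
  assumes "\<phi> \<in> test_functions \<Omega>"
  shows "smooth \<phi> \<and> (\<exists>K. compact K \<and> K \<subseteq> \<Omega> \<and> (\<forall>x. x \<notin> K \<longrightarrow> \<phi> x = 0) \<and> (\<forall>x. x \<notin> K \<longrightarrow> gradient \<phi> x = 0))"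
proof (intro conjI exI allI impI)
  let ?K = "closure {x. \<phi> x \<noteq> 0}"
  show *: "\<phi> x = 0" if "x \<notin> ?K" for x
    using that closure_subset[of "{x. \<phi> x \<noteq> 0}"] by auto
  show "gradient \<phi> x = 0" if "x \<notin> ?K" for x
    by (rule gradient_zero_outside[OF closed_closure * that])
  show "smooth \<phi>" "compact ?K" "?K \<subseteq> \<Omega>"
    using assms by (simp_all add: test_functions_def)
qed

text \<open>
  The difference quotients of \<open>f\<close> in direction \<open>b\<close> have integral zero by translation invariance. They
  converge to the directional derivative and are bounded by its maximum on one fixed
  compact set, so dominated convergence passes this to the limit. Only
  one derivative is involved, so that powers such as \<open>\<bar>v\<bar>\<^sup>p\<close> are covered.
\<close>

lemma integral_directional_derivative_eq_0:
  fixes f :: "'a::euclidean_space \<Rightarrow> real"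
  assumes D: "\<And>x. (f has_derivative F x) (at x)" and cont: "continuous_on UNIV (\<lambda>x. F x b)"
    and K: "compact K" "\<And>x. x \<notin> K \<Longrightarrow> f x = 0"
  shows "(\<integral>x. F x b \<partial>lborel) = 0"
proof -
  have fc: "continuous_on UNIV f"
    by (meson D continuous_at_imp_continuous_on has_derivative_continuous)
  then have [measurable]: "f \<in> borel_measurable borel"
    by (rule borel_measurable_continuous_onI)
  have [measurable]: "(\<lambda>x. F x b) \<in> borel_measurable borel"
    by (rule borel_measurable_continuous_onI[OF cont])
  have F0: "F x b = 0" if "x \<notin> K" for x
  proof -
    have "((\<lambda>x. 0) has_derivative (\<lambda>h. 0)) (at x)" by simp
    then have "(f has_derivative (\<lambda>h. 0)) (at x)"
      by (rule has_derivative_transform_within_open[where s="- K"])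
        (use K that compact_imp_closed in auto)
    from has_derivative_unique[OF D this] show ?thesis by simp
  qed
  have "bounded ((\<lambda>x. F x b) ` K)"
    by (intro compact_imp_bounded compact_continuous_image continuous_on_subset[OF cont] K) auto
  then obtain B where B: "\<And>x. x \<in> K \<Longrightarrow> \<bar>F x b\<bar> \<le> B" "0 < B"
    unfolding bounded_pos by auto
  then have B': "\<bar>F x b\<bar> \<le> B" for x by (cases "x \<in> K") (auto simp: F0)
  \<comment> \<open>All points from which a step of length at most one along \<open>b\<close> can reach \<open>K\<close>: outside, the
    difference quotients vanish.\<close>
  define K' where "K' = (\<lambda>(x, s). x - s *\<^sub>R b) ` (K \<times> {0..1::real})"
  have cK': "compact K'"
    unfolding K'_def by (intro compact_continuous_image compact_Times K)
      (auto simp: case_prod_beta intro!: continuous_intros)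
  define q where "q = (\<lambda>n x. (f (x + (1 / real (Suc n)) *\<^sub>R b) - f x) * real (Suc n))"
  have fi: "integrable lborel f"
    by (rule integrable_continuous_compact_support[OF fc K])
  have ft: "integrable lborel (\<lambda>x. f (x + c))" "(\<integral>x. f (x + c) \<partial>lborel) = (\<integral>x. f x \<partial>lborel)" for c
  proof -
    have "integrable (distr lborel borel ((+) c)) f"
      using fi by (simp add: lborel_distr_plus)
    then show "integrable lborel (\<lambda>x. f (x + c))"
      by (subst (asm) integrable_distr_eq) (auto simp: add.commute)
    have "(\<integral>x. f x \<partial>lborel) = (\<integral>x. f x \<partial>distr lborel borel ((+) c))"
      by (simp add: lborel_distr_plus)
    also have "\<dots> = (\<integral>x. f (c + x) \<partial>lborel)"
      by (rule integral_distr) auto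
    finally show "(\<integral>x. f (x + c) \<partial>lborel) = (\<integral>x. f x \<partial>lborel)"
      by (simp add: add.commute)
  qed
  have q0: "(\<integral>x. q n x \<partial>lborel) = 0" for n
    unfolding q_def using fi ft by simp
  have "(\<lambda>n. \<integral>x. q n x \<partial>lborel) \<longlonglongrightarrow> (\<integral>x. F x b \<partial>lborel)"
  proof (rule integral_dominated_convergence[where w="\<lambda>x. indicator K' x * B"])
    have "integrable lborel (\<lambda>x. indicator K' x *\<^sub>R B)"
      by (rule borel_integrable_compact[OF cK']) auto
    then show "integrable lborel (\<lambda>x. indicator K' x * B)" by simp
    have deriv: "((\<lambda>t. f (x + t *\<^sub>R b)) has_real_derivative F (x + t *\<^sub>R b) b) (at t)" for x t
    proof -
      have "((\<lambda>t. f (x + t *\<^sub>R b)) has_derivative (\<lambda>h. F (x + t *\<^sub>R b) (h *\<^sub>R b))) (at t)"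
        by (rule has_derivative_compose[OF _ D]) (auto intro!: derivative_eq_intros)
      moreover have "F (x + t *\<^sub>R b) (h *\<^sub>R b) = F (x + t *\<^sub>R b) b * h" for h
        using has_derivative_linear[OF D] by (simp add: linear_scale)
      ultimately show ?thesis by (simp add: has_field_derivative_def)
    qed
    show "AE x in lborel. (\<lambda>n. q n x) \<longlonglongrightarrow> F x b"
    proof (rule AE_I2)
      fix x
      have "((\<lambda>h. (f (x + h *\<^sub>R b) - f x) / h) \<longlongrightarrow> F x b) (at 0)"
        using deriv[of x 0] by (simp add: DERIV_def)
      moreover have "filterlim (\<lambda>n. 1 / real (Suc n)) (at 0) sequentially"
        unfolding filterlim_at using LIMSEQ_inverse_real_of_nat by (simp add: inverse_eq_divide)
      ultimately have "(\<lambda>n. (f (x + (1 / real (Suc n)) *\<^sub>R b) - f x) / (1 / real (Suc n))) \<longlonglongrightarrow> F x b"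
        by (rule filterlim_compose)
      then show "(\<lambda>n. q n x) \<longlonglongrightarrow> F x b" by (simp add: q_def)
    qed
    fix n
    define h where "h = 1 / real (Suc n)"
    have h: "0 < h" "h \<le> 1" "real (Suc n) = 1 / h" by (auto simp: h_def)
    show "AE x in lborel. norm (q n x) \<le> indicator K' x * B"
    proof (rule AE_I2)
      fix x
      show "norm (q n x) \<le> indicator K' x * B"
      proof (cases "x \<in> K'")
        case True
        obtain z where "0 < z" "z < h" "f (x + h *\<^sub>R b) - f (x + 0 *\<^sub>R b) = (h - 0) * F (x + z *\<^sub>R b) b"
          using MVT2[of 0 h "\<lambda>t. f (x + t *\<^sub>R b)" "\<lambda>t. F (x + t *\<^sub>R b) b"] h deriv by blast
        then have "q n x = F (x + z *\<^sub>R b) b"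
          using h by (simp add: q_def h(3) flip: h_def)
        then show ?thesis using B' True by simp
      next
        case False
        have "x \<notin> K" "x + h *\<^sub>R b \<notin> K"
        proof -
          have *: "y - s *\<^sub>R b \<in> K'" if "y \<in> K" "s \<in> {0..1}" for y s
            unfolding K'_def using that by (intro image_eqI[where x="(y, s)"]) auto
          show "x \<notin> K" using False *[of x 0] by auto
          show "x + h *\<^sub>R b \<notin> K" using False h *[of "x + h *\<^sub>R b" h] by auto
        qed
        then have "f x = 0" "f (x + h *\<^sub>R b) = 0" using K(2) by blast+
        then have "q n x = 0" unfolding q_def h_def[symmetric] by simp
        then show ?thesis using B(2) by simp
      qed
    qed
  qed (unfold q_def, measurable)
  then show ?thesis using q0 LIMSEQ_unique by (simp add: LIMSEQ_const_iff)
qed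

text \<open>
  Functions that vanish off the domain are integrated over the whole space below; this frees the later
  arguments from carrying the domain, and makes the energy of a test function independent of the
  domain in which it is considered.
\<close>

lemma integral_lebesgue_on_eq_lebesgue:
  fixes f :: "'a::euclidean_space \<Rightarrow> real"
  assumes "\<Omega> \<in> sets lebesgue" "\<And>x. x \<notin> \<Omega> \<Longrightarrow> f x = 0"
  shows "integral\<^sup>L (lebesgue_on \<Omega>) f = integral\<^sup>L lebesgue f"
    "integrable (lebesgue_on \<Omega>) f \<longleftrightarrow> integrable lebesgue f"
proof -
  have "(\<lambda>x. indicator \<Omega> x *\<^sub>R f x) = f" using assms(2) by (auto simp: indicator_def fun_eq_iff)
  then show "integral\<^sup>L (lebesgue_on \<Omega>) f = integral\<^sup>L lebesgue f"
    "integrable (lebesgue_on \<Omega>) f \<longleftrightarrow> integrable lebesgue f"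
    using assms(1) by (simp_all add: integral_restrict_space integrable_restrict_space)
qed

lemma integral_lebesgue_on_eq_lborel:
  fixes f :: "'a::euclidean_space \<Rightarrow> real"
  assumes "\<Omega> \<in> sets lebesgue" "\<And>x. x \<notin> \<Omega> \<Longrightarrow> f x = 0" "f \<in> borel_measurable borel"
  shows "integral\<^sup>L (lebesgue_on \<Omega>) f = integral\<^sup>L lborel f"
    "integrable (lebesgue_on \<Omega>) f \<longleftrightarrow> integrable lborel f"
  using integral_lebesgue_on_eq_lebesgue[OF assms(1,2)] assms(3)
  by (simp_all add: integral_completion integrable_completion)

text \<open>
  Integration by parts: the derivative of \<open>u \<phi>\<close> has integral zero because \<open>\<phi>\<close> has compact support.
\<close>

lemma weak_gradient_smooth:
  fixes u :: "'a::euclidean_space \<Rightarrow> real"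
  assumes u: "smooth u" and \<Omega>: "open \<Omega>"
  shows "weak_gradient \<Omega> u (gradient u)"
  unfolding weak_gradient_def
proof (intro ballI)
  fix \<phi> :: "'a \<Rightarrow> real" and b :: 'a assume \<phi>: "\<phi> \<in> test_functions \<Omega>" and "b \<in> Basis"
  obtain K where K: "smooth \<phi>" "compact K" "K \<subseteq> \<Omega>" "\<And>x. x \<notin> K \<Longrightarrow> \<phi> x = 0" "\<And>x. x \<notin> K \<Longrightarrow> gradient \<phi> x = 0"
    using test_function_support[OF \<phi>] by blast
  have nK: "x \<notin> K" if "x \<notin> \<Omega>" for x using K(3) that by blast
  have fd: "frechet_derivative \<phi> (at x) b = gradient \<phi> x \<bullet> b" for x
    by (rule frechet_gradient[OF smooth_differentiable[OF K(1)]])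
  note c = smooth_continuous[OF u] smooth_continuous[OF K(1)] smooth_continuous_gradient[OF u] smooth_continuous_gradient[OF K(1)]
  have \<Omega>': "\<Omega> \<in> sets lebesgue" using \<Omega> by simp
  have 1: "continuous_on UNIV (\<lambda>x. u x * (gradient \<phi> x \<bullet> b))" "continuous_on UNIV (\<lambda>x. (gradient u x \<bullet> b) * \<phi> x)"
    by (intro continuous_intros c)+
  have i: "integrable lborel (\<lambda>x. u x * (gradient \<phi> x \<bullet> b))" "integrable lborel (\<lambda>x. (gradient u x \<bullet> b) * \<phi> x)"
    by (rule integrable_continuous_compact_support[OF 1(1) K(2)], simp add: K)
      (rule integrable_continuous_compact_support[OF 1(2) K(2)], simp add: K)
  have "(\<integral>x. (\<lambda>x h. u x * (gradient \<phi> x \<bullet> h) + (gradient u x \<bullet> h) * \<phi> x) x b \<partial>lborel) = 0"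
  proof (rule integral_directional_derivative_eq_0)
    show "((\<lambda>x. u x * \<phi> x) has_derivative (\<lambda>h. u x * (gradient \<phi> x \<bullet> h) + (gradient u x \<bullet> h) * \<phi> x)) (at x)" for x
      by (intro has_derivative_mult smooth_has_derivative u K)
    show "continuous_on UNIV (\<lambda>x. u x * (gradient \<phi> x \<bullet> b) + (gradient u x \<bullet> b) * \<phi> x)"
      by (intro continuous_intros c)
  qed (use K in auto)
  then have "(\<integral>x. u x * (gradient \<phi> x \<bullet> b) \<partial>lborel) = - (\<integral>x. (gradient u x \<bullet> b) * \<phi> x \<partial>lborel)"
    using i by simp
  moreover have "(\<integral>x. u x * (gradient \<phi> x \<bullet> b) \<partial>lebesgue_on \<Omega>) = (\<integral>x. u x * (gradient \<phi> x \<bullet> b) \<partial>lborel)"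
    by (rule integral_lebesgue_on_eq_lborel[OF \<Omega>' _ borel_measurable_continuous_onI[OF 1(1)]]) (simp add: K(5)[OF nK])
  moreover have "(\<integral>x. (gradient u x \<bullet> b) * \<phi> x \<partial>lebesgue_on \<Omega>) = (\<integral>x. (gradient u x \<bullet> b) * \<phi> x \<partial>lborel)"
    by (rule integral_lebesgue_on_eq_lborel[OF \<Omega>' _ borel_measurable_continuous_onI[OF 1(2)]]) (simp add: K(4)[OF nK])
  ultimately show "(\<integral>x. u x * frechet_derivative \<phi> (at x) b \<partial>lebesgue_on \<Omega>) = - (\<integral>x. (gradient u x \<bullet> b) * \<phi> x \<partial>lebesgue_on \<Omega>)"
    by (simp add: fd)
qed

lemma continuous_on_norm_powr:
  fixes f :: "'a::topological_space \<Rightarrow> 'b::real_normed_vector"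
  assumes "continuous_on S f" "0 < p"
  shows "continuous_on S (\<lambda>x. norm (f x) powr p)"
  by (intro continuous_on_powr' continuous_intros assms) (use assms in auto)

lemma integrable_powr_compact_support:
  fixes f :: "'a::euclidean_space \<Rightarrow> 'b::real_normed_vector"
  assumes "continuous_on UNIV f" "compact K" "\<And>x. x \<notin> K \<Longrightarrow> f x = 0" "0 < p"
  shows "integrable lborel (\<lambda>x. norm (f x) powr p)"
  by (rule integrable_continuous_compact_support[OF continuous_on_norm_powr assms(2)]) (use assms in auto)

lemma test_function_W1p_0:
  fixes \<phi> :: "'a::euclidean_space \<Rightarrow> real"
  assumes \<phi>: "\<phi> \<in> test_functions \<Omega>" and \<Omega>: "open \<Omega>" and p: "0 < p"
  shows "W1p_0 p \<Omega> \<phi> (gradient \<phi>)"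
proof -
  obtain K where K: "smooth \<phi>" "compact K" "K \<subseteq> \<Omega>" "\<And>x. x \<notin> K \<Longrightarrow> \<phi> x = 0" "\<And>x. x \<notin> K \<Longrightarrow> gradient \<phi> x = 0"
    using test_function_support[OF \<phi>] by blast
  have \<Omega>': "\<Omega> \<in> sets lebesgue" using \<Omega> by simp
  note c = smooth_continuous[OF K(1)] smooth_continuous_gradient[OF K(1)]
  note m = smooth_measurable[OF K(1)] smooth_gradient_measurable[OF K(1)]
  have meas: "\<phi> \<in> borel_measurable (lebesgue_on \<Omega>)" "gradient \<phi> \<in> borel_measurable (lebesgue_on \<Omega>)"
    using m by (auto intro!: measurable_restrict_space1 measurable_completion)
  have "integrable (lebesgue_on \<Omega>) (\<lambda>x. norm (\<phi> x) powr p)"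
    by (subst integral_lebesgue_on_eq_lborel(2)[OF \<Omega>'])
      (use K m integrable_powr_compact_support[OF c(1) K(2,4) p] in auto)
  moreover have "integrable (lebesgue_on \<Omega>) (\<lambda>x. norm (gradient \<phi> x) powr p)"
    by (subst integral_lebesgue_on_eq_lborel(2)[OF \<Omega>'])
      (use K m integrable_powr_compact_support[OF c(2) K(2,5) p] in auto)
  ultimately have "W1p p \<Omega> \<phi> (gradient \<phi>)"
    unfolding W1p_def Lp_def using meas weak_gradient_smooth[OF K(1) \<Omega>] by auto
  then show ?thesis unfolding W1p_0_def using \<phi> p by (intro conjI exI[of _ "\<lambda>k. \<phi>"]) auto
qed

text \<open>
  The function \<open>exp (- 1 / (r\<^sup>2 - \<bar>x - a\<bar>\<^sup>2))\<close> on a small ball, extended by zero.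
\<close>

lemma bump_exists:
  fixes \<Omega> :: "'a::euclidean_space set"
  assumes "open \<Omega>" "\<Omega> \<noteq> {}"
  obtains v x0 where "v \<in> test_functions \<Omega>" "\<And>x. 0 \<le> v x" "\<And>x. v x \<le> 1" "v x0 > 0"
proof -
  obtain a where a: "a \<in> \<Omega>" using assms by auto
  obtain r where r: "r > 0" "cball a r \<subseteq> \<Omega>" using assms(1) a open_contains_cball by blast
  let ?q = "\<lambda>x. r^2 + (\<Sum>b\<in>Basis. (- 1) * ((x \<bullet> b + - (a \<bullet> b)) * (x \<bullet> b + - (a \<bullet> b))))"
  let ?v = "\<lambda>x. flat_exp 0 (?q x)"
  have q: "?q x = r^2 - (norm (x - a))^2" for x
    unfolding power2_norm_eq_inner euclidean_inner[of "x-a" "x-a"] by (simp add: inner_diff_left sum_negf)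
  have s: "smooth ?v"
    by (intro smooth_flat_exp smooth_add smooth_sum smooth_mult smooth_const smooth_bounded_linear bounded_linear_inner_left)
  have "?v x = 0" if "x \<notin> cball a r" for x
  proof -
    have "r \<le> norm (x - a)" using that by (simp add: dist_norm norm_minus_commute)
    then have "r^2 \<le> (norm (x - a))^2" using r by (intro power_mono) auto
    then show ?thesis unfolding q flat_exp_def by simp
  qed
  then have "?v \<in> test_functions \<Omega>"
    using s r by (intro test_functionsI[of _ "cball a r"]) auto
  moreover have "0 \<le> ?v x" "?v x \<le> 1" for x by (auto simp: flat_exp_def)
  moreover have "?v a > 0" using r by (simp add: flat_exp_def)
  ultimately show thesis using that by blast
qed

lemma continuous_AE_eq_0:
  fixes f :: "'a::euclidean_space \<Rightarrow> real"
  assumes f: "continuous_on UNIV f" and ae: "AE x in lborel. f x = 0"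
  shows "f x = 0"
proof -
  have "closed {x. f x = 0}"
    using continuous_closed_preimage_constant[OF f closed_UNIV, of 0] by simp
  moreover have "AE x\<in>UNIV in lebesgue. x \<in> {x. f x = 0}"
    using ae by (simp add: AE_completion_iff)
  ultimately have "x \<in> {x. f x = 0}"
    by (rule mem_closed_if_AE_lebesgue_open[OF open_UNIV _ _ UNIV_I])
  then show ?thesis by simp
qed

lemma integral_pos_continuous:
  fixes f :: "'a::euclidean_space \<Rightarrow> real"
  assumes f: "continuous_on UNIV f" "integrable lborel f" "\<And>x. 0 \<le> f x" "f x0 > 0"
  shows "0 < (\<integral>x. f x \<partial>lborel)"
proof -
  have "(\<integral>x. f x \<partial>lborel) \<noteq> 0"
    using continuous_AE_eq_0[OF f(1), of x0] integral_nonneg_eq_0_iff_AE[OF f(2)] f by auto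
  moreover have "0 \<le> (\<integral>x. f x \<partial>lborel)" using f by simp
  ultimately show ?thesis by simp
qed

section \<open>Uniformly elliptic quadratic forms\<close>

text \<open>
  The pointwise content of the hypotheses on the coefficients: symmetry and two-sided bounds by
  multiples of the Euclidean form.
\<close>

definition elliptic_form :: "real \<Rightarrow> real \<Rightarrow> ('a::euclidean_space \<Rightarrow> 'a) \<Rightarrow> bool" where
  "elliptic_form lam M L \<longleftrightarrow> linear L \<and> (\<forall>\<xi> \<eta>. L \<xi> \<bullet> \<eta> = L \<eta> \<bullet> \<xi>) \<and>
     (\<forall>\<xi>. lam * (norm \<xi>)\<^sup>2 \<le> L \<xi> \<bullet> \<xi>) \<and> (\<forall>\<xi>. L \<xi> \<bullet> \<xi> \<le> M * (norm \<xi>)\<^sup>2)"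

text \<open>
  The integrand of the Rayleigh quotient has to be measurable for every measurable vector field, not
  only for smooth ones, because weak gradients are inserted.
\<close>

definition measurable_form :: "'a::euclidean_space set \<Rightarrow> ('a \<Rightarrow> 'a \<Rightarrow> 'a) \<Rightarrow> bool" where
  "measurable_form \<Omega> A \<longleftrightarrow> (\<forall>g \<in> borel_measurable (lebesgue_on \<Omega>). (\<lambda>x. A x (g x) \<bullet> g x) \<in> borel_measurable (lebesgue_on \<Omega>))"

lemma elliptic_form_nonneg: "elliptic_form lam M L \<Longrightarrow> 0 < lam \<Longrightarrow> 0 \<le> L \<xi> \<bullet> \<xi>"
  unfolding elliptic_form_def by (meson less_imp_le mult_nonneg_nonneg order_trans zero_le_power2)

lemma elliptic_form_add:
  assumes "elliptic_form lam M L"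
  shows "L (\<xi> + \<eta>) \<bullet> (\<xi> + \<eta>) = L \<xi> \<bullet> \<xi> + 2 * (L \<eta> \<bullet> \<xi>) + L \<eta> \<bullet> \<eta>"
proof -
  have "linear L" "L \<xi> \<bullet> \<eta> = L \<eta> \<bullet> \<xi>" using assms unfolding elliptic_form_def by blast+
  then show ?thesis by (simp add: linear_add inner_add)
qed

lemma elliptic_form_Cauchy_Schwarz:
  assumes L: "elliptic_form lam M L" and lam: "0 < lam"
  shows "(L \<eta> \<bullet> \<xi>)\<^sup>2 \<le> (L \<xi> \<bullet> \<xi>) * (L \<eta> \<bullet> \<eta>)"
proof (cases "L \<eta> \<bullet> \<eta> = 0")
  case True
  have "lam * (norm \<eta>)\<^sup>2 \<le> 0" using L True unfolding elliptic_form_def by metis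
  then have "\<eta> = 0" using lam by (simp add: mult_le_0_iff)
  then show ?thesis by (metis L elliptic_form_def inner_zero_right mult_zero_right order_refl power_zero_numeral)
next
  case False
  define c where "c = L \<eta> \<bullet> \<eta>"
  have c: "c > 0" using False elliptic_form_nonneg[OF L lam, of \<eta>] by (simp add: c_def)
  \<comment> \<open>The minimiser of the form along the line through \<open>\<xi>\<close> in direction \<open>\<eta>\<close>.\<close>
  define s where "s = - (L \<eta> \<bullet> \<xi>) / c"
  have lin: "linear L" using L unfolding elliptic_form_def by blast
  have "0 \<le> L (\<xi> + s *\<^sub>R \<eta>) \<bullet> (\<xi> + s *\<^sub>R \<eta>)" by (rule elliptic_form_nonneg[OF L lam])
  also have "\<dots> = L \<xi> \<bullet> \<xi> + 2 * (s * (L \<eta> \<bullet> \<xi>)) + s\<^sup>2 * c"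
    unfolding elliptic_form_add[OF L] by (simp add: linear_scale[OF lin] c_def power2_eq_square)
  also have "\<dots> = L \<xi> \<bullet> \<xi> - (L \<eta> \<bullet> \<xi>)\<^sup>2 / c"
    using c by (simp add: s_def field_simps power2_eq_square)
  finally show ?thesis using c by (simp add: c_def[symmetric] field_simps)
qed

lemma elliptic_form_Cauchy_Schwarz_sqrt:
  assumes L: "elliptic_form lam M L" and lam: "0 < lam"
  shows "\<bar>L \<eta> \<bullet> \<xi>\<bar> \<le> sqrt (L \<xi> \<bullet> \<xi>) * sqrt (L \<eta> \<bullet> \<eta>)"
  using real_sqrt_le_mono[OF elliptic_form_Cauchy_Schwarz[OF L lam, of \<eta> \<xi>]]
  by (simp add: real_sqrt_mult)

text \<open>
  The square root of the form is a norm; this makes the energy continuous with respect to the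
  convergence of gradients in \<open>L\<^sup>p\<close>.
\<close>

lemma elliptic_form_sqrt_triangle:
  assumes L: "elliptic_form lam M L" and lam: "0 < lam" and M: "0 < M"
  shows "sqrt (L \<xi> \<bullet> \<xi>) \<le> sqrt (L \<eta> \<bullet> \<eta>) + sqrt M * norm (\<xi> - \<eta>)"
proof -
  define \<zeta> where "\<zeta> = \<xi> - \<eta>"
  have nn: "0 \<le> L \<eta> \<bullet> \<eta>" "0 \<le> L \<zeta> \<bullet> \<zeta>" using elliptic_form_nonneg[OF L lam] by auto
  have "L \<xi> \<bullet> \<xi> = L \<eta> \<bullet> \<eta> + 2 * (L \<zeta> \<bullet> \<eta>) + L \<zeta> \<bullet> \<zeta>"
    using elliptic_form_add[OF L, of \<eta> \<zeta>] by (simp add: \<zeta>_def)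
  also have "\<dots> \<le> (sqrt (L \<eta> \<bullet> \<eta>) + sqrt (L \<zeta> \<bullet> \<zeta>))\<^sup>2"
    using elliptic_form_Cauchy_Schwarz_sqrt[OF L lam, of \<zeta> \<eta>] nn by (simp add: power2_sum)
  finally have "sqrt (L \<xi> \<bullet> \<xi>) \<le> sqrt (L \<eta> \<bullet> \<eta>) + sqrt (L \<zeta> \<bullet> \<zeta>)"
    using nn by (intro real_le_lsqrt) auto
  moreover have "L \<zeta> \<bullet> \<zeta> \<le> M * (norm \<zeta>)\<^sup>2" using L unfolding elliptic_form_def by blast
  then have "sqrt (L \<zeta> \<bullet> \<zeta>) \<le> sqrt M * norm \<zeta>"
    using real_sqrt_le_mono by (fastforce simp: real_sqrt_mult)
  ultimately show ?thesis by (simp add: \<zeta>_def)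
qed

section \<open>The Rayleigh infimum through test functions\<close>

lemma powr_half: "0 \<le> x \<Longrightarrow> x powr (p / 2) = sqrt x powr p"
  by (simp add: powr_half_sqrt[symmetric] powr_powr)

text \<open>
  Convexity of the \<open>p\<close>-th power, applied to \<open>(1 - t) (a / (1 - t)) + t (b / t)\<close>. With \<open>b\<close> an error
  term and \<open>t\<close> close to zero, the factor of \<open>a\<^sup>p\<close> is close to one, which serves as a substitute for the
  triangle inequality in \<open>L\<^sup>p\<close>.
\<close>

lemma powr_add_le:
  fixes a b t p :: real
  assumes "0 \<le> a" "0 \<le> b" "0 < t" "t < 1" "1 \<le> p"
  shows "(a + b) powr p \<le> (1 - t) powr (1 - p) * a powr p + t powr (1 - p) * b powr p"
proof -
  have c: "1 \<le> s powr (1 - p)" if "0 < s" "s < 1" for s :: real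
    using powr_mono'[of "1 - p" 0 s] that assms by simp
  consider "a = 0" | "b = 0" | "a > 0" "b > 0" using assms by linarith
  then show ?thesis
  proof cases
    case 1 then show ?thesis using c[of t] assms by (simp add: mult_le_cancel_right1)
  next
    case 2 then show ?thesis using c[of "1 - t"] assms by (simp add: mult_le_cancel_right1)
  next
    case 3
    have "((1 - t) *\<^sub>R (a / (1 - t)) + t *\<^sub>R (b / t)) powr p \<le> (1 - t) * (a / (1 - t)) powr p + t * (b / t) powr p"
      by (rule convex_onD[OF powr_convex[OF assms(5)], of t]) (use assms 3 in auto)
    also have "\<dots> = (1 - t) powr (1 - p) * a powr p + t powr (1 - p) * b powr p"
      using assms 3 by (simp add: powr_divide powr_diff)
    finally show ?thesis using assms by simp
  qed
qed

definition Lp_mass :: "real \<Rightarrow> ('a::euclidean_space \<Rightarrow> real) \<Rightarrow> real" where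
  "Lp_mass p \<phi> = (\<integral>x. \<bar>\<phi> x\<bar> powr p \<partial>lborel)"

definition energy :: "real \<Rightarrow> ('a::euclidean_space \<Rightarrow> 'a \<Rightarrow> 'a) \<Rightarrow> ('a \<Rightarrow> real) \<Rightarrow> real" where
  "energy p A \<phi> = (\<integral>x. \<bar>A x (gradient \<phi> x) \<bullet> gradient \<phi> x\<bar> powr (p / 2) \<partial>lebesgue)"

lemma Lp_mass_nonneg: "0 \<le> Lp_mass p \<phi>" and energy_nonneg: "0 \<le> energy p A \<phi>"
  by (simp_all add: Lp_mass_def energy_def)

lemma test_function_integrals:
  assumes \<phi>: "\<phi> \<in> test_functions \<Omega>" and \<Omega>: "open \<Omega>" and p: "0 < p"
  shows "(\<integral>x. \<bar>\<phi> x\<bar> powr p \<partial>lebesgue_on \<Omega>) = Lp_mass p \<phi>"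
    "(\<integral>x. \<bar>A x (gradient \<phi> x) \<bullet> gradient \<phi> x\<bar> powr (p / 2) \<partial>lebesgue_on \<Omega>) = energy p A \<phi>"
proof -
  obtain K where K: "smooth \<phi>" "compact K" "K \<subseteq> \<Omega>" "\<And>x. x \<notin> K \<Longrightarrow> \<phi> x = 0" "\<And>x. x \<notin> K \<Longrightarrow> gradient \<phi> x = 0"
    using test_function_support[OF \<phi>] by blast
  have nK: "x \<notin> K" if "x \<notin> \<Omega>" for x using K(3) that by blast
  have \<Omega>': "\<Omega> \<in> sets lebesgue" using \<Omega> by simp
  have [measurable]: "\<phi> \<in> borel_measurable borel" by (rule smooth_measurable[OF K(1)])
  show "(\<integral>x. \<bar>\<phi> x\<bar> powr p \<partial>lebesgue_on \<Omega>) = Lp_mass p \<phi>"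
    unfolding Lp_mass_def by (rule integral_lebesgue_on_eq_lborel[OF \<Omega>']) (simp_all add: K(4)[OF nK])
  show "(\<integral>x. \<bar>A x (gradient \<phi> x) \<bullet> gradient \<phi> x\<bar> powr (p / 2) \<partial>lebesgue_on \<Omega>) = energy p A \<phi>"
    unfolding energy_def by (rule integral_lebesgue_on_eq_lebesgue[OF \<Omega>']) (simp add: K(5)[OF nK])
qed

text \<open>
  A test function is its own approximating sequence, hence an admissible competitor.
\<close>

lemma rayleigh_inf_le_test:
  assumes \<phi>: "\<phi> \<in> test_functions \<Omega>" and \<Omega>: "open \<Omega>" and p: "0 < p"
  shows "rayleigh_inf p \<Omega> A * Lp_mass p \<phi> \<le> energy p A \<phi>"
proof (cases "Lp_mass p \<phi> = 0")
  case True then show ?thesis by (simp add: energy_nonneg)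
next
  case False
  have "\<not> (AE x in lebesgue_on \<Omega>. \<phi> x = 0)"
  proof
    assume ae: "AE x in lebesgue_on \<Omega>. \<phi> x = 0"
    have "(\<integral>x. \<bar>\<phi> x\<bar> powr p \<partial>lebesgue_on \<Omega>) = 0"
      by (rule integral_eq_zero_AE) (use ae in auto)
    with False show False using test_function_integrals(1)[OF \<phi> \<Omega> p] by simp
  qed
  then have "energy p A \<phi> / Lp_mass p \<phi> \<in>
    {(\<integral>x. \<bar>A x (g x) \<bullet> g x\<bar> powr (p / 2) \<partial>lebesgue_on \<Omega>) / (\<integral>x. \<bar>u x\<bar> powr p \<partial>lebesgue_on \<Omega>) | u g.
            W1p_0 p \<Omega> u g \<and> \<not> (AE x in lebesgue_on \<Omega>. u x = 0)}"
    using test_function_W1p_0[OF \<phi> \<Omega> p] test_function_integrals(1)[OF \<phi> \<Omega> p]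
      test_function_integrals(2)[OF \<phi> \<Omega> p, of A] by force
  then have "rayleigh_inf p \<Omega> A \<le> energy p A \<phi> / Lp_mass p \<phi>"
    unfolding rayleigh_inf_def
    by (rule cInf_lower) (auto intro!: bdd_belowI[of _ 0])
  moreover have "0 < Lp_mass p \<phi>" using False Lp_mass_nonneg[of p \<phi>] by simp
  ultimately show ?thesis by (simp add: pos_le_divide_eq)
qed

lemma integrable_norm_powr_diff:
  fixes f g :: "'a::euclidean_space \<Rightarrow> 'b::euclidean_space"
  assumes "Lp p \<Omega> f" "Lp p \<Omega> g" "1 \<le> p"
  shows "integrable (lebesgue_on \<Omega>) (\<lambda>x. norm (f x - g x) powr p)"
proof (rule Bochner_Integration.integrable_bound)
  have [measurable]: "f \<in> borel_measurable (lebesgue_on \<Omega>)" "g \<in> borel_measurable (lebesgue_on \<Omega>)"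
    using assms unfolding Lp_def by auto
  show "integrable (lebesgue_on \<Omega>) (\<lambda>x. (1 - 1/2) powr (1 - p) * norm (f x) powr p + (1/2) powr (1 - p) * norm (g x) powr p)"
    using assms unfolding Lp_def by auto
  show "(\<lambda>x. norm (f x - g x) powr p) \<in> borel_measurable (lebesgue_on \<Omega>)" by measurable
  show "AE x in lebesgue_on \<Omega>. norm (norm (f x - g x) powr p) \<le>
      norm ((1 - 1/2) powr (1 - p) * norm (f x) powr p + (1/2) powr (1 - p) * norm (g x) powr p)"
  proof (rule AE_I2)
    fix x
    have "norm (f x - g x) powr p \<le> (norm (f x) + norm (g x)) powr p"
      using norm_triangle_ineq4 assms(3) by (intro powr_mono2) auto
    also have "\<dots> \<le> (1 - 1/2) powr (1 - p) * norm (f x) powr p + (1/2) powr (1 - p) * norm (g x) powr p"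
      by (rule powr_add_le) (use assms in auto)
    finally show "norm (norm (f x - g x) powr p) \<le>
      norm ((1 - 1/2) powr (1 - p) * norm (f x) powr p + (1/2) powr (1 - p) * norm (g x) powr p)" by simp
  qed
qed

lemma integrable_energy_density:
  assumes p: "0 < p" and pos: "0 < lam" "0 < M"
    and ell: "AE x in lebesgue_on \<Omega>. elliptic_form lam M (A x)"
    and meas: "measurable_form \<Omega> A"
    and h: "Lp p \<Omega> h"
  shows "integrable (lebesgue_on \<Omega>) (\<lambda>x. \<bar>A x (h x) \<bullet> h x\<bar> powr (p / 2))"
proof (rule Bochner_Integration.integrable_bound)
  show "integrable (lebesgue_on \<Omega>) (\<lambda>x. M powr (p / 2) * norm (h x) powr p)"
    using h unfolding Lp_def by simp
  have [measurable]: "(\<lambda>x. A x (h x) \<bullet> h x) \<in> borel_measurable (lebesgue_on \<Omega>)"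
    using h meas unfolding Lp_def measurable_form_def by blast
  show "(\<lambda>x. \<bar>A x (h x) \<bullet> h x\<bar> powr (p / 2)) \<in> borel_measurable (lebesgue_on \<Omega>)"
    by measurable
  show "AE x in lebesgue_on \<Omega>. norm (\<bar>A x (h x) \<bullet> h x\<bar> powr (p / 2)) \<le> norm (M powr (p / 2) * norm (h x) powr p)"
    using ell
  proof eventually_elim
    case (elim x)
    have "A x (h x) \<bullet> h x \<le> M * (norm (h x))\<^sup>2" using elim unfolding elliptic_form_def by blast
    moreover have nn: "0 \<le> A x (h x) \<bullet> h x" by (rule elliptic_form_nonneg[OF elim pos(1)])
    ultimately have "\<bar>A x (h x) \<bullet> h x\<bar> powr (p / 2) \<le> (M * (norm (h x))\<^sup>2) powr (p / 2)"
      using p by (intro powr_mono2) auto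
    also have "\<dots> = M powr (p / 2) * norm (h x) powr p"
      using pos by (simp add: powr_mult powr_half)
    finally show ?case by simp
  qed
qed

text \<open>
  Density of the test functions: an inequality between mass and energy survives the passage from test
  functions \<open>\<phi>\<^sub>k\<close> to a limit \<open>u\<close>. Both quantities are compared up to a factor \<open>(1 - t)\<^bsup>1 - p\<^esup>\<close> and an
  error that vanishes as \<open>k\<close> grows; afterwards \<open>t\<close> tends to zero.
\<close>

lemma rayleigh_inf_ge_test:
  assumes \<Omega>: "open \<Omega>" "\<Omega> \<noteq> {}" and p: "1 \<le> p" and pos: "0 < lam" "0 < M"
    and ell: "AE x in lebesgue_on \<Omega>. elliptic_form lam M (A x)"
    and meas: "measurable_form \<Omega> A"
    and c: "\<And>\<phi>. \<phi> \<in> test_functions \<Omega> \<Longrightarrow> c * Lp_mass p \<phi> \<le> energy p A \<phi>"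
  shows "c \<le> rayleigh_inf p \<Omega> A"
  unfolding rayleigh_inf_def
proof (rule cInf_greatest)
  have p0: "0 < p" using p by simp
  obtain v x0 where v: "v \<in> test_functions \<Omega>" "v x0 > 0"
    by (rule bump_exists[OF \<Omega>]) blast
  obtain K where K: "smooth v" "compact K" "K \<subseteq> \<Omega>" "\<And>x. x \<notin> K \<Longrightarrow> v x = 0"
    using test_function_support[OF v(1)] by blast
  have "\<not> (AE x in lebesgue_on \<Omega>. v x = 0)"
  proof
    assume "AE x in lebesgue_on \<Omega>. v x = 0"
    then have "AE x in lebesgue. x \<in> \<Omega> \<longrightarrow> v x = 0"
      using \<Omega> by (subst (asm) AE_restrict_space_iff) auto
    then have "AE x in lebesgue. v x = 0"
      by (rule AE_mp) (use K in auto)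
    then have "AE x in lborel. v x = 0" by (simp add: AE_completion_iff)
    from continuous_AE_eq_0[OF smooth_continuous[OF K(1)] this, of x0] v show False by simp
  qed
  with test_function_W1p_0[OF v(1) \<Omega>(1) p0]
  show "{(\<integral>x. \<bar>A x (g x) \<bullet> g x\<bar> powr (p / 2) \<partial>lebesgue_on \<Omega>) / (\<integral>x. \<bar>u x\<bar> powr p \<partial>lebesgue_on \<Omega>) | u g.
            W1p_0 p \<Omega> u g \<and> \<not> (AE x in lebesgue_on \<Omega>. u x = 0)} \<noteq> {}" by blast
next
  fix y
  assume "y \<in> {(\<integral>x. \<bar>A x (g x) \<bullet> g x\<bar> powr (p / 2) \<partial>lebesgue_on \<Omega>) / (\<integral>x. \<bar>u x\<bar> powr p \<partial>lebesgue_on \<Omega>) | u g.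
            W1p_0 p \<Omega> u g \<and> \<not> (AE x in lebesgue_on \<Omega>. u x = 0)}"
  then obtain u g where y: "y = (\<integral>x. \<bar>A x (g x) \<bullet> g x\<bar> powr (p / 2) \<partial>lebesgue_on \<Omega>) / (\<integral>x. \<bar>u x\<bar> powr p \<partial>lebesgue_on \<Omega>)"
    and W: "W1p_0 p \<Omega> u g" and nz: "\<not> (AE x in lebesgue_on \<Omega>. u x = 0)" by blast
  let ?\<nu> = "lebesgue_on \<Omega>"
  define N where "N = (\<integral>x. \<bar>u x\<bar> powr p \<partial>?\<nu>)"
  define E where "E = (\<integral>x. \<bar>A x (g x) \<bullet> g x\<bar> powr (p / 2) \<partial>?\<nu>)"
  have p0: "0 < p" using p by simp
  have u: "Lp p \<Omega> u" and g: "Lp p \<Omega> g"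
    using W unfolding W1p_0_def W1p_def by auto
  obtain \<phi> where \<phi>: "\<And>k. \<phi> k \<in> test_functions \<Omega>"
    and lim_u: "(\<lambda>k. \<integral>x. \<bar>\<phi> k x - u x\<bar> powr p \<partial>?\<nu>) \<longlonglongrightarrow> 0"
    and lim_g: "(\<lambda>k. \<integral>x. norm (gradient (\<phi> k) x - g x) powr p \<partial>?\<nu>) \<longlonglongrightarrow> 0"
    using W unfolding W1p_0_def by blast
  have L\<phi>: "Lp p \<Omega> (\<phi> k)" "Lp p \<Omega> (gradient (\<phi> k))" for k
    using test_function_W1p_0[OF \<phi>[of k] \<Omega>(1) p0] unfolding W1p_0_def W1p_def by auto
  have iu: "integrable ?\<nu> (\<lambda>x. \<bar>u x\<bar> powr p)" using u unfolding Lp_def by simp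
  have i\<phi>: "integrable ?\<nu> (\<lambda>x. \<bar>\<phi> k x\<bar> powr p)" for k using L\<phi>(1)[of k] unfolding Lp_def by simp
  note iE = integrable_energy_density[OF p0 pos ell meas]
  have N0: "0 < N"
  proof -
    have "N \<noteq> 0"
      using integral_nonneg_eq_0_iff_AE[OF iu] nz unfolding N_def by auto
    moreover have "0 \<le> N" unfolding N_def by simp
    ultimately show ?thesis by simp
  qed
  have E0: "0 \<le> E" unfolding E_def by simp
  have "c * N \<le> E"
  proof (cases "c \<le> 0")
    case True then show ?thesis using N0 E0 by (smt (verit) mult_nonneg_nonneg mult_minus_left)
  next
    case False
    have step: "c * N \<le> (1 - t) powr (1 - p) * ((1 - t) powr (1 - p) * E)" if t: "0 < t" "t < 1" for t
    proof -
      let ?a = "(1 - t) powr (1 - p)" and ?b = "t powr (1 - p)"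
      let ?d = "\<lambda>k. \<integral>x. \<bar>\<phi> k x - u x\<bar> powr p \<partial>?\<nu>" and ?D = "\<lambda>k. \<integral>x. norm (gradient (\<phi> k) x - g x) powr p \<partial>?\<nu>"
      have id: "integrable ?\<nu> (\<lambda>x. \<bar>\<phi> k x - u x\<bar> powr p)" for k
        using integrable_norm_powr_diff[OF L\<phi>(1) u p, of k] by simp
      have iD: "integrable ?\<nu> (\<lambda>x. norm (gradient (\<phi> k) x - g x) powr p)" for k
        by (rule integrable_norm_powr_diff[OF L\<phi>(2) g p])
      have bound: "c * N \<le> ?a * (?a * E + ?b * (M powr (p / 2) * ?D k)) + c * (?b * ?d k)" for k
      proof -
        have "N \<le> (\<integral>x. ?a * \<bar>\<phi> k x\<bar> powr p + ?b * \<bar>\<phi> k x - u x\<bar> powr p \<partial>?\<nu>)"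
          unfolding N_def
        proof (rule integral_mono[OF iu])
          show "integrable ?\<nu> (\<lambda>x. ?a * \<bar>\<phi> k x\<bar> powr p + ?b * \<bar>\<phi> k x - u x\<bar> powr p)"
            using i\<phi> id by simp
          fix x
          have "\<bar>u x\<bar> powr p \<le> (\<bar>\<phi> k x\<bar> + \<bar>\<phi> k x - u x\<bar>) powr p"
            using p0 by (intro powr_mono2) auto
          also have "\<dots> \<le> ?a * \<bar>\<phi> k x\<bar> powr p + ?b * \<bar>\<phi> k x - u x\<bar> powr p"
            by (rule powr_add_le) (use t p in auto)
          finally show "\<bar>u x\<bar> powr p \<le> ?a * \<bar>\<phi> k x\<bar> powr p + ?b * \<bar>\<phi> k x - u x\<bar> powr p" .
        qed
        also have "\<dots> = ?a * Lp_mass p (\<phi> k) + ?b * ?d k"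
          using i\<phi> id test_function_integrals(1)[OF \<phi>[of k] \<Omega>(1) p0] by simp
        finally have "c * N \<le> c * (?a * Lp_mass p (\<phi> k) + ?b * ?d k)"
          using False by (intro mult_left_mono) auto
        also have "\<dots> = ?a * (c * Lp_mass p (\<phi> k)) + c * (?b * ?d k)" by (simp add: algebra_simps)
        also have "\<dots> \<le> ?a * energy p A (\<phi> k) + c * (?b * ?d k)"
          using c[OF \<phi>[of k]] by (intro add_right_mono mult_left_mono) auto
        finally have 1: "c * N \<le> ?a * energy p A (\<phi> k) + c * (?b * ?d k)" .
        have "energy p A (\<phi> k) = (\<integral>x. \<bar>A x (gradient (\<phi> k) x) \<bullet> gradient (\<phi> k) x\<bar> powr (p / 2) \<partial>?\<nu>)"
          using test_function_integrals(2)[OF \<phi>[of k] \<Omega>(1) p0] by simp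
        also have "\<dots> \<le> (\<integral>x. ?a * \<bar>A x (g x) \<bullet> g x\<bar> powr (p / 2) + ?b * (M powr (p / 2) * norm (gradient (\<phi> k) x - g x) powr p) \<partial>?\<nu>)"
        proof (rule integral_mono_AE[OF iE[OF L\<phi>(2)]])
          show "integrable ?\<nu> (\<lambda>x. ?a * \<bar>A x (g x) \<bullet> g x\<bar> powr (p / 2) + ?b * (M powr (p / 2) * norm (gradient (\<phi> k) x - g x) powr p))"
            using iE[OF g] iD by simp
          show "AE x in ?\<nu>. \<bar>A x (gradient (\<phi> k) x) \<bullet> gradient (\<phi> k) x\<bar> powr (p / 2) \<le>
              ?a * \<bar>A x (g x) \<bullet> g x\<bar> powr (p / 2) + ?b * (M powr (p / 2) * norm (gradient (\<phi> k) x - g x) powr p)"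
            using ell
          proof eventually_elim
            case (elim x)
            let ?h = "gradient (\<phi> k) x"
            note nn = elliptic_form_nonneg[OF elim pos(1)]
            have "\<bar>A x ?h \<bullet> ?h\<bar> powr (p / 2) = sqrt (A x ?h \<bullet> ?h) powr p"
              using nn by (simp add: powr_half)
            also have "\<dots> \<le> (sqrt (A x (g x) \<bullet> g x) + sqrt M * norm (?h - g x)) powr p"
              using elliptic_form_sqrt_triangle[OF elim pos] nn p0 by (intro powr_mono2) auto
            also have "\<dots> \<le> ?a * sqrt (A x (g x) \<bullet> g x) powr p + ?b * (sqrt M * norm (?h - g x)) powr p"
              by (rule powr_add_le) (use t p nn pos in auto)
            also have "\<dots> = ?a * \<bar>A x (g x) \<bullet> g x\<bar> powr (p / 2) + ?b * (M powr (p / 2) * norm (?h - g x) powr p)"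
              using nn pos by (simp add: powr_half powr_mult)
            finally show ?case .
          qed
        qed
        also have "\<dots> = ?a * E + ?b * (M powr (p / 2) * ?D k)"
          using iE[OF g] iD by (simp add: E_def)
        finally have "?a * energy p A (\<phi> k) \<le> ?a * (?a * E + ?b * (M powr (p / 2) * ?D k))"
          by (intro mult_left_mono) auto
        with 1 show ?thesis by linarith
      qed
      have "(\<lambda>k. ?a * (?a * E + ?b * (M powr (p / 2) * ?D k)) + c * (?b * ?d k)) \<longlonglongrightarrow> ?a * (?a * E + ?b * (M powr (p / 2) * 0)) + c * (?b * 0)"
        by (intro tendsto_intros lim_u lim_g)
      from LIMSEQ_le_const[OF this] bound show ?thesis by auto
    qed
    have "((\<lambda>t. (1 - t) powr (1 - p) * ((1 - t) powr (1 - p) * E)) \<longlongrightarrow> (1 - 0) powr (1 - p) * ((1 - 0) powr (1 - p) * E)) (at_right 0)"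
      by (intro tendsto_intros) auto
    moreover have "\<forall>\<^sub>F t in at_right 0. c * N \<le> (1 - t) powr (1 - p) * ((1 - t) powr (1 - p) * E)"
      using eventually_at_right_less[of "0::real"] eventually_at_right_real[of 0 "1::real"]
      by (rule eventually_elim2[where R="\<lambda>t. _ t"]) (use step in auto)
    ultimately show ?thesis
      using tendsto_lowerbound[of _ _ "at_right (0::real)" "c * N"] by fastforce
  qed
  then show "c \<le> y" using N0 unfolding y N_def E_def by (simp add: pos_le_divide_eq)
qed

lemma rayleigh_inf_nonneg:
  assumes "open \<Omega>" "\<Omega> \<noteq> {}" "1 \<le> p" "0 < lam" "0 < M"
    "AE x in lebesgue_on \<Omega>. elliptic_form lam M (A x)"
    "measurable_form \<Omega> A"
  shows "0 \<le> rayleigh_inf p \<Omega> A"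
  by (rule rayleigh_inf_ge_test[OF assms]) (auto simp: energy_nonneg)

lemma rayleigh_inf_approx_test:
  assumes "open \<Omega>" "\<Omega> \<noteq> {}" "1 \<le> p" "0 < lam" "0 < M"
    "AE x in lebesgue_on \<Omega>. elliptic_form lam M (A x)"
    "measurable_form \<Omega> A"
    and \<epsilon>: "0 < \<epsilon>"
  obtains \<phi> where "\<phi> \<in> test_functions \<Omega>" "0 < Lp_mass p \<phi>" "energy p A \<phi> < (rayleigh_inf p \<Omega> A + \<epsilon>) * Lp_mass p \<phi>"
proof -
  have "\<exists>\<phi>\<in>test_functions \<Omega>. energy p A \<phi> < (rayleigh_inf p \<Omega> A + \<epsilon>) * Lp_mass p \<phi>"
  proof (rule ccontr)
    assume "\<not> ?thesis"
    then have "rayleigh_inf p \<Omega> A + \<epsilon> \<le> rayleigh_inf p \<Omega> A"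
      by (intro rayleigh_inf_ge_test[OF assms(1-7)]) (auto simp: not_less)
    with \<epsilon> show False by simp
  qed
  then obtain \<phi> where \<phi>: "\<phi> \<in> test_functions \<Omega>" "energy p A \<phi> < (rayleigh_inf p \<Omega> A + \<epsilon>) * Lp_mass p \<phi>" by blast
  moreover have "Lp_mass p \<phi> \<noteq> 0" using \<phi>(2) energy_nonneg[of p A \<phi>] by auto
  ultimately show thesis using that Lp_mass_nonneg[of p \<phi>] by force
qed

section \<open>Scalar inequalities for powers\<close>

text \<open>
  The \<open>p\<close>-th power lies above its tangent at \<open>b\<close>; the inequality is a form of Young's inequality.
\<close>

lemma Young_tangent:
  fixes a b p :: real
  assumes "0 \<le> a" "0 \<le> b" "1 < p"
  shows "p * b powr (p - 1) * a - (p - 1) * b powr p \<le> a powr p"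
proof -
  have "a * b powr (p - 1) \<le> a powr p / p + (b powr (p - 1)) powr (p / (p - 1)) / (p / (p - 1))"
    by (rule Youngs_inequality) (use assms in \<open>auto simp: field_simps\<close>)
  also have "(b powr (p - 1)) powr (p / (p - 1)) = b powr p"
    using assms by (simp add: powr_powr)
  finally have "p * (a * b powr (p - 1)) \<le> p * (a powr p / p + b powr p / (p / (p - 1)))"
    using assms by (intro mult_left_mono) auto
  moreover have "p * (a powr p / p + b powr p / (p / (p - 1))) = a powr p + (p - 1) * b powr p"
    using assms by (simp add: distrib_left)
  ultimately show ?thesis by (simp add: mult.assoc mult.commute mult.left_commute)
qed

lemma powr_tangent:
  fixes a X r :: real
  assumes "0 \<le> a" "0 \<le> X" "1 \<le> r"
  shows "X powr r \<le> a powr r + r * X powr (r - 1) * (X - a)"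
proof (cases "r = 1")
  case True then show ?thesis using assms by (cases "X = 0") auto
next
  case False
  have "X powr (r - 1) * X = X powr r"
    using assms False by (cases "X = 0") (simp_all add: powr_mult_base[symmetric] powr_diff)
  moreover have "r * X powr (r - 1) * a - (r - 1) * X powr r \<le> a powr r"
    by (rule Young_tangent) (use assms False in auto)
  ultimately show ?thesis by (simp add: algebra_simps)
qed

text \<open>
  The point of this estimate is the base point 1: although \<open>x\<^sup>s\<close> need not be Lipschitz at the
  origin, it is at distance one from the base point there. The exponent is replaced by
  an integer one, for which Bernoulli's inequality (below 1) and the geometric sum (above 1) apply.
\<close>

lemma powr_difference_le:
  fixes s x :: real
  assumes "0 \<le> s" "0 \<le> x" "x \<le> 4"
  defines "K \<equiv> real (nat \<lceil>s\<rceil>) * 4 ^ nat \<lceil>s\<rceil> + 1"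
  shows "(x powr s - 1) * (x - 1) \<le> K * (x - 1)\<^sup>2"
proof -
  define n where "n = nat \<lceil>s\<rceil>"
  have sn: "s \<le> real n" unfolding n_def by linarith
  have K: "real n \<le> K"
  proof -
    have "real n * 1 \<le> real n * 4 ^ n" by (intro mult_left_mono) auto
    then show ?thesis unfolding K_def n_def by simp
  qed
  show ?thesis
  proof (cases "1 \<le> x")
    case True
    have "x powr s \<le> x ^ n"
      using powr_mono[OF sn True] True by (simp add: powr_realpow)
    moreover have "x ^ n - 1 \<le> (x - 1) * (real n * 4 ^ n)"
    proof -
      have "x ^ n - 1 = (x - 1) * (\<Sum>i<n. x ^ i)" using power_diff_1_eq[of x n] by simp
      also have "(\<Sum>i<n. x ^ i) \<le> (\<Sum>i<n. 4 ^ n)"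
      proof (rule sum_mono)
        fix i assume "i \<in> {..<n}"
        then have "x ^ i \<le> x ^ n" using True by (intro power_increasing) auto
        also have "\<dots> \<le> 4 ^ n" using assms by (intro power_mono) auto
        finally show "x ^ i \<le> 4 ^ n" .
      qed
      finally show ?thesis using True by (simp add: mult_left_mono)
    qed
    ultimately have "x powr s - 1 \<le> K * (x - 1)"
      using True unfolding K_def n_def[symmetric] by (simp add: algebra_simps)
    then have "(x powr s - 1) * (x - 1) \<le> K * (x - 1) * (x - 1)"
      using True by (intro mult_right_mono) auto
    then show ?thesis by (simp add: power2_eq_square mult.assoc)
  next
    case False
    have "1 - x powr s \<le> K * (1 - x)"
    proof (cases "x = 0")
      case True then show ?thesis by (simp add: K_def)
    next
      case nz: False
      have "x powr real n \<le> x powr s"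
        by (rule powr_mono') (use sn False nz assms in auto)
      moreover have "1 - real n * (1 - x) \<le> x ^ n"
        using Bernoulli_inequality[of "x - 1" n] assms by (simp add: algebra_simps)
      moreover have "x powr real n = x ^ n" using nz assms by (simp add: powr_realpow)
      moreover have "real n * (1 - x) \<le> K * (1 - x)" using K False by (intro mult_right_mono) auto
      ultimately show ?thesis by linarith
    qed
    then have "(1 - x powr s) * (1 - x) \<le> K * (1 - x) * (1 - x)"
      using False by (intro mult_right_mono) auto
    then show ?thesis by (simp add: power2_eq_square algebra_simps)
  qed
qed

text \<open>
  Second-order expansion of \<open>t \<mapsto> Q(\<eta> + t \<xi>)\<^sup>r\<close> for a nonnegative quadratic form \<open>Q\<close>, written with
  \<open>a = Q(\<eta>)\<close>, \<open>c = Q(\<xi>)\<close> and the mixed term \<open>b\<close>. If \<open>c\<close> dominates, all terms are bounded by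
  \<open>c\<^sup>r\<close>. If \<open>a\<close> dominates, convexity bounds the increment by the derivative at the far end, and
  replacing that derivative by the one at \<open>a\<close> costs only a quadratic error. The error has exactly the two
  terms that scale like \<open>l\<^bsup>-2\<^esup>\<close> and \<open>l\<^bsup>-p\<^esup>\<close> when \<open>\<xi>\<close> is of size \<open>1 / l\<close>.
\<close>

lemma powr_quadratic_expansion:
  fixes r :: real
  assumes r: "1 \<le> r"
  obtains C where "0 \<le> C" "\<And>a b c :: real. 0 \<le> a \<Longrightarrow> 0 \<le> c \<Longrightarrow> b\<^sup>2 \<le> a * c \<Longrightarrow>
    (a + 2 * b + c) powr r \<le> a powr r + 2 * r * a powr (r - 1) * b + C * (a powr (r - 1) * c + c powr r)"
proof
  define K where "K = real (nat \<lceil>r - 1\<rceil>) * 4 ^ nat \<lceil>r - 1\<rceil> + 1"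
  define C where "C = r + 9 * r * K + 4 powr r + 2 * r"
  have K0: "0 \<le> K" unfolding K_def by simp
  then show C0: "0 \<le> C" using r unfolding C_def by simp
  fix a b c :: real
  assume a: "0 \<le> a" and c: "0 \<le> c" and bac: "b\<^sup>2 \<le> a * c"
  define X where "X = a + 2 * b + c"
  define y where "y = sqrt (a * c)"
  have by': "\<bar>b\<bar> \<le> y" using real_sqrt_le_mono[OF bac] by (simp add: y_def)
  have ysq: "y = sqrt a * sqrt c" by (simp add: y_def real_sqrt_mult)
  have "(sqrt a - sqrt c)\<^sup>2 \<ge> 0" by simp
  then have "2 * y \<le> a + c" using a c by (simp add: power2_diff ysq)
  then have X0: "0 \<le> X" using by' unfolding X_def by linarith
  show "X powr r \<le> a powr r + 2 * r * a powr (r - 1) * b + C * (a powr (r - 1) * c + c powr r)"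
  proof (cases "a \<le> c")
    case True
    have yc: "y \<le> c" unfolding y_def using True a c
      by (intro real_le_lsqrt) (auto simp: power2_eq_square mult_right_mono)
    have "X \<le> 4 * c" unfolding X_def using True yc by' by linarith
    then have 1: "X powr r \<le> 4 powr r * c powr r"
      using powr_mono2[of r X "4 * c"] X0 r c by (simp add: powr_mult)
    have cc: "c powr (r - 1) * c = c powr r"
      using c by (cases "c = 0") (simp_all add: powr_diff)
    have "- (a powr (r - 1) * b) \<le> a powr (r - 1) * c"
    proof -
      have "a powr (r - 1) * (- b) \<le> a powr (r - 1) * c" using by' yc by (intro mult_left_mono) auto
      then show ?thesis by simp
    qed
    also have "a powr (r - 1) * c \<le> c powr (r - 1) * c"
      using True a r c by (intro mult_right_mono powr_mono2) auto
    finally have "- (a powr (r - 1) * b) \<le> c powr r" unfolding cc .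
    then have "2 * r * (- (a powr (r - 1) * b)) \<le> 2 * r * c powr r"
      using r by (intro mult_left_mono) auto
    then have "0 \<le> 2 * r * a powr (r - 1) * b + 2 * r * c powr r"
      unfolding mult_minus_right mult.assoc[symmetric] by linarith
    with 1 have "X powr r \<le> 2 * r * a powr (r - 1) * b + (4 powr r + 2 * r) * c powr r"
      unfolding distrib_right by linarith
    also have "(4 powr r + 2 * r) * c powr r \<le> C * c powr r"
      using r K0 unfolding C_def by (intro mult_right_mono) auto
    also have "\<dots> \<le> C * (a powr (r - 1) * c + c powr r)"
      using C0 c by (intro mult_left_mono) auto
    finally show ?thesis using powr_ge_zero[of a r] by linarith
  next
    case False
    then have a0: "0 < a" and ca: "c < a" using c by auto
    have ya: "y \<le> a" unfolding y_def using ca a c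
      by (intro real_le_lsqrt) (auto simp: power2_eq_square mult_left_mono)
    have cy: "c \<le> y" unfolding y_def using ca a c
      by (intro real_le_rsqrt) (auto simp: power2_eq_square mult_right_mono)
    have X4: "X \<le> 4 * a" unfolding X_def using ca ya by' by linarith
    have Xa: "\<bar>X - a\<bar> \<le> 3 * y" unfolding X_def using by' cy c by linarith
    have "(X - a)\<^sup>2 \<le> (3 * y)\<^sup>2" using power_mono[OF Xa abs_ge_zero, of 2] by simp
    also have "\<dots> = 9 * (a * c)" using a c by (simp add: y_def power_mult_distrib)
    finally have Xa2: "(X - a)\<^sup>2 \<le> 9 * (a * c)" .
    define \<rho> where "\<rho> = X / a"
    have \<rho>: "0 \<le> \<rho>" "\<rho> \<le> 4" "X = a * \<rho>" using X0 X4 a0 by (auto simp: \<rho>_def field_simps)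
    have "(\<rho> powr (r - 1) - 1) * (\<rho> - 1) \<le> K * (\<rho> - 1)\<^sup>2"
      unfolding K_def by (rule powr_difference_le) (use r \<rho> in auto)
    then have "a powr (r - 1) * a * ((\<rho> powr (r - 1) - 1) * (\<rho> - 1)) \<le> a powr (r - 1) * a * (K * (\<rho> - 1)\<^sup>2)"
      using a0 by (intro mult_left_mono) auto
    also have "a powr (r - 1) * a * ((\<rho> powr (r - 1) - 1) * (\<rho> - 1)) = (X powr (r - 1) - a powr (r - 1)) * (X - a)"
      using a0 \<rho>(1) unfolding \<rho>(3) by (simp add: powr_mult algebra_simps)
    also have "a powr (r - 1) * a * (K * (\<rho> - 1)\<^sup>2) = a powr (r - 1) / a * K * (X - a)\<^sup>2"
      using a0 unfolding \<rho>(3) by (simp add: field_simps power2_eq_square)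
    also have "\<dots> \<le> a powr (r - 1) / a * K * (9 * (a * c))"
      using a0 K0 Xa2 by (intro mult_left_mono) auto
    also have "\<dots> = 9 * K * (a powr (r - 1) * c)" using a0 by simp
    finally have 1: "(X powr (r - 1) - a powr (r - 1)) * (X - a) \<le> 9 * K * (a powr (r - 1) * c)" .
    have "X powr r \<le> a powr r + r * (X powr (r - 1) * (X - a))"
      using powr_tangent[OF a X0 r] by (simp add: mult.assoc)
    also have "X powr (r - 1) * (X - a) = a powr (r - 1) * (2 * b + c) + (X powr (r - 1) - a powr (r - 1)) * (X - a)"
      by (simp add: X_def algebra_simps)
    also have "r * (a powr (r - 1) * (2 * b + c) + (X powr (r - 1) - a powr (r - 1)) * (X - a))
        \<le> r * (a powr (r - 1) * (2 * b + c) + 9 * K * (a powr (r - 1) * c))"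
      using 1 r by (intro mult_left_mono) auto
    also have "\<dots> = 2 * r * a powr (r - 1) * b + (r + 9 * r * K) * (a powr (r - 1) * c)"
      by (simp add: algebra_simps)
    also have "(r + 9 * r * K) * (a powr (r - 1) * c) \<le> C * (a powr (r - 1) * c)"
      using r c unfolding C_def by (intro mult_right_mono) auto
    also have "\<dots> \<le> C * (a powr (r - 1) * c + c powr r)"
      using C0 by (intro mult_left_mono) auto
    finally show ?thesis by simp
  qed
qed

section \<open>Integration by slices of a product\<close>

lemma AE_slices:
  assumes "AE z in lborel. P (z :: 'a::euclidean_space \<times> 'b::euclidean_space)"
  shows "AE y in lborel. AE x in lborel. P (x, y)"
proof -
  have "AE z in lborel \<Otimes>\<^sub>M lborel. P z" using assms unfolding lborel_prod .
  then obtain N where N: "N \<in> null_sets (lborel \<Otimes>\<^sub>M lborel)" "{z. \<not> P z} \<subseteq> N"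
    unfolding eventually_ae_filter by (auto simp: space_pair_measure)
  have "AE z in lborel \<Otimes>\<^sub>M lborel. z \<notin> N" by (rule AE_not_in[OF N(1)])
  then have "AE x in lborel. AE y in lborel. (x, y) \<notin> N"
    by (rule lborel_pair.AE_pair)
  moreover have "{z \<in> space (lborel \<Otimes>\<^sub>M lborel). (fst z, snd z) \<notin> N} \<in> sets (lborel \<Otimes>\<^sub>M lborel)"
  proof -
    have "{z \<in> space (lborel \<Otimes>\<^sub>M lborel). (fst z, snd z) \<notin> N} = space (lborel \<Otimes>\<^sub>M lborel) - N"
      by auto
    then show ?thesis using sets.compl_sets[OF null_setsD2[OF N(1)]] by simp
  qed
  ultimately have "AE y in lborel. AE x in lborel. (x, y) \<notin> N"
    using lborel_pair.AE_commute[of "\<lambda>x y. (x, y) \<notin> N"] by simp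
  then show ?thesis
    by (rule AE_mp) (rule AE_I2, intro impI, erule AE_mp, rule AE_I2, use N(2) in blast)
qed

lemma integrable_lebesgue_borel_representative:
  fixes f :: "'a::euclidean_space \<Rightarrow> real"
  assumes "integrable lebesgue f"
  obtains f' where "integrable lborel f'" "AE x in lborel. f x = f' x" "integral\<^sup>L lebesgue f = integral\<^sup>L lborel f'"
proof -
  obtain f' where f': "f' \<in> borel_measurable lborel" "AE x in lborel. f x = f' x"
    using completion_ex_borel_measurable_real[OF borel_measurable_integrable[OF assms]] by blast
  have ae: "AE x in lebesgue. f x = f' x" using f'(2) by (simp add: AE_completion_iff)
  have m: "f' \<in> borel_measurable lebesgue" using f'(1) by (rule measurable_completion)
  have "integrable lebesgue f'"
    using integrable_cong_AE[OF borel_measurable_integrable[OF assms] m ae] assms by simp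
  moreover have "integral\<^sup>L lebesgue f = integral\<^sup>L lebesgue f'"
    by (rule integral_cong_AE[OF borel_measurable_integrable[OF assms] m ae])
  ultimately show thesis
    using that[of f'] f' by (simp add: integrable_completion integral_completion)
qed

text \<open>
  Fubini's theorem for a Borel representative of \<open>f\<close>, in a form that compares one slice at a time: on almost
  every slice \<open>f\<close> is bounded below by an integrable \<open>g\<close>. The energy density, whose coefficients are
  merely measurable, is thus compared with functions that are continuous in \<open>X\<^sub>1\<close> on a box.
\<close>

lemma integral_le_by_slices:
  fixes f :: "'a::euclidean_space \<times> 'b::euclidean_space \<Rightarrow> real"
  assumes f: "integrable lebesgue f" and h: "integrable lebesgue h"
    and slice: "AE y in lborel. \<exists>g. integrable lborel g \<and> h y \<le> integral\<^sup>L lborel g \<and> (AE x in lborel. g x \<le> f (x, y))"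
  shows "integral\<^sup>L lebesgue h \<le> integral\<^sup>L lebesgue f"
proof -
  obtain f' where f': "integrable lborel f'" "AE z in lborel. f z = f' z" "integral\<^sup>L lebesgue f = integral\<^sup>L lborel f'"
    by (rule integrable_lebesgue_borel_representative[OF f])
  obtain h' where h': "integrable lborel h'" "AE y in lborel. h y = h' y" "integral\<^sup>L lebesgue h = integral\<^sup>L lborel h'"
    by (rule integrable_lebesgue_borel_representative[OF h])
  have f'i: "integrable (lborel \<Otimes>\<^sub>M lborel) (\<lambda>(x, y). f' (x, y))"
    using f'(1) by (simp add: lborel_prod)
  have "integral\<^sup>L lborel h' \<le> (\<integral>y. (\<integral>x. f' (x, y) \<partial>lborel) \<partial>lborel)"
  proof (rule integral_mono_AE[OF h'(1)])
    show "integrable lborel (\<lambda>y. \<integral>x. f' (x, y) \<partial>lborel)"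
      by (rule lborel_pair.integrable_snd[OF f'i])
    show "AE y in lborel. h' y \<le> (\<integral>x. f' (x, y) \<partial>lborel)"
      using slice h'(2) AE_slices[OF f'(2)] lborel_pair.AE_integrable_snd[OF f'i]
    proof eventually_elim
      case (elim y)
      then obtain g where g: "integrable lborel g" "h y \<le> integral\<^sup>L lborel g" "AE x in lborel. g x \<le> f (x, y)"
        by blast
      have "integral\<^sup>L lborel g \<le> (\<integral>x. f' (x, y) \<partial>lborel)"
      proof (rule integral_mono_AE[OF g(1)])
        show "AE x in lborel. g x \<le> f' (x, y)"
          using g(3) elim(3) by eventually_elim simp
      qed (use elim in simp)
      then show ?case using g(2) elim(2) by simp
    qed
  qed
  also have "\<dots> = integral\<^sup>L lborel f'"
    using lborel_pair.integral_snd[OF f'i] by (simp add: lborel_prod)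
  finally show ?thesis using f'(3) h'(3) by simp
qed

lemma integral_ge_by_slices:
  fixes f :: "'a::euclidean_space \<times> 'b::euclidean_space \<Rightarrow> real"
  assumes f: "integrable lebesgue f" and h: "integrable lebesgue h"
    and slice: "AE y in lborel. \<exists>g. integrable lborel g \<and> integral\<^sup>L lborel g \<le> h y \<and> (AE x in lborel. f (x, y) \<le> g x)"
  shows "integral\<^sup>L lebesgue f \<le> integral\<^sup>L lebesgue h"
proof -
  have "integral\<^sup>L lebesgue (\<lambda>y. - h y) \<le> integral\<^sup>L lebesgue (\<lambda>z. - f z)"
  proof (rule integral_le_by_slices)
    show "AE y in lborel. \<exists>g. integrable lborel g \<and> - h y \<le> integral\<^sup>L lborel g \<and> (AE x in lborel. g x \<le> - f (x, y))"
      using slice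
    proof eventually_elim
      case (elim y)
      then obtain g where "integrable lborel g" "integral\<^sup>L lborel g \<le> h y" "AE x in lborel. f (x, y) \<le> g x" by blast
      then show ?case by (intro exI[of _ "\<lambda>x. - g x"]) simp
    qed
  qed (use f h in auto)
  then show ?thesis by simp
qed

text \<open>
  Preimages of Borel sets are not enough here: coefficients depending on \<open>X\<^sub>2\<close> are only Lebesgue
  measurable. Null sets pull back to null sets under the projection.
\<close>

lemma measurable_snd_lebesgue:
  "snd \<in> measurable (lebesgue :: ('a::euclidean_space \<times> 'b::euclidean_space) measure) lebesgue"
proof (rule measurableI)
  fix S :: "'b set" assume "S \<in> sets lebesgue"
  then obtain S' N N' where S: "S = S' \<union> N" "N \<subseteq> N'" "N' \<in> null_sets lborel" "S' \<in> sets lborel"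
    by (rule sets_completionE)
  have "(UNIV :: 'a set) \<times> N' \<in> null_sets (lborel \<Otimes>\<^sub>M lborel)"
    using S(3) by (intro null_setsI) (auto simp: lborel.emeasure_pair_measure_Times null_sets_def)
  moreover have "(UNIV :: 'a set) \<times> S' \<in> sets (lborel \<Otimes>\<^sub>M lborel)"
    using S(4) by (intro pair_measureI) auto
  ultimately have N: "(UNIV :: 'a set) \<times> N' \<in> null_sets lborel" "(UNIV :: 'a set) \<times> S' \<in> sets lborel"
    unfolding lborel_prod .
  have "snd -` S \<inter> space lebesgue = (UNIV :: 'a set) \<times> S' \<union> UNIV \<times> N" using S(1) by auto
  then show "snd -` S \<inter> space lebesgue \<in> sets (lebesgue :: ('a \<times> 'b) measure)"
    by (rule sets_completionI[OF _ _ N]) (use S(2) in auto)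
qed simp

lemma measurable_snd_lebesgue_on:
  assumes "f \<in> borel_measurable (lebesgue_on T)" "\<Omega> \<subseteq> UNIV \<times> T"
  shows "(\<lambda>z. f (snd z)) \<in> borel_measurable (lebesgue_on \<Omega>)"
proof -
  have "snd \<in> measurable (lebesgue_on \<Omega>) (lebesgue_on T)"
    by (intro measurable_restrict_space3 measurable_snd_lebesgue) (use assms(2) in auto)
  from measurable_compose[OF this assms(1)] show ?thesis .
qed

section \<open>Dilations, powers and one-sided limits\<close>

lemma lborel_integral_scaleR:
  fixes f :: "'a::euclidean_space \<Rightarrow> real"
  assumes "l > 0" "f \<in> borel_measurable borel"
  shows "(\<integral>x. f ((1 / l) *\<^sub>R x) \<partial>lborel) = l ^ DIM('a) * (\<integral>x. f x \<partial>lborel)"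
proof -
  have "(\<integral>x. f ((1 / l) *\<^sub>R x) \<partial>lborel) =
      (\<integral>x. f ((1 / l) *\<^sub>R x) \<partial>density (distr lborel borel (\<lambda>x. 0 + l *\<^sub>R x)) (\<lambda>_. \<bar>l\<bar> ^ DIM('a)))"
    using lborel_affine[of l "0::'a"] assms(1) by simp
  also have "\<dots> = (\<integral>x. l ^ DIM('a) * f ((1 / l) *\<^sub>R x) \<partial>distr lborel borel (\<lambda>x. 0 + l *\<^sub>R x))"
    using assms by (subst integral_density) auto
  also have "\<dots> = (\<integral>x. l ^ DIM('a) * f ((1 / l) *\<^sub>R (0 + l *\<^sub>R x)) \<partial>lborel)"
    using assms by (subst integral_distr) auto
  also have "\<dots> = l ^ DIM('a) * (\<integral>x. f x \<partial>lborel)"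
    using assms by simp
  finally show ?thesis .
qed

text \<open>
  With \<open>p > 1\<close> the origin is included; on the left of it \<open>\<bar>t\<bar>\<^sup>p\<close> is differentiable as well, which is what
  makes \<open>v\<^sup>p\<close> differentiable at the zeros of a nonnegative function \<open>v\<close>.
\<close>

lemma DERIV_abs_powr:
  fixes p t :: real
  assumes p: "1 < p" and t: "0 \<le> t"
  shows "((\<lambda>t. \<bar>t\<bar> powr p) has_real_derivative p * t powr (p - 1)) (at t)"
proof (cases "t = 0")
  case False
  have "((\<lambda>t. t powr p) has_real_derivative p * t powr (p - 1)) (at t)"
    using t False by (intro has_real_derivative_powr) auto
  then show ?thesis
    by (rule has_field_derivative_transform_within_open[where S="{0<..}"]) (use t False in auto)
next
  case True
  have "((\<lambda>h::real. \<bar>h\<bar> powr p / h) \<longlongrightarrow> 0) (at 0)"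
  proof (rule tendsto_rabs_zero_cancel, rule tendsto_cong[THEN iffD1])
    show "((\<lambda>h::real. \<bar>h\<bar> powr (p - 1)) \<longlongrightarrow> 0) (at 0)"
      by (rule tendsto_eq_rhs[OF tendsto_powr'[where a=0 and b="p-1"]])
        (use p in \<open>auto intro!: tendsto_eq_intros\<close>)
    show "\<forall>\<^sub>F h::real in at 0. \<bar>h\<bar> powr (p - 1) = \<bar>\<bar>h\<bar> powr p / h\<bar>"
      by (auto simp: eventually_at_filter powr_diff)
  qed
  then show ?thesis using True p by (simp add: DERIV_def)
qed

lemma le_limit_at_right_0:
  fixes F :: "real \<Rightarrow> real"
  assumes "(F \<longlongrightarrow> Y) (at_right 0)" "\<And>s. 0 < s \<Longrightarrow> s < 1 \<Longrightarrow> X \<le> F s"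
  shows "X \<le> Y"
proof (rule tendsto_lowerbound[OF assms(1)])
  show "\<forall>\<^sub>F s in at_right 0. X \<le> F s"
    by (rule eventually_mono[OF eventually_at_right_real[of 0 1]]) (use assms(2) in auto)
qed simp

section \<open>The block coefficients\<close>

lemma continuous_on_matrix_vector_mult:
  fixes f :: "'c::topological_space \<Rightarrow> real^'a^'b"
  assumes "continuous_on S f" "continuous_on S g"
  shows "continuous_on S (\<lambda>x. f x *v g x)"
  unfolding matrix_vector_mult_def
  by (intro continuous_on_vec_lambda continuous_intros assms)

lemma borel_measurable_matrix_vector_mult:
  fixes f :: "'c \<Rightarrow> real^'a^'b"
  assumes "f \<in> borel_measurable N" "g \<in> borel_measurable N"
  shows "(\<lambda>x. f x *v g x) \<in> borel_measurable N"
  by (rule borel_measurable_continuous_Pair[OF assms])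
    (intro continuous_on_matrix_vector_mult continuous_intros)

lemma transpose_inner: "(transpose B *v a) \<bullet> b = (B *v b) \<bullet> (a :: real^'n)"
  by (metis dot_lmul_matrix inner_commute transpose_matrix_vector)

lemma block_field_inner:
  "block_field A11 A12 A22 x \<xi> \<bullet> \<eta> =
    (A11 x *v fst \<xi>) \<bullet> fst \<eta> + (A12 (snd x) *v snd \<xi>) \<bullet> fst \<eta> +
    (A12 (snd x) *v snd \<eta>) \<bullet> fst \<xi> + (A22 (snd x) *v snd \<xi>) \<bullet> snd \<eta>"
  unfolding block_field_def inner_prod_def fst_conv snd_conv inner_add_left transpose_inner by simp

lemma linear_block_field: "linear (block_field A11 A12 A22 x)"
  by (rule linearI) (simp_all add: block_field_def matrix_vector_right_distrib matrix_vector_mult_scaleR scaleR_add_right)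

text \<open>
  The hypotheses on the coefficients in the form in which they are used: symmetry and both bounds are merged into
  one statement about the quadratic form at almost every point.
\<close>

locale block_coefficients =
  fixes p M lam :: real
    and \<omega>2 :: "(real^'k) set"
    and A11 :: "(real^'m) \<times> (real^'k) \<Rightarrow> real^'m^'m"
    and A12 :: "real^'k \<Rightarrow> real^'k^'m"
    and A22 :: "real^'k \<Rightarrow> real^'k^'k"
  assumes p: "2 \<le> p" and pos: "0 < lam" "0 < M"
    and omega2: "open \<omega>2" "bounded \<omega>2" "\<omega>2 \<noteq> {}"
    and measurable_A11: "A11 \<in> borel_measurable (lebesgue_on (UNIV \<times> \<omega>2))"
    and measurable_A12: "A12 \<in> borel_measurable (lebesgue_on \<omega>2)"
    and continuous_A22: "continuous_on \<omega>2 A22"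
    and elliptic_A: "AE x in lebesgue_on (UNIV \<times> \<omega>2). elliptic_form lam M (block_field A11 A12 A22 x)"
begin

abbreviation A where "A \<equiv> block_field A11 A12 A22"
abbreviation B where "B \<equiv> (\<lambda>y \<eta>. A22 y *v \<eta>)"
abbreviation \<mu> where "\<mu> \<equiv> rayleigh_inf p \<omega>2 B"

lemma p0: "0 < p" and p1: "1 \<le> p" using p by auto

text \<open>
  The form of \<open>A22\<close> is the restriction of the full form to vectors with vanishing first component.
\<close>

lemma elliptic_form_section:
  assumes "elliptic_form lam M (A (x, y))"
  shows "elliptic_form lam M (B y)"
proof -
  have *: "A (x, y) (0, \<eta>) \<bullet> (0, \<eta>') = B y \<eta> \<bullet> \<eta>'" for \<eta> \<eta>'
    by (simp add: block_field_inner)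
  have n: "norm (0 :: real^'m, \<eta>) = norm \<eta>" for \<eta> :: "real^'k" by (simp add: norm_prod_def)
  show ?thesis
    using assms unfolding elliptic_form_def *[symmetric] n[symmetric]
    by (blast intro: matrix_vector_mul_linear)
qed

lemma elliptic_A_sections:
  "AE y in lborel. y \<in> \<omega>2 \<longrightarrow> (AE x in lborel. elliptic_form lam M (A (x, y)))"
proof -
  have "UNIV \<times> \<omega>2 \<in> sets (lebesgue :: ((real^'m) \<times> (real^'k)) measure)"
    by (intro sets_completionI_sets) (simp add: borel_open open_Times omega2)
  then have "AE x in lebesgue. x \<in> UNIV \<times> \<omega>2 \<longrightarrow> elliptic_form lam M (A x)"
    using elliptic_A by (subst (asm) AE_restrict_space_iff) auto
  then have "AE x in lborel. x \<in> UNIV \<times> \<omega>2 \<longrightarrow> elliptic_form lam M (A x)"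
    by (simp add: AE_completion_iff)
  from AE_slices[OF this] show ?thesis by eventually_elim auto
qed

text \<open>
  The bounds for \<open>A\<close> hold at almost every point of the strip; for almost every \<open>X\<^sub>2\<close> they therefore hold at some
  \<open>(X\<^sub>1, X\<^sub>2)\<close>, and \<open>A22\<close> sees only \<open>X\<^sub>2\<close>.
\<close>

lemma elliptic_B_lborel: "AE y in lborel. y \<in> \<omega>2 \<longrightarrow> elliptic_form lam M (B y)"
  using elliptic_A_sections
proof eventually_elim
  case (elim y)
  show ?case
  proof
    assume "y \<in> \<omega>2"
    then have ae: "AE x in lborel. elliptic_form lam M (A (x, y))" using elim by blast
    have "ae_filter (lborel :: (real^'m) measure) \<noteq> bot"
      by (simp add: ae_filter_eq_bot_iff)
    then obtain x where "elliptic_form lam M (A (x, y))"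
      using eventually_happens[OF ae] by auto
    then show "elliptic_form lam M (B y)" by (rule elliptic_form_section)
  qed
qed

lemma elliptic_B: "AE y in lebesgue_on \<omega>2. elliptic_form lam M (B y)"
  using elliptic_B_lborel omega2 by (subst AE_restrict_space_iff) (auto simp: AE_completion_iff)

lemma measurable_A22: "A22 \<in> borel_measurable (lebesgue_on \<omega>2)"
  using continuous_imp_measurable_on_sets_lebesgue[OF continuous_A22] omega2 by simp

lemma measurable_form_A:
  assumes "\<Omega> \<subseteq> UNIV \<times> \<omega>2"
  shows "measurable_form \<Omega> A"
  unfolding measurable_form_def
proof
  fix g :: "(real^'m) \<times> (real^'k) \<Rightarrow> (real^'m) \<times> (real^'k)"
  assume g: "g \<in> borel_measurable (lebesgue_on \<Omega>)"
  have 1: "A11 \<in> borel_measurable (lebesgue_on \<Omega>)"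
    using measurable_restrict_mono[OF measurable_A11 assms] .
  note 2 = measurable_snd_lebesgue_on[OF measurable_A12 assms] measurable_snd_lebesgue_on[OF measurable_A22 assms]
  have 3: "(\<lambda>x. fst (g x)) \<in> borel_measurable (lebesgue_on \<Omega>)" "(\<lambda>x. snd (g x)) \<in> borel_measurable (lebesgue_on \<Omega>)"
    by (rule borel_measurable_continuous_on[OF _ g]; intro continuous_intros)+
  show "(\<lambda>x. A x (g x) \<bullet> g x) \<in> borel_measurable (lebesgue_on \<Omega>)"
    unfolding block_field_inner
    by (intro borel_measurable_add borel_measurable_inner borel_measurable_matrix_vector_mult 1 2 3 g)
qed

lemma measurable_form_B: "measurable_form \<omega>2 B"
  unfolding measurable_form_def
  by (intro ballI borel_measurable_inner borel_measurable_matrix_vector_mult measurable_A22)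

lemma open_strip: "open (UNIV \<times> \<omega>2 :: ((real^'m) \<times> (real^'k)) set)"
  by (rule open_Times[OF open_UNIV omega2(1)])

lemma test_function_Lp:
  assumes "\<phi> \<in> test_functions \<Omega>" "open \<Omega>"
  shows "Lp p \<Omega> \<phi>" "Lp p \<Omega> (gradient \<phi>)"
  using test_function_W1p_0[OF assms p0] unfolding W1p_0_def W1p_def by auto

lemma integrable_energy_A:
  assumes u: "u \<in> test_functions (UNIV \<times> \<omega>2)"
  shows "integrable lebesgue (\<lambda>x. \<bar>A x (gradient u x) \<bullet> gradient u x\<bar> powr (p / 2))"
proof -
  obtain K where K: "K \<subseteq> UNIV \<times> \<omega>2" "\<And>x. x \<notin> K \<Longrightarrow> gradient u x = 0"
    using test_function_support[OF u] by blast
  have z: "gradient u x = 0" if "x \<notin> UNIV \<times> \<omega>2" for x using K that by blast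
  have "integrable (lebesgue_on (UNIV \<times> \<omega>2)) (\<lambda>x. \<bar>A x (gradient u x) \<bullet> gradient u x\<bar> powr (p / 2))"
    by (rule integrable_energy_density[OF p0 pos elliptic_A measurable_form_A[OF order_refl] test_function_Lp(2)[OF u open_strip]])
  then show ?thesis
    by (subst (asm) integral_lebesgue_on_eq_lebesgue(2)) (use open_strip z in auto)
qed

lemma integrable_energy_B:
  assumes W: "W \<in> test_functions \<omega>2"
  shows "integrable lebesgue (\<lambda>y. \<bar>B y (gradient W y) \<bullet> gradient W y\<bar> powr (p / 2))"
proof -
  obtain K where K: "K \<subseteq> \<omega>2" "\<And>x. x \<notin> K \<Longrightarrow> gradient W x = 0"
    using test_function_support[OF W] by blast
  have z: "gradient W x = 0" if "x \<notin> \<omega>2" for x using K that by blast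
  have "integrable (lebesgue_on \<omega>2) (\<lambda>x. \<bar>B x (gradient W x) \<bullet> gradient W x\<bar> powr (p / 2))"
    by (rule integrable_energy_density[OF p0 pos elliptic_B measurable_form_B test_function_Lp(2)[OF W omega2(1)]])
  then show ?thesis
    by (subst (asm) integral_lebesgue_on_eq_lebesgue(2)) (use omega2 z in auto)
qed

lemma mu_nonneg: "0 \<le> \<mu>"
  by (rule rayleigh_inf_nonneg[OF omega2(1,3) p1 pos elliptic_B measurable_form_B])

lemma mu_le_test: "W \<in> test_functions \<omega>2 \<Longrightarrow> \<mu> * Lp_mass p W \<le> energy p B W"
  by (rule rayleigh_inf_le_test[OF _ omega2(1) p0])

end

section \<open>The lower bound by averaging over the axis directions\<close>

lemma integral_cbox_eq_lborel:
  fixes f :: "'a::euclidean_space \<Rightarrow> real"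
  assumes "continuous_on UNIV f"
  shows "integrable lborel (\<lambda>x. indicator (cbox a b) x * f x)"
    "(\<integral>x. indicator (cbox a b) x * f x \<partial>lborel) = integral (cbox a b) f"
proof -
  have c: "continuous_on (cbox a b) f" using assms continuous_on_subset by blast
  have i: "set_integrable lborel (cbox a b) f"
    unfolding set_integrable_def by (rule borel_integrable_compact[OF compact_cbox c])
  then show "integrable lborel (\<lambda>x. indicator (cbox a b) x * f x)"
    by (simp add: set_integrable_def)
  show "(\<integral>x. indicator (cbox a b) x * f x \<partial>lborel) = integral (cbox a b) f"
    using set_borel_integral_eq_integral(2)[OF i] by (simp add: set_lebesgue_integral_def)
qed

text \<open>
  Picone's inequality at one point. Let \<open>S = u\<^sup>2 + \<delta>\<^sup>2\<close>, let \<open>w\<close> be its square root, \<open>q\<close> the form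
  \<open>A22 \<nabla>V \<cdot> \<nabla>V\<close>, \<open>a\<close> the norm of \<open>\<nabla>u\<close> in the form of \<open>A\<close>, and \<open>D\<close> the derivative of \<open>w\<^sup>p\<close> along
  \<open>A (0, \<nabla>V)\<close>. The claim is the tangent inequality for the power \<open>a\<^sup>p\<close> at the norm of the vector
  \<open>(w / V) (0, \<nabla>V)\<close>.
\<close>

lemma Picone_pointwise:
  fixes p S V q a X P D :: real
  assumes p: "2 \<le> p" and S: "0 < S" and V: "0 < V" and q: "0 < q" and a: "0 \<le> a"
    and D: "D \<le> p * S powr (p / 2 - 1) * (sqrt S * (a * sqrt q))"
  shows "V powr (1 - p) * q powr (p / 2 - 1) * D - (p - 1) * V powr (- p) * q powr (p / 2) * S powr (p / 2) \<le> a powr p"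
proof -
  define b where "b = S powr (1/2) * q powr (1/2) * V powr (- 1)"
  have b: "b powr s = S powr (s / 2) * q powr (s / 2) * V powr (- s)" for s
    unfolding b_def using S q V by (simp add: powr_mult powr_divide powr_powr powr_minus_divide)
  have "V powr (1 - p) * q powr (p / 2 - 1) * D \<le> V powr (1 - p) * q powr (p / 2 - 1) * (p * S powr (p / 2 - 1) * (sqrt S * (a * sqrt q)))"
    using D by (intro mult_left_mono) auto
  also have "\<dots> = p * (S powr (p / 2 - 1) * S powr (1/2)) * (q powr (p / 2 - 1) * q powr (1/2)) * V powr (1 - p) * a"
    using S q by (simp add: powr_half_sqrt mult_ac)
  also have "\<dots> = p * b powr (p - 1) * a"
    unfolding b powr_add[symmetric] by (simp add: diff_divide_distrib mult_ac)
  finally have "V powr (1 - p) * q powr (p / 2 - 1) * D - (p - 1) * V powr (- p) * q powr (p / 2) * S powr (p / 2)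
      \<le> p * b powr (p - 1) * a - (p - 1) * b powr p"
    by (simp add: b mult_ac)
  also have "\<dots> \<le> a powr p"
    by (rule Young_tangent) (use a p in \<open>auto simp: b_def\<close>)
  finally show ?thesis .
qed

context block_coefficients
begin

text \<open>
  The heart of the lower bound. For \<open>V(X\<^sub>2) = (\<integral> (u\<^sup>2 + \<delta>\<^sup>2)\<^bsup>p/2\<^esup> dX\<^sub>1)\<^bsup>1/p\<^esup>\<close>, integrated over a box that
  contains the support of \<open>u\<close>, Picone's inequality bounds the energy density of \<open>u\<close> from below, and
  the bound is integrated over \<open>X\<^sub>1\<close>. The vector \<open>e = A (0, \<nabla>V)\<close> does not depend on \<open>X\<^sub>1\<close>, because \<open>A11\<close>
  does not act on it. Hence its first component meets the integral of an \<open>X\<^sub>1\<close>-derivative, which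
  vanishes, and its second component meets \<open>\<nabla>(V\<^sup>p)\<close>. What remains is exactly the energy density of \<open>V\<close>.
  The regularisation by \<open>\<delta>\<close> keeps \<open>V\<close> positive and smooth; outside the support of \<open>u\<close> it is
  the constant \<open>c0\<close>, so that \<open>V - c0\<close> is a test function.
\<close>

lemma energy_strip_ge_section:
  assumes u: "u \<in> test_functions (UNIV \<times> \<omega>2)" and \<delta>: "0 < \<delta>"
    and K: "smooth u" "compact K" "K \<subseteq> UNIV \<times> \<omega>2" "\<forall>z. z \<notin> K \<longrightarrow> u z = 0"
    and box: "insert 0 (fst ` K) \<subseteq> box (- b) b"
  defines "G \<equiv> (\<lambda>y. integral (cbox (- b) b) (\<lambda>x. (u (x, y) ^ 2 + \<delta> ^ 2) powr (p / 2)))"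
  defines "c0 \<equiv> (\<delta> powr p * measure lborel (cbox (- b) b)) powr (1 / p)"
  defines "U \<equiv> (\<lambda>y. G y powr (1 / p) + - c0)"
  shows "U \<in> test_functions \<omega>2" "energy p B U \<le> energy p A u"
    "\<And>y. 0 \<le> U y" "\<And>y. (\<integral>x. \<bar>u (x, y)\<bar> powr p \<partial>lborel) \<le> (U y + c0) powr p"
    "\<And>y. integrable lborel (\<lambda>x. \<bar>u (x, y)\<bar> powr p)"
proof -
  define P where "P = (\<lambda>z. (u z * u z + \<delta> ^ 2) powr (p / 2))"
  define vol where "vol = measure lborel (cbox (- b) b)"
  have S0: "0 < u z * u z + \<delta> ^ 2" for z
    using \<delta> by (simp add: add_nonneg_pos)
  have G: "G = (\<lambda>y. integral (cbox (- b) b) (\<lambda>x. P (x, y)))"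
    unfolding G_def P_def by (simp add: power2_eq_square)
  have sP: "smooth P" unfolding P_def
    by (intro smooth_powr smooth_add smooth_mult smooth_const K S0)
  have sG: "smooth G" unfolding G by (rule smooth_integral_parameter[OF sP])
  have cP: "continuous_on UNIV (\<lambda>x. P (x, y))" for y
    by (intro continuous_on_compose2[OF smooth_continuous[OF sP, of UNIV]] continuous_intros) auto
  have cu: "continuous_on UNIV (\<lambda>x. u (x, y))" for y
    by (intro continuous_on_compose2[OF smooth_continuous[OF K(1), of UNIV]] continuous_intros) auto
  have vol: "0 < vol"
  proof -
    have "\<forall>i\<in>Basis. (- b) \<bullet> i < b \<bullet> i" using box by (auto simp: mem_box)
    then show ?thesis unfolding vol_def using content_pos_lt_eq[of "- b" b] by blast
  qed
  have P_ge: "\<delta> powr p \<le> P z" "\<bar>u z\<bar> powr p \<le> P z" for z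
  proof -
    have "(\<delta> ^ 2) powr (p / 2) \<le> P z" unfolding P_def using p0 by (intro powr_mono2) auto
    then show "\<delta> powr p \<le> P z" using \<delta> by (simp add: powr_half)
    have "(\<bar>u z\<bar> ^ 2) powr (p / 2) \<le> P z" unfolding P_def using p0 by (intro powr_mono2) (auto simp: power2_eq_square)
    then show "\<bar>u z\<bar> powr p \<le> P z" by (simp add: powr_half)
  qed
  have P_out: "P z = \<delta> powr p" if "z \<notin> K" for z
    using K(4)[rule_format, OF that] \<delta> by (simp add: P_def powr_half)
  have const: "integral (cbox (- b) b) (\<lambda>x. \<delta> powr p) = \<delta> powr p * vol"
    by (simp add: vol_def)
  have G_ge: "\<delta> powr p * vol \<le> G y" for y
    unfolding G const[symmetric]
    by (intro integral_le integrable_continuous continuous_on_subset[OF cP] continuous_intros P_ge) auto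
  have dv: "0 < \<delta> powr p * vol" using \<delta> vol by simp
  have G0: "0 < G y" for y using G_ge[of y] dv by linarith
  have c0: "c0 = (\<delta> powr p * vol) powr (1 / p)" "0 \<le> c0" by (simp_all add: c0_def vol_def)
  show U0: "0 \<le> U y" for y
    using powr_mono2[OF _ _ G_ge[of y], of "1 / p"] dv p0 unfolding U_def c0(1) by simp
  have sU: "smooth U" unfolding U_def by (intro smooth_add smooth_const smooth_powr sG G0)
  let ?K2 = "snd ` K"
  have K2: "compact ?K2" "?K2 \<subseteq> \<omega>2"
    using compact_continuous_image[OF continuous_on_snd[OF continuous_on_id] K(2)] K(3) by auto
  have "U y = 0" if "y \<notin> ?K2" for y
  proof -
    have "(x, y) \<notin> K" for x using that by force
    then have "G y = \<delta> powr p * vol" unfolding G using P_out const by simp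
    then show ?thesis by (simp add: U_def c0(1))
  qed
  then show Ut: "U \<in> test_functions \<omega>2"
    using sU K2 by (intro test_functionsI[of U ?K2]) auto
  have inbox: "x \<in> cbox (- b) b" if "(x, y) \<in> K" for x y
    using box that box_subset_cbox by force
  have iP: "integrable lborel (\<lambda>x. indicator (cbox (- b) b) x * P (x, y))"
      "(\<integral>x. indicator (cbox (- b) b) x * P (x, y) \<partial>lborel) = G y" for y
    using integral_cbox_eq_lborel[OF cP] by (simp_all add: G)
  show iu: "integrable lborel (\<lambda>x. \<bar>u (x, y)\<bar> powr p)" for y
    using integrable_powr_compact_support[OF cu[of y] compact_continuous_image[OF continuous_on_fst[OF continuous_on_id] K(2)] _ p0]
      K(4) by (force simp: image_iff)
  show "(\<integral>x. \<bar>u (x, y)\<bar> powr p \<partial>lborel) \<le> (U y + c0) powr p" for y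
  proof -
    have "(\<integral>x. \<bar>u (x, y)\<bar> powr p \<partial>lborel) \<le> (\<integral>x. indicator (cbox (- b) b) x * P (x, y) \<partial>lborel)"
    proof (rule integral_mono[OF iu iP(1)])
      fix x
      show "\<bar>u (x, y)\<bar> powr p \<le> indicator (cbox (- b) b) x * P (x, y)"
        using P_ge(2)[of "(x, y)"] K(4)[rule_format, of "(x, y)"] inbox[of x y] p0
        by (cases "(x, y) \<in> K") (auto simp: indicator_def P_def)
    qed
    also have "\<dots> = (U y + c0) powr p"
      unfolding iP U_def using G0[of y] p0 by (simp add: powr_powr)
    finally show ?thesis .
  qed
  show "energy p B U \<le> energy p A u"
    unfolding energy_def
  proof (rule integral_le_by_slices[OF integrable_energy_A[OF u] integrable_energy_B[OF Ut]])
    show "AE y in lborel. \<exists>g. integrable lborel g \<and> \<bar>B y (gradient U y) \<bullet> gradient U y\<bar> powr (p / 2) \<le> integral\<^sup>L lborel g \<and>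
        (AE x in lborel. g x \<le> \<bar>A (x, y) (gradient u (x, y)) \<bullet> gradient u (x, y)\<bar> powr (p / 2))"
      using elliptic_A_sections elliptic_B_lborel
    proof eventually_elim
      case (elim y)
      define d where "d = gradient U y"
      define q where "q = B y d \<bullet> d"
      \<comment> \<open>Where \<open>q\<close> vanishes there is nothing to prove; the powers of \<open>q\<close> below need \<open>q > 0\<close>, since
        \<open>0 powr 0 = 0\<close>.\<close>
      show ?case
      proof (cases "y \<in> \<omega>2 \<and> q \<noteq> 0")
        case False
        have "q = 0"
        proof (cases "y \<in> \<omega>2")
          case True then show ?thesis using False by simp
        next
          case F: False
          obtain K' where "K' \<subseteq> \<omega>2" "\<And>x. x \<notin> K' \<Longrightarrow> gradient U x = 0"
            using test_function_support[OF Ut] by blast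
          then have "d = 0" using F unfolding d_def by blast
          then show ?thesis by (simp add: q_def)
        qed
        then show ?thesis by (intro exI[of _ "\<lambda>x. 0"]) (simp add: q_def d_def)
      next
        case True
        then have ell_y: "AE x in lborel. elliptic_form lam M (A (x, y))" and gB: "elliptic_form lam M (B y)"
          using elim by auto
        have q: "0 < q" using elliptic_form_nonneg[OF gB pos(1), of d] True by (simp add: q_def)
        define V where "V = G y powr (1 / p)"
        have V: "0 < V" using G0[of y] by (simp add: V_def)
        have VG: "G y = V powr p" using G0[of y] p0 by (simp add: V_def powr_powr)
        define e where "e = (A12 y *v d, A22 y *v d)"
        define \<alpha> where "\<alpha> = V powr (1 - p) * q powr (p / 2 - 1)"
        define \<beta> where "\<beta> = (p - 1) * V powr (- p) * q powr (p / 2)"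
        define g where "g = (\<lambda>x. indicator (cbox (- b) b) x * (\<alpha> * (gradient P (x, y) \<bullet> e) - \<beta> * P (x, y)))"
        have cg: "continuous_on UNIV (\<lambda>x. gradient P (x, y) \<bullet> e')" for e'
          by (intro continuous_intros continuous_on_compose2[OF smooth_continuous_gradient[OF sP, of UNIV]]) auto
        have gi: "integrable lborel g"
          unfolding g_def by (intro integral_cbox_eq_lborel(1) continuous_intros cg cP)
        have int_on: "f integrable_on cbox (- b) b" if "continuous_on UNIV f" for f :: "real^'m \<Rightarrow> real"
          using that by (intro integrable_continuous continuous_on_subset[OF that]) auto
        have dG: "gradient G y \<bullet> h = integral (cbox (- b) b) (\<lambda>x. gradient P (x, y) \<bullet> (0, h))" for h
          using frechet_gradient[OF smooth_differentiable[OF sG], of y h]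
            partial_eq[OF integral_parameter_has_derivative[OF sP, of "- b" b y], of h] unfolding G by simp
        \<comment> \<open>The chain rule for \<open>V = G\<^bsup>1/p\<^esup>\<close>, read backwards below as \<open>\<nabla>G = p V\<^bsup>p-1\<^esup> \<nabla>V\<close>.\<close>
        have dU: "d = ((1 / p) * G y powr (1 / p - 1)) *\<^sub>R gradient G y"
          unfolding d_def
        proof (rule gradient_eqI)
          have D: "((\<lambda>t. t powr (1 / p) + - c0) has_real_derivative (1 / p) * G y powr (1 / p - 1)) (at (G y))"
            using G0[of y] by (auto intro!: derivative_eq_intros simp: powr_diff)
          show "(U has_derivative (\<lambda>h. ((1 / p) * G y powr (1 / p - 1)) *\<^sub>R gradient G y \<bullet> h)) (at y)"
            using partial_chain_real[OF smooth_differentiable[OF sG] D]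
            unfolding frechet_gradient[OF smooth_differentiable[OF sG]] U_def by simp
        qed
        have "V powr (1 - p) = G y powr (1 / p - 1)"
          using G0[of y] p0 by (simp add: V_def powr_powr field_simps)
        then have "V powr (p - 1) * G y powr (1 / p - 1) = V powr (p - 1) * V powr (1 - p)" by simp
        also have "\<dots> = 1" unfolding powr_add[symmetric] using V by simp
        finally have gG: "gradient G y = (p * V powr (p - 1)) *\<^sub>R d"
          using p0 by (simp add: dU)
        have I1: "integral (cbox (- b) b) (\<lambda>x. gradient P (x, y) \<bullet> (fst e, 0)) = 0"
        proof -
          have D: "((\<lambda>x. P (x, y) - \<delta> powr p) has_derivative (\<lambda>h. gradient P (x, y) \<bullet> (h, 0))) (at x)" for x
            by (rule has_derivative_eq_rhs[OF has_derivative_diff[OF has_derivative_compose[OF _ smooth_has_derivative[OF sP], of "\<lambda>x. (x, y)"] has_derivative_const]])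
              (auto intro!: derivative_eq_intros)
          have cK1: "compact (fst ` K)" by (intro compact_continuous_image continuous_intros K)
          have o: "P (x, y) - \<delta> powr p = 0" if "x \<notin> fst ` K" for x
          proof -
            have "(x, y) \<notin> K" using that by force
            then show ?thesis by (simp add: P_out)
          qed
          have "(\<integral>x. gradient P (x, y) \<bullet> (fst e, 0) \<partial>lborel) = 0"
            by (rule integral_directional_derivative_eq_0[OF D cg cK1 o])
          moreover have "gradient P (x, y) = 0" if "x \<notin> cbox (- b) b" for x
          proof (rule gradient_eqI)
            have n: "(x, y) \<in> - K" using inbox that by blast
            have "((\<lambda>z. \<delta> powr p) has_derivative (\<lambda>h. 0 \<bullet> h)) (at (x, y))" by simp
            then show "(P has_derivative (\<lambda>h. 0 \<bullet> h)) (at (x, y))"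
              by (rule has_derivative_transform_within_open[where s="- K"])
                (use n P_out compact_imp_closed[OF K(2)] in auto)
          qed
          then have "(\<lambda>x. gradient P (x, y) \<bullet> (fst e, 0)) = (\<lambda>x. indicator (cbox (- b) b) x * (gradient P (x, y) \<bullet> (fst e, 0)))"
            by (auto simp: indicator_def fun_eq_iff)
          ultimately show ?thesis using integral_cbox_eq_lborel(2)[OF cg[of "(fst e, 0)"], of "- b" b] by simp
        qed
        have I2: "integral (cbox (- b) b) (\<lambda>x. gradient P (x, y) \<bullet> (0, snd e)) = p * V powr (p - 1) * q"
          unfolding dG[symmetric] gG by (simp add: e_def q_def inner_commute)
        have "gradient P (x, y) \<bullet> e = gradient P (x, y) \<bullet> (fst e, 0) + gradient P (x, y) \<bullet> (0, snd e)" for x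
          by (simp add: inner_prod_def)
        then have I: "integral (cbox (- b) b) (\<lambda>x. gradient P (x, y) \<bullet> e) = p * V powr (p - 1) * q"
          using I1 I2 by (simp add: integral_add int_on[OF cg])
        have "integral\<^sup>L lborel g = integral (cbox (- b) b) (\<lambda>x. \<alpha> * (gradient P (x, y) \<bullet> e) - \<beta> * P (x, y))"
          unfolding g_def by (intro integral_cbox_eq_lborel(2) continuous_intros cg cP)
        also have "\<dots> = \<alpha> * (p * V powr (p - 1) * q) - \<beta> * G y"
          using I by (subst integral_diff) (auto simp: G intro!: int_on continuous_intros cg cP)
        also have "\<dots> = p * (V powr (1 - p) * V powr (p - 1)) * (q powr (p / 2 - 1) * q powr 1) - (p - 1) * (V powr (- p) * V powr p) * q powr (p / 2)"
          using q by (simp add: \<alpha>_def \<beta>_def VG mult_ac)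
        also have "\<dots> = q powr (p / 2)"
          unfolding powr_add[symmetric] using V q by (simp add: algebra_simps)
        finally have int_g: "integral\<^sup>L lborel g = q powr (p / 2)" .
        have "AE x in lborel. g x \<le> \<bar>A (x, y) (gradient u (x, y)) \<bullet> gradient u (x, y)\<bar> powr (p / 2)"
          using ell_y
        proof eventually_elim
          case (elim x)
          let ?S = "u (x, y) * u (x, y) + \<delta> ^ 2" and ?\<xi> = "gradient u (x, y)"
          let ?a = "sqrt (A (x, y) ?\<xi> \<bullet> ?\<xi>)"
          have nn: "0 \<le> A (x, y) ?\<xi> \<bullet> ?\<xi>" by (rule elliptic_form_nonneg[OF elim pos(1)])
          have Ae: "A (x, y) (0, d) = e" by (simp add: block_field_def e_def)
          have qe: "A (x, y) (0, d) \<bullet> (0, d) = q" by (simp add: block_field_inner q_def)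
          have CS: "\<bar>e \<bullet> ?\<xi>\<bar> \<le> ?a * sqrt q"
            using elliptic_form_Cauchy_Schwarz_sqrt[OF elim pos(1), of "(0, d)" ?\<xi>] unfolding qe unfolding Ae .
          have "gradient P (x, y) = (p * ?S powr (p / 2 - 1) * u (x, y)) *\<^sub>R ?\<xi>"
          proof (rule gradient_eqI)
            have D: "((\<lambda>t. (t * t + \<delta> ^ 2) powr (p / 2)) has_real_derivative p * ?S powr (p / 2 - 1) * u (x, y)) (at (u (x, y)))"
              by (rule DERIV_cong[OF DERIV_chain2[OF has_real_derivative_powr[OF S0] DERIV_add[OF DERIV_mult[OF DERIV_ident DERIV_ident] DERIV_const]]]) simp
            show "(P has_derivative (\<lambda>h. (p * ?S powr (p / 2 - 1) * u (x, y)) *\<^sub>R ?\<xi> \<bullet> h)) (at (x, y))"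
              using partial_chain_real[OF smooth_differentiable[OF K(1)] D]
              unfolding frechet_gradient[OF smooth_differentiable[OF K(1)]] P_def by simp
          qed
          then have "gradient P (x, y) \<bullet> e = p * ?S powr (p / 2 - 1) * (u (x, y) * (e \<bullet> ?\<xi>))"
            by (simp add: inner_commute)
          also have "\<dots> \<le> p * ?S powr (p / 2 - 1) * (sqrt ?S * (?a * sqrt q))"
          proof (rule mult_left_mono)
            have "\<bar>u (x, y)\<bar> \<le> sqrt ?S" by (rule real_le_rsqrt) (simp add: power2_eq_square)
            then have "\<bar>u (x, y)\<bar> * \<bar>e \<bullet> ?\<xi>\<bar> \<le> sqrt ?S * (?a * sqrt q)"
              using CS by (intro mult_mono) auto
            then show "u (x, y) * (e \<bullet> ?\<xi>) \<le> sqrt ?S * (?a * sqrt q)"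
              unfolding abs_mult[symmetric] by linarith
          qed (use p0 in simp)
          finally have D: "gradient P (x, y) \<bullet> e \<le> p * ?S powr (p / 2 - 1) * (sqrt ?S * (?a * sqrt q))" .
          have "\<alpha> * (gradient P (x, y) \<bullet> e) - \<beta> * P (x, y) \<le> ?a powr p"
            using Picone_pointwise[OF p S0 V q _ D] nn unfolding \<alpha>_def \<beta>_def P_def by simp
          also have "\<dots> = \<bar>A (x, y) ?\<xi> \<bullet> ?\<xi>\<bar> powr (p / 2)"
            using nn by (simp add: powr_half)
          finally show ?case by (auto simp: g_def indicator_def)
        qed
        then show ?thesis
          using gi int_g q by (intro exI[of _ g]) (simp add: q_def d_def)
      qed
    qed
  qed
qed

text \<open>
  The section \<open>U\<close> has at most the energy of \<open>u\<close>, and at least its mass up to the shift \<open>c0\<close>, which is small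
  in \<open>L\<^sup>p(\<omega>\<^sub>2)\<close> since \<open>\<omega>\<^sub>2\<close> is bounded. With \<open>s = \<delta>\<^sup>p\<close> the error is linear in \<open>s\<close>; first \<open>s\<close> and then the
  convexity parameter \<open>t\<close> tend to zero.
\<close>

lemma mu_le_on_strip:
  assumes u: "u \<in> test_functions (UNIV \<times> \<omega>2)"
  shows "\<mu> * Lp_mass p u \<le> energy p A u"
proof -
  obtain K where K: "smooth u" "compact K" "K \<subseteq> UNIV \<times> \<omega>2" "\<forall>z. z \<notin> K \<longrightarrow> u z = 0"
    using test_function_support[OF u] by blast
  have "bounded (insert 0 (fst ` K))"
    using compact_imp_bounded[OF compact_continuous_image[OF continuous_on_fst[OF continuous_on_id] K(2)]] by simp
  then obtain b where box: "insert 0 (fst ` K) \<subseteq> box (- b) b"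
    using bounded_subset_box_symmetric by blast
  define vol where "vol = measure lborel (cbox (- b) b)"
  define m where "m = measure lborel \<omega>2"
  have \<omega>2_fin: "emeasure lborel \<omega>2 < \<infinity>" using omega2(2) by (rule emeasure_bounded_finite)
  have vol0: "0 \<le> vol" by (simp add: vol_def)
  have main: "\<mu> * Lp_mass p u \<le> (1 - t) powr (1 - p) * energy p A u + s * (\<mu> * t powr (1 - p) * vol * m)"
    if t: "0 < t" "t < 1" and s: "0 < s" for t s
  proof -
    define \<delta> where "\<delta> = s powr (1 / p)"
    have \<delta>: "0 < \<delta>" "\<delta> powr p = s" using s p0 by (simp_all add: \<delta>_def powr_powr)
    define c0 where "c0 = (\<delta> powr p * measure lborel (cbox (- b) b)) powr (1 / p)"
    define U where "U = (\<lambda>y. integral (cbox (- b) b) (\<lambda>x. (u (x, y) ^ 2 + \<delta> ^ 2) powr (p / 2)) powr (1 / p) + - c0)"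
    note facts = energy_strip_ge_section[OF u \<delta>(1) K box, folded c0_def, folded U_def]
    have U_ge: "0 \<le> U y" for y unfolding U_def by (rule facts(3))
    have U_le: "(\<integral>x. \<bar>u (x, y)\<bar> powr p \<partial>lborel) \<le> (U y + c0) powr p" for y
      unfolding U_def by (rule facts(4))
    let ?a = "(1 - t) powr (1 - p)" and ?b = "t powr (1 - p)"
    have c0: "0 \<le> c0" "c0 powr p = s * vol"
      using \<delta> s p0 by (simp_all add: c0_def powr_powr vol_def)
    obtain KU where KU: "smooth U" "compact KU" "KU \<subseteq> \<omega>2" "\<And>x. x \<notin> KU \<Longrightarrow> U x = 0"
      using test_function_support[OF facts(1)] by blast
    have iU: "integrable lborel (\<lambda>y. \<bar>U y\<bar> powr p)"
      using integrable_powr_compact_support[OF smooth_continuous[OF KU(1)] KU(2,4) p0] by simp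
    have i\<omega>: "integrable lborel (\<lambda>y. indicator \<omega>2 y :: real)"
      using \<omega>2_fin omega2(1) by (intro integrable_real_indicator) auto
    have iu: "integrable lborel (\<lambda>z. \<bar>u z\<bar> powr p)"
      using integrable_powr_compact_support[OF smooth_continuous[OF K(1)] K(2) K(4)[rule_format] p0] by simp
    let ?h = "\<lambda>y. ?a * \<bar>U y\<bar> powr p + ?b * (s * vol) * indicator \<omega>2 y"
    have ih: "integrable lborel ?h" using iU i\<omega> by simp
    have "Lp_mass p u = (\<integral>z. \<bar>u z\<bar> powr p \<partial>lebesgue)"
      unfolding Lp_mass_def using iu by (simp add: integral_completion)
    also have "\<dots> \<le> (\<integral>y. ?h y \<partial>lebesgue)"
    proof (rule integral_ge_by_slices)
      show "integrable lebesgue (\<lambda>z. \<bar>u z\<bar> powr p)" using iu by (simp add: integrable_completion)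
      show "integrable lebesgue ?h" using ih by (subst integrable_completion) auto
      show "AE y in lborel. \<exists>g. integrable lborel g \<and> integral\<^sup>L lborel g \<le> ?h y \<and> (AE x in lborel. \<bar>u (x, y)\<bar> powr p \<le> g x)"
      proof (rule AE_I2)
        fix y
        have "(\<integral>x. \<bar>u (x, y)\<bar> powr p \<partial>lborel) \<le> ?h y"
        proof (cases "y \<in> \<omega>2")
          case True
          have "(\<integral>x. \<bar>u (x, y)\<bar> powr p \<partial>lborel) \<le> (U y + c0) powr p" by (rule U_le)
          also have "\<dots> \<le> ?a * U y powr p + ?b * c0 powr p"
            by (rule powr_add_le) (use t p c0 U_ge in auto)
          finally show ?thesis using True U_ge[of y] by (simp add: c0)
        next
          case False
          then have "(x, y) \<notin> K" for x using K(3) by blast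
          then have "u (x, y) = 0" for x using K(4) by blast
          then show ?thesis using False p0 by simp
        qed
        then show "\<exists>g. integrable lborel g \<and> integral\<^sup>L lborel g \<le> ?h y \<and> (AE x in lborel. \<bar>u (x, y)\<bar> powr p \<le> g x)"
          using facts(5)[of y] by (intro exI[of _ "\<lambda>x. \<bar>u (x, y)\<bar> powr p"]) simp
      qed
    qed
    also have "\<dots> = (\<integral>y. ?h y \<partial>lborel)"
      using ih by (intro integral_completion) auto
    also have "\<dots> = ?a * Lp_mass p U + ?b * (s * vol) * m"
      using iU i\<omega> omega2(1) by (simp add: Lp_mass_def m_def)
    finally have "\<mu> * Lp_mass p u \<le> \<mu> * (?a * Lp_mass p U + ?b * (s * vol) * m)"
      using mu_nonneg by (rule mult_left_mono)
    also have "\<dots> = ?a * (\<mu> * Lp_mass p U) + s * (\<mu> * ?b * vol * m)" by (simp add: algebra_simps)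
    also have "?a * (\<mu> * Lp_mass p U) \<le> ?a * energy p A u"
      using order_trans[OF mu_le_test[OF facts(1)] facts(2)] by (intro mult_left_mono) auto
    finally show ?thesis by simp
  qed
  have main': "\<mu> * Lp_mass p u \<le> (1 - t) powr (1 - p) * energy p A u" if t: "0 < t" "t < 1" for t
  proof (rule le_limit_at_right_0)
    show "((\<lambda>s. (1 - t) powr (1 - p) * energy p A u + s * (\<mu> * t powr (1 - p) * vol * m)) \<longlongrightarrow> (1 - t) powr (1 - p) * energy p A u) (at_right 0)"
      by (auto intro!: tendsto_eq_intros)
  qed (use main t in blast)
  show ?thesis
  proof (rule le_limit_at_right_0)
    show "((\<lambda>t. (1 - t) powr (1 - p) * energy p A u) \<longlongrightarrow> energy p A u) (at_right 0)"
      by (auto intro!: tendsto_eq_intros)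
  qed (use main' in blast)
qed

lemma elliptic_A_subset:
  assumes "open \<Omega>" "\<Omega> \<subseteq> UNIV \<times> \<omega>2"
  shows "AE x in lebesgue_on \<Omega>. elliptic_form lam M (A x)"
  using elliptic_A assms
  by (subst (asm) AE_restrict_space_iff, simp add: borel_open open_strip sets_completionI_sets)
    (subst AE_restrict_space_iff, auto elim: AE_mp)

text \<open>
  Test functions on a subset of the strip are test functions on the strip.
\<close>

lemma mu_le_rayleigh_inf:
  assumes "open \<Omega>" "\<Omega> \<noteq> {}" "\<Omega> \<subseteq> UNIV \<times> \<omega>2"
  shows "\<mu> \<le> rayleigh_inf p \<Omega> A"
proof (rule rayleigh_inf_ge_test[OF assms(1,2) p1 pos elliptic_A_subset[OF assms(1,3)] measurable_form_A[OF assms(3)]])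
  fix \<phi> assume "\<phi> \<in> test_functions \<Omega>"
  then have "\<phi> \<in> test_functions (UNIV \<times> \<omega>2)" using assms(3) unfolding test_functions_def by blast
  then show "\<mu> * Lp_mass p \<phi> \<le> energy p A \<phi>" by (rule mu_le_on_strip)
qed

end

section \<open>The upper bound by product test functions\<close>

text \<open>
  Whichever of \<open>x\<close> and \<open>w\<^sup>2\<close> is larger, its power \<open>p / 2\<close> dominates the product.
\<close>

lemma powr_mixed_le:
  fixes x w p :: real
  assumes "0 \<le> x" "2 \<le> p"
  shows "x powr (p / 2 - 1) * w\<^sup>2 \<le> x powr (p / 2) + \<bar>w\<bar> powr p"
proof -
  have e: "s powr (p / 2 - 1) * s = s powr (p / 2)" if "0 \<le> s" for s :: real
    using that by (cases "s = 0") (simp_all add: powr_diff)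
  show ?thesis
  proof (cases "w\<^sup>2 \<le> x")
    case True
    have "x powr (p / 2 - 1) * w\<^sup>2 \<le> x powr (p / 2 - 1) * x" using True by (intro mult_left_mono) auto
    also have "\<dots> = x powr (p / 2)" using assms by (simp add: e)
    finally show ?thesis using powr_ge_zero[of "\<bar>w\<bar>" p] by linarith
  next
    case False
    have "x powr (p / 2 - 1) * w\<^sup>2 \<le> (w\<^sup>2) powr (p / 2 - 1) * w\<^sup>2"
      using False assms by (intro mult_right_mono powr_mono2) auto
    also have "\<dots> = \<bar>w\<bar> powr p" by (simp add: e powr_half)
    finally show ?thesis using powr_ge_zero[of x "p / 2"] by linarith
  qed
qed

context block_coefficients
begin

lemma open_cylinder:
  assumes "open \<omega>1" "\<omega>1 \<noteq> {}" "0 < l"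
  shows "open (cylinder \<omega>1 \<omega>2 l)" "cylinder \<omega>1 \<omega>2 l \<noteq> {}" "cylinder \<omega>1 \<omega>2 l \<subseteq> UNIV \<times> \<omega>2"
  using assms omega2 unfolding cylinder_def by (auto intro!: open_Times open_scaling)

text \<open>
  The gradient of the product \<open>v(X\<^sub>1 / l) W(X\<^sub>2)\<close> is \<open>(0, v \<nabla>W)\<close> plus the small vector \<open>(W \<nabla>v / l, 0)\<close>.
  In the second-order expansion of the energy density the mixed term is
  \<open>v\<^bsup>p-1\<^esup> \<nabla>v\<close> times a function of \<open>X\<^sub>2\<close> only, as \<open>A12\<close> does not depend on \<open>X\<^sub>1\<close>; it is the
  derivative of \<open>v\<^sup>p / p\<close> and integrates to zero. The block \<open>A11\<close>, which does depend on \<open>X\<^sub>1\<close>, occurs only in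
  the remainder, where its upper bound suffices. All constants depend on \<open>W\<close> only through its energy and
  its mass.
\<close>

lemma energy_product_le:
  fixes v :: "real^'m \<Rightarrow> real"
  assumes v: "v \<in> test_functions \<omega>1" "\<And>x. 0 \<le> v x" "\<And>x. v x \<le> 1"
    and W: "W \<in> test_functions \<omega>2" and l: "0 < l"
    and C: "0 \<le> C" "\<And>a b c :: real. 0 \<le> a \<Longrightarrow> 0 \<le> c \<Longrightarrow> b\<^sup>2 \<le> a * c \<Longrightarrow>
      (a + 2 * b + c) powr (p / 2) \<le> a powr (p / 2) + 2 * (p / 2) * a powr (p / 2 - 1) * b + C * (a powr (p / 2 - 1) * c + c powr (p / 2))"
  defines "u \<equiv> (\<lambda>z. v ((1 / l) *\<^sub>R fst z) * W (snd z))"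
  defines "K0 \<equiv> Lp_mass p v"
  defines "K1 \<equiv> (\<integral>x. (norm (gradient v x))\<^sup>2 \<partial>lborel)"
  defines "K2 \<equiv> (\<integral>x. norm (gradient v x) powr p \<partial>lborel)"
  shows "u \<in> test_functions (cylinder \<omega>1 \<omega>2 l)"
    "l ^ CARD('m) * K0 * Lp_mass p W \<le> Lp_mass p u"
    "energy p A u \<le> l ^ CARD('m) * (K0 * energy p B W + C * (M * K1 / l\<^sup>2 * (energy p B W + Lp_mass p W)
       + M powr (p / 2) * K2 / l powr p * Lp_mass p W))"
proof -
  obtain Kv where Kv: "smooth v" "compact Kv" "Kv \<subseteq> \<omega>1" "\<forall>x. x \<notin> Kv \<longrightarrow> v x = 0" "\<forall>x. x \<notin> Kv \<longrightarrow> gradient v x = 0"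
    using test_function_support[OF v(1)] by blast
  obtain KW where KW: "smooth W" "compact KW" "KW \<subseteq> \<omega>2" "\<forall>x. x \<notin> KW \<longrightarrow> W x = 0" "\<forall>x. x \<notin> KW \<longrightarrow> gradient W x = 0"
    using test_function_support[OF W] by blast
  let ?Kl = "(\<lambda>X. l *\<^sub>R X) ` Kv"
  have Kl: "compact ?Kl" by (intro compact_continuous_image continuous_intros Kv)
  have notKl: "(1 / l) *\<^sub>R x \<notin> Kv" if "x \<notin> ?Kl" for x
  proof
    assume "(1 / l) *\<^sub>R x \<in> Kv"
    then have "l *\<^sub>R ((1 / l) *\<^sub>R x) \<in> ?Kl" by (rule imageI)
    then show False using that l by simp
  qed
  have su: "smooth u"
    unfolding u_def
    by (intro smooth_mult smooth_compose_linear[OF Kv(1)] smooth_compose_linear[OF KW(1)]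
        bounded_linear_snd bounded_linear_scaleR_right[THEN bounded_linear_compose] bounded_linear_fst)
  show ut: "u \<in> test_functions (cylinder \<omega>1 \<omega>2 l)"
  proof (rule test_functionsI[OF su compact_Times[OF Kl KW(2)]])
    show "?Kl \<times> KW \<subseteq> cylinder \<omega>1 \<omega>2 l" unfolding cylinder_def using Kv(3) KW(3) by (intro Sigma_mono image_mono) auto
    fix z assume "z \<notin> ?Kl \<times> KW"
    then have "fst z \<notin> ?Kl \<or> snd z \<notin> KW" by (simp add: mem_Times_iff)
    then have "v ((1 / l) *\<^sub>R fst z) = 0 \<or> W (snd z) = 0" using notKl Kv(4) KW(4) by blast
    then show "u z = 0" unfolding u_def by auto
  qed
  have ut': "u \<in> test_functions (UNIV \<times> \<omega>2)"
    using ut unfolding test_functions_def cylinder_def by auto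
  have gu: "gradient u (x, y) = (((W y / l) *\<^sub>R gradient v ((1 / l) *\<^sub>R x)), v ((1 / l) *\<^sub>R x) *\<^sub>R gradient W y)" for x y
  proof (rule gradient_eqI)
    have 1: "((\<lambda>z. (1 / l) *\<^sub>R fst z) has_derivative (\<lambda>k. (1 / l) *\<^sub>R fst k)) (at (x, y))"
      by (auto intro!: derivative_eq_intros)
    have 1: "((\<lambda>z. v ((1 / l) *\<^sub>R fst z)) has_derivative (\<lambda>h. gradient v ((1 / l) *\<^sub>R x) \<bullet> ((1 / l) *\<^sub>R fst h))) (at (x, y))"
      using has_derivative_compose[OF 1, of v "\<lambda>k. gradient v ((1 / l) *\<^sub>R x) \<bullet> k"]
        smooth_has_derivative[OF Kv(1)] by simp
    have 2: "((\<lambda>z. W (snd z)) has_derivative (\<lambda>h. gradient W y \<bullet> snd h)) (at (x, y))"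
      by (rule has_derivative_compose[of snd snd "(x, y)" UNIV W, simplified, OF _ smooth_has_derivative[OF KW(1)]])
        (auto intro!: derivative_eq_intros)
    show "(u has_derivative (\<lambda>h. ((W y / l) *\<^sub>R gradient v ((1 / l) *\<^sub>R x), v ((1 / l) *\<^sub>R x) *\<^sub>R gradient W y) \<bullet> h)) (at (x, y))"
      unfolding u_def by (rule has_derivative_eq_rhs[OF has_derivative_mult[OF 1 2]])
        (auto simp: inner_prod_def algebra_simps)
  qed
  note cv = smooth_continuous[OF Kv(1), of UNIV] smooth_continuous_gradient[OF Kv(1), of UNIV]
  have scaled: "integrable lborel (\<lambda>x. f ((1 / l) *\<^sub>R x))"
    "(\<integral>x. f ((1 / l) *\<^sub>R x) \<partial>lborel) = l ^ CARD('m) * (\<integral>x. f x \<partial>lborel)"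
    if f: "continuous_on UNIV f" "\<And>x. x \<notin> Kv \<Longrightarrow> f x = 0" for f :: "real^'m \<Rightarrow> real"
  proof -
    have "continuous_on UNIV (\<lambda>x. f ((1 / l) *\<^sub>R x))"
      by (intro continuous_on_compose2[OF f(1)] continuous_intros) auto
    then show "integrable lborel (\<lambda>x. f ((1 / l) *\<^sub>R x))"
      by (rule integrable_continuous_compact_support[OF _ Kl]) (use f(2) notKl in blast)
    show "(\<integral>x. f ((1 / l) *\<^sub>R x) \<partial>lborel) = l ^ CARD('m) * (\<integral>x. f x \<partial>lborel)"
      using lborel_integral_scaleR[OF l borel_measurable_continuous_onI[OF f(1)]] by simp
  qed
  have cvp: "continuous_on UNIV (\<lambda>x. \<bar>v x\<bar> powr p)" "continuous_on UNIV (\<lambda>x. norm (gradient v x) powr p)"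
    using continuous_on_norm_powr[OF cv(1) p0] continuous_on_norm_powr[OF cv(2) p0] by simp_all
  have zv: "\<bar>v x\<bar> powr p = 0" "norm (gradient v x) powr p = 0" "(norm (gradient v x))\<^sup>2 = 0" if "x \<notin> Kv" for x
    using Kv(4,5) that by simp_all
  have iW: "integrable lborel (\<lambda>y. \<bar>W y\<bar> powr p)"
    using integrable_powr_compact_support[OF smooth_continuous[OF KW(1)] KW(2) KW(4)[rule_format] p0] by simp
  have iWl: "integrable lebesgue (\<lambda>y. c * \<bar>W y\<bar> powr p)" "integral\<^sup>L lebesgue (\<lambda>y. c * \<bar>W y\<bar> powr p) = c * Lp_mass p W" for c
  proof -
    have i: "integrable lborel (\<lambda>y. c * \<bar>W y\<bar> powr p)" using iW by simp
    show "integrable lebesgue (\<lambda>y. c * \<bar>W y\<bar> powr p)"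
      using i integrable_completion[OF borel_measurable_integrable[OF i]] by blast
    show "integral\<^sup>L lebesgue (\<lambda>y. c * \<bar>W y\<bar> powr p) = c * Lp_mass p W"
      using integral_completion[OF borel_measurable_integrable[OF i]] by (simp add: Lp_mass_def)
  qed
  have m: "0 < l ^ CARD('m)" using l by simp
  show "l ^ CARD('m) * K0 * Lp_mass p W \<le> Lp_mass p u"
  proof -
    have iu: "integrable lborel (\<lambda>z. \<bar>u z\<bar> powr p)"
    proof -
      obtain K where K: "compact K" "\<forall>z. z \<notin> K \<longrightarrow> u z = 0" using test_function_support[OF ut] by blast
      show ?thesis
        using integrable_powr_compact_support[OF smooth_continuous[OF su] K(1) K(2)[rule_format] p0] by simp
    qed
    have "l ^ CARD('m) * K0 * Lp_mass p W = integral\<^sup>L lebesgue (\<lambda>y. l ^ CARD('m) * K0 * \<bar>W y\<bar> powr p)"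
      by (rule iWl(2)[symmetric])
    also have "\<dots> \<le> (\<integral>z. \<bar>u z\<bar> powr p \<partial>lebesgue)"
    proof (rule integral_le_by_slices[OF _ iWl(1)])
      show "integrable lebesgue (\<lambda>z. \<bar>u z\<bar> powr p)" using iu by (simp add: integrable_completion)
      show "AE y in lborel. \<exists>g. integrable lborel g \<and> l ^ CARD('m) * K0 * \<bar>W y\<bar> powr p \<le> integral\<^sup>L lborel g \<and> (AE x in lborel. g x \<le> \<bar>u (x, y)\<bar> powr p)"
      proof (rule AE_I2)
        fix y
        let ?g = "\<lambda>x. \<bar>v ((1 / l) *\<^sub>R x)\<bar> powr p * \<bar>W y\<bar> powr p"
        have "integrable lborel ?g" using scaled(1)[OF cvp(1) zv(1)] by simp
        moreover have "integral\<^sup>L lborel ?g = l ^ CARD('m) * K0 * \<bar>W y\<bar> powr p"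
          using scaled[OF cvp(1) zv(1)] by (simp add: K0_def Lp_mass_def)
        moreover have "?g x = \<bar>u (x, y)\<bar> powr p" for x
          by (simp add: u_def abs_mult powr_mult)
        ultimately show "\<exists>g. integrable lborel g \<and> l ^ CARD('m) * K0 * \<bar>W y\<bar> powr p \<le> integral\<^sup>L lborel g \<and> (AE x in lborel. g x \<le> \<bar>u (x, y)\<bar> powr p)"
          by (intro exI[of _ ?g]) simp
      qed
    qed
    also have "\<dots> = Lp_mass p u" unfolding Lp_mass_def using iu by (simp add: integral_completion)
    finally show ?thesis .
  qed
  define \<rho> where "\<rho> = (\<lambda>y. \<bar>B y (gradient W y) \<bullet> gradient W y\<bar> powr (p / 2))"
  define h where "h = (\<lambda>y. l ^ CARD('m) * (K0 + C * (M * K1 / l\<^sup>2)) * \<rho> y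
      + l ^ CARD('m) * C * (M * K1 / l\<^sup>2 + M powr (p / 2) * K2 / l powr p) * \<bar>W y\<bar> powr p)"
  have nn: "0 \<le> K0" "0 \<le> K1" "0 \<le> K2" by (simp_all add: K0_def K1_def K2_def Lp_mass_nonneg)
  have i\<rho>: "integrable lebesgue \<rho>" unfolding \<rho>_def by (rule integrable_energy_B[OF W])
  have "energy p A u \<le> integral\<^sup>L lebesgue h"
    unfolding energy_def
  proof (rule integral_ge_by_slices[OF integrable_energy_A[OF ut']])
    show "integrable lebesgue h" unfolding h_def using i\<rho> iWl(1) by simp
    show "AE y in lborel. \<exists>g. integrable lborel g \<and> integral\<^sup>L lborel g \<le> h y \<and>
        (AE x in lborel. \<bar>A (x, y) (gradient u (x, y)) \<bullet> gradient u (x, y)\<bar> powr (p / 2) \<le> g x)"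
      using elliptic_A_sections elliptic_B_lborel
    proof eventually_elim
      case (elim y)
      have h0: "0 \<le> h y" unfolding h_def \<rho>_def using nn C(1) pos l by simp
      show ?case
      proof (cases "y \<in> \<omega>2")
        case False
        then have "y \<notin> KW" using KW(3) by blast
        then have "gradient u (x, y) = 0" for x using KW(4,5) by (simp add: gu zero_prod_def)
        then show ?thesis using h0 by (intro exI[of _ "\<lambda>x. 0"]) simp
      next
        case True
        then have ell_y: "AE x in lborel. elliptic_form lam M (A (x, y))" and gB: "elliptic_form lam M (B y)"
          using elim by auto
        define d where "d = gradient W y"
        define w where "w = W y"
        define q where "q = B y d \<bullet> d"
        define e where "e = A12 y *v d"
        have q: "0 \<le> q" unfolding q_def by (rule elliptic_form_nonneg[OF gB pos(1)])
        \<comment> \<open>The expansion on the slice in the rescaled variable \<open>X = X\<^sub>1 / l\<close>. The factor \<open>v\<^bsup>p-2\<^esup>\<close> of the third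
          term is bounded by one.\<close>
        define g0 where "g0 = (\<lambda>X. q powr (p / 2) * \<bar>v X\<bar> powr p
            + p * q powr (p / 2 - 1) * (w / l) * (v X powr (p - 1) * (gradient v X \<bullet> e))
            + C * (q powr (p / 2 - 1) * (M * w\<^sup>2 / l\<^sup>2) * (norm (gradient v X))\<^sup>2
              + M powr (p / 2) * \<bar>w\<bar> powr p / l powr p * norm (gradient v X) powr p))"
        have c2: "continuous_on UNIV (\<lambda>X. v X powr (p - 1) * (gradient v X \<bullet> e))"
          using p v(2) by (intro continuous_intros continuous_on_powr' cv) auto
        have c3: "continuous_on UNIV (\<lambda>X. (norm (gradient v X))\<^sup>2)" by (intro continuous_intros cv)
        have cg0: "continuous_on UNIV g0" unfolding g0_def
          by (intro continuous_on_add continuous_on_mult continuous_on_const cvp c2 c3)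
        have zg0: "g0 X = 0" if "X \<notin> Kv" for X
          using Kv(4,5) that p by (simp add: g0_def)
        have I2: "(\<integral>X. v X powr (p - 1) * (gradient v X \<bullet> e) \<partial>lborel) = 0"
        proof -
          have D: "((\<lambda>X. \<bar>v X\<bar> powr p) has_derivative (\<lambda>k. p * v X powr (p - 1) * (gradient v X \<bullet> k))) (at X)" for X
            using partial_chain_real[OF smooth_differentiable[OF Kv(1)] DERIV_abs_powr[OF _ v(2)], of p X] p
            unfolding frechet_gradient[OF smooth_differentiable[OF Kv(1)]] by simp
          have "continuous_on UNIV (\<lambda>X. p * v X powr (p - 1) * (gradient v X \<bullet> e))"
            using continuous_on_mult[OF continuous_on_const[of _ p] c2] by (simp add: mult.assoc)
          then have "(\<integral>X. p * v X powr (p - 1) * (gradient v X \<bullet> e) \<partial>lborel) = 0"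
            by (rule integral_directional_derivative_eq_0[OF D _ Kv(2) zv(1)])
          then show ?thesis using p0 by (simp add: mult.assoc)
        qed
        have ii: "integrable lborel (\<lambda>X. \<bar>v X\<bar> powr p)" "integrable lborel (\<lambda>X. v X powr (p - 1) * (gradient v X \<bullet> e))"
            "integrable lborel (\<lambda>X. (norm (gradient v X))\<^sup>2)" "integrable lborel (\<lambda>X. norm (gradient v X) powr p)"
          by (rule integrable_continuous_compact_support[OF cvp(1) Kv(2) zv(1)], assumption)
            (rule integrable_continuous_compact_support[OF c2 Kv(2)], use Kv(5) in simp,
             rule integrable_continuous_compact_support[OF c3 Kv(2) zv(3)], assumption,
             rule integrable_continuous_compact_support[OF cvp(2) Kv(2) zv(2)], assumption)
        have "(\<integral>X. g0 X \<partial>lborel) = q powr (p / 2) * K0 + C * (q powr (p / 2 - 1) * (M * w\<^sup>2 / l\<^sup>2) * K1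
            + M powr (p / 2) * \<bar>w\<bar> powr p / l powr p * K2)"
          unfolding g0_def K0_def K1_def K2_def Lp_mass_def using ii I2 by simp
        also have "\<dots> = q powr (p / 2) * K0 + C * (M * K1 / l\<^sup>2 * (q powr (p / 2 - 1) * w\<^sup>2)
            + M powr (p / 2) * K2 / l powr p * \<bar>w\<bar> powr p)"
          by (simp add: mult_ac)
        also have "\<dots> \<le> q powr (p / 2) * K0 + C * (M * K1 / l\<^sup>2 * (q powr (p / 2) + \<bar>w\<bar> powr p)
            + M powr (p / 2) * K2 / l powr p * \<bar>w\<bar> powr p)"
          using powr_mixed_le[OF q p, of w] nn C(1) pos l
          by (intro add_left_mono mult_left_mono add_right_mono) auto
        finally have "l ^ CARD('m) * (\<integral>X. g0 X \<partial>lborel) \<le> l ^ CARD('m) * (q powr (p / 2) * K0 + C * (M * K1 / l\<^sup>2 * (q powr (p / 2) + \<bar>w\<bar> powr p)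
            + M powr (p / 2) * K2 / l powr p * \<bar>w\<bar> powr p))"
          using m by (intro mult_left_mono) auto
        also have "\<dots> = h y"
          using q by (simp add: h_def \<rho>_def q_def d_def w_def distrib_left distrib_right mult_ac)
        finally have "l ^ CARD('m) * (\<integral>X. g0 X \<partial>lborel) \<le> h y" .
        moreover have "(\<integral>x. g0 ((1 / l) *\<^sub>R x) \<partial>lborel) = l ^ CARD('m) * (\<integral>X. g0 X \<partial>lborel)"
          by (rule scaled(2)[OF cg0 zg0])
        ultimately have "(\<integral>x. g0 ((1 / l) *\<^sub>R x) \<partial>lborel) \<le> h y" by simp
        moreover have "integrable lborel (\<lambda>x. g0 ((1 / l) *\<^sub>R x))" by (rule scaled(1)[OF cg0 zg0])
        moreover have "AE x in lborel. \<bar>A (x, y) (gradient u (x, y)) \<bullet> gradient u (x, y)\<bar> powr (p / 2) \<le> g0 ((1 / l) *\<^sub>R x)"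
          using ell_y
        proof eventually_elim
          case (elim x)
          define X where "X = (1 / l) *\<^sub>R x"
          define t where "t = v X"
          define k where "k = gradient v X"
          define \<xi> where "\<xi> = ((w / l) *\<^sub>R k, 0 :: real^'k)"
          define \<eta> where "\<eta> = (0 :: real^'m, t *\<^sub>R d)"
          define a where "a = A (x, y) \<eta> \<bullet> \<eta>"
          define b where "b = A (x, y) \<eta> \<bullet> \<xi>"
          define c where "c = A (x, y) \<xi> \<bullet> \<xi>"
          have t: "0 \<le> t" "t \<le> 1" using v by (simp_all add: t_def)
          have gsum: "gradient u (x, y) = \<xi> + \<eta>"
            by (simp add: gu \<xi>_def \<eta>_def X_def t_def k_def w_def d_def)
          have a: "a = t\<^sup>2 * q" "0 \<le> a"
            using elliptic_form_nonneg[OF elim pos(1), of \<eta>]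
            by (simp_all add: a_def \<eta>_def block_field_inner q_def matrix_vector_mult_scaleR power2_eq_square)
          have b: "b = t * (w / l) * (k \<bullet> e)"
            unfolding b_def block_field_inner
            by (simp add: \<eta>_def \<xi>_def matrix_vector_mult_scaleR e_def inner_commute)
          define n where "n = \<bar>w\<bar> / l * norm k"
          have n0: "0 \<le> n" using l by (simp add: n_def)
          have c: "0 \<le> c" "c \<le> M * n\<^sup>2"
          proof -
            show "0 \<le> c" unfolding c_def by (rule elliptic_form_nonneg[OF elim pos(1)])
            have "norm \<xi> = n" using l by (simp add: \<xi>_def n_def norm_prod_def)
            then show "c \<le> M * n\<^sup>2" using elim unfolding c_def elliptic_form_def by metis
          qed
          have "b\<^sup>2 \<le> a * c"
            using elliptic_form_Cauchy_Schwarz[OF elim pos(1), of \<eta> \<xi>] by (simp add: a_def b_def c_def mult.commute)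
          from C(2)[OF a(2) c(1) this]
          have main: "(a + 2 * b + c) powr (p / 2) \<le> a powr (p / 2) + p * (a powr (p / 2 - 1) * b) + C * (a powr (p / 2 - 1) * c + c powr (p / 2))"
            by (simp add: mult.assoc)
          have "A (x, y) (gradient u (x, y)) \<bullet> gradient u (x, y) = a + 2 * b + c"
            unfolding gsum elliptic_form_add[OF elim] a_def b_def c_def by simp
          moreover have "0 \<le> A (x, y) (gradient u (x, y)) \<bullet> gradient u (x, y)"
            by (rule elliptic_form_nonneg[OF elim pos(1)])
          ultimately have lhs: "\<bar>A (x, y) (gradient u (x, y)) \<bullet> gradient u (x, y)\<bar> powr (p / 2) = (a + 2 * b + c) powr (p / 2)"
            by simp
          have 1: "a powr (p / 2) = q powr (p / 2) * \<bar>t\<bar> powr p"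
            using t q unfolding a by (simp add: powr_mult powr_half)
          have 2: "a powr (p / 2 - 1) * b = q powr (p / 2 - 1) * (w / l) * (t powr (p - 1) * (k \<bullet> e))"
          proof (cases "t = 0")
            case True then show ?thesis by (simp add: b)
          next
            case False
            have "(t\<^sup>2) powr (p / 2 - 1) = t powr (p - 2)"
              using powr_half[of "t\<^sup>2" "p - 2"] t by (simp add: diff_divide_distrib)
            moreover have "t powr (p - 2) * t powr 1 = t powr (p - 1)" unfolding powr_add[symmetric] by simp
            then have "t powr (p - 2) * t = t powr (p - 1)" using t False by simp
            ultimately show ?thesis
              unfolding a b using t q by (simp add: powr_mult mult_ac)
          qed
          have "a \<le> q" unfolding a using t q by (simp add: mult_left_le_one_le power_le_one)
          then have "a powr (p / 2 - 1) \<le> q powr (p / 2 - 1)" using a p by (intro powr_mono2) auto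
          then have "a powr (p / 2 - 1) * c \<le> q powr (p / 2 - 1) * (M * n\<^sup>2)"
            using c by (intro mult_mono) auto
          also have "\<dots> = q powr (p / 2 - 1) * (M * w\<^sup>2 / l\<^sup>2) * (norm k)\<^sup>2"
            by (simp add: n_def power_mult_distrib power_divide)
          finally have 3: "a powr (p / 2 - 1) * c \<le> q powr (p / 2 - 1) * (M * w\<^sup>2 / l\<^sup>2) * (norm k)\<^sup>2" .
          have "c powr (p / 2) \<le> (M * n\<^sup>2) powr (p / 2)" using c p0 by (intro powr_mono2) auto
          also have "\<dots> = M powr (p / 2) * n powr p" using pos n0 by (simp add: powr_mult powr_half)
          also have "\<dots> = M powr (p / 2) * \<bar>w\<bar> powr p / l powr p * norm k powr p"
            using l by (simp add: n_def powr_mult powr_divide)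
          finally have 4: "c powr (p / 2) \<le> M powr (p / 2) * \<bar>w\<bar> powr p / l powr p * norm k powr p" .
          have "C * (a powr (p / 2 - 1) * c + c powr (p / 2)) \<le> C * (q powr (p / 2 - 1) * (M * w\<^sup>2 / l\<^sup>2) * (norm k)\<^sup>2
              + M powr (p / 2) * \<bar>w\<bar> powr p / l powr p * norm k powr p)"
            using 3 4 C(1) by (intro mult_left_mono add_mono)
          with main have "(a + 2 * b + c) powr (p / 2) \<le> g0 X"
            unfolding g0_def 1 2 t_def[symmetric] k_def[symmetric] by (simp add: mult.assoc)
          then show ?case unfolding lhs X_def .
        qed
        ultimately show ?thesis by blast
      qed
    qed
  qed
  also have "integral\<^sup>L lebesgue h = l ^ CARD('m) * (K0 + C * (M * K1 / l\<^sup>2)) * energy p B W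
      + l ^ CARD('m) * C * (M * K1 / l\<^sup>2 + M powr (p / 2) * K2 / l powr p) * Lp_mass p W"
    unfolding h_def using i\<rho> iWl(1) by (subst Bochner_Integration.integral_add) (simp_all add: iWl(2)[of 1, simplified] energy_def \<rho>_def)
  also have "\<dots> = l ^ CARD('m) * (K0 * energy p B W + C * (M * K1 / l\<^sup>2 * (energy p B W + Lp_mass p W)
       + M powr (p / 2) * K2 / l powr p * Lp_mass p W))"
    by (simp add: distrib_left distrib_right mult_ac)
  finally show "energy p A u \<le> l ^ CARD('m) * (K0 * energy p B W + C * (M * K1 / l\<^sup>2 * (energy p B W + Lp_mass p W)
       + M powr (p / 2) * K2 / l powr p * Lp_mass p W))" .
qed

text \<open>
  The product estimate with \<open>W\<close> nearly optimal for the cross-section, first for an error \<open>\<epsilon>\<close> in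
  its quotient and then in the limit. As the constants involve only the energy and the mass of \<open>W\<close>, they stay
  bounded along a minimising sequence, and the rate in \<open>l\<close> survives the limit.
\<close>

lemma rayleigh_inf_cylinder_le:
  assumes \<omega>1: "open \<omega>1" "\<omega>1 \<noteq> {}"
  obtains D where "0 \<le> D" "\<And>l. 0 < l \<Longrightarrow> rayleigh_inf p (cylinder \<omega>1 \<omega>2 l) A \<le> \<mu> + D * (1 / l\<^sup>2 + 1 / l powr p)"
proof -
  obtain v x0 where v: "v \<in> test_functions \<omega>1" "\<And>x. 0 \<le> v x" "\<And>x. v x \<le> 1" "v x0 > 0"
    by (rule bump_exists[OF \<omega>1]) blast
  have "1 \<le> p / 2" using p by simp
  then obtain C where C: "0 \<le> C" "\<And>a b c :: real. 0 \<le> a \<Longrightarrow> 0 \<le> c \<Longrightarrow> b\<^sup>2 \<le> a * c \<Longrightarrow>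
      (a + 2 * b + c) powr (p / 2) \<le> a powr (p / 2) + 2 * (p / 2) * a powr (p / 2 - 1) * b + C * (a powr (p / 2 - 1) * c + c powr (p / 2))"
    by (rule powr_quadratic_expansion) blast
  define K0 where "K0 = Lp_mass p v"
  define K1 where "K1 = (\<integral>x. (norm (gradient v x))\<^sup>2 \<partial>lborel)"
  define K2 where "K2 = (\<integral>x. norm (gradient v x) powr p \<partial>lborel)"
  obtain Kv where Kv: "smooth v" "compact Kv" "\<forall>x. x \<notin> Kv \<longrightarrow> v x = 0"
    using test_function_support[OF v(1)] by blast
  have K0: "0 < K0" unfolding K0_def Lp_mass_def
  proof (rule integral_pos_continuous[of "\<lambda>x. \<bar>v x\<bar> powr p" x0])
    show "continuous_on UNIV (\<lambda>x. \<bar>v x\<bar> powr p)"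
      using continuous_on_norm_powr[OF smooth_continuous[OF Kv(1)] p0] by simp
    show "integrable lborel (\<lambda>x. \<bar>v x\<bar> powr p)"
      using integrable_powr_compact_support[OF smooth_continuous[OF Kv(1)] Kv(2) Kv(3)[rule_format] p0] by simp
  qed (use v(4) in auto)
  have nn: "0 \<le> K1" "0 \<le> K2" by (simp_all add: K1_def K2_def)
  define D where "D = C * (M * K1 * (\<mu> + 2) + M powr (p / 2) * K2) / K0"
  have D1: "C * (M * K1 * (\<mu> + 2)) / K0 \<le> D" "C * (M powr (p / 2) * K2) / K0 \<le> D"
    unfolding D_def using C(1) nn pos K0 mu_nonneg by (auto intro!: divide_right_mono mult_left_mono)
  have D0: "0 \<le> D" unfolding D_def using C(1) nn pos K0 mu_nonneg by simp
  have "rayleigh_inf p (cylinder \<omega>1 \<omega>2 l) A \<le> \<mu> + D * (1 / l\<^sup>2 + 1 / l powr p)" if l: "0 < l" for l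
  proof (rule le_limit_at_right_0)
    let ?R = "rayleigh_inf p (cylinder \<omega>1 \<omega>2 l) A"
    let ?m = "l ^ CARD('m)"
    show "((\<lambda>\<epsilon>. \<mu> + \<epsilon> + D * (1 / l\<^sup>2 + 1 / l powr p)) \<longlongrightarrow> \<mu> + D * (1 / l\<^sup>2 + 1 / l powr p)) (at_right 0)"
      by (auto intro!: tendsto_eq_intros)
    fix \<epsilon> :: real assume \<epsilon>: "0 < \<epsilon>" "\<epsilon> < 1"
    obtain W where W: "W \<in> test_functions \<omega>2" "0 < Lp_mass p W" "energy p B W < (\<mu> + \<epsilon>) * Lp_mass p W"
      by (rule rayleigh_inf_approx_test[OF omega2(1,3) p1 pos elliptic_B measurable_form_B \<epsilon>(1)]) blast
    let ?N = "Lp_mass p W" and ?E = "energy p B W"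
    let ?u = "\<lambda>z. v ((1 / l) *\<^sub>R fst z) * W (snd z)"
    note prod = energy_product_le[OF v(1-3) W(1) l C, folded K0_def K1_def K2_def]
    note cyl = open_cylinder[OF \<omega>1 l]
    have R0: "0 \<le> ?R" using mu_nonneg mu_le_rayleigh_inf[OF cyl] by linarith
    have m: "0 < ?m" using l by simp
    have "?R * (?m * K0 * ?N) \<le> ?R * Lp_mass p ?u"
      by (rule mult_left_mono[OF prod(2) R0])
    also have "\<dots> \<le> energy p A ?u" by (rule rayleigh_inf_le_test[OF prod(1) cyl(1) p0])
    also have "\<dots> \<le> ?m * (K0 * ?E + C * (M * K1 / l\<^sup>2 * (?E + ?N) + M powr (p / 2) * K2 / l powr p * ?N))"
      by (rule prod(3))
    also have "\<dots> \<le> ?m * (K0 * ((\<mu> + \<epsilon>) * ?N) + C * (M * K1 / l\<^sup>2 * ((\<mu> + \<epsilon>) * ?N + ?N) + M powr (p / 2) * K2 / l powr p * ?N))"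
      using W(3) m K0 C(1) nn pos by (intro mult_left_mono add_mono order_refl) auto
    also have "\<dots> = (K0 * (\<mu> + \<epsilon>) + C * (M * K1 / l\<^sup>2 * (\<mu> + \<epsilon> + 1) + M powr (p / 2) * K2 / l powr p)) * (?m * ?N)"
      by (simp add: distrib_left distrib_right mult_ac add_divide_distrib)
    finally have "?R * K0 * (?m * ?N) \<le> (K0 * (\<mu> + \<epsilon>) + C * (M * K1 / l\<^sup>2 * (\<mu> + \<epsilon> + 1) + M powr (p / 2) * K2 / l powr p)) * (?m * ?N)"
      by (simp add: mult_ac)
    then have "?R * K0 \<le> K0 * (\<mu> + \<epsilon>) + C * (M * K1 / l\<^sup>2 * (\<mu> + \<epsilon> + 1) + M powr (p / 2) * K2 / l powr p)"
      using m W(2) by (simp add: mult_le_cancel_right)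
    also have "\<dots> \<le> K0 * (\<mu> + \<epsilon>) + C * (M * K1 / l\<^sup>2 * (\<mu> + 2) + M powr (p / 2) * K2 / l powr p)"
      using C(1) nn pos \<epsilon> by (intro add_left_mono mult_left_mono add_right_mono) auto
    also have "\<dots> = K0 * (\<mu> + \<epsilon>) + C * (M * K1 * (\<mu> + 2)) * (1 / l\<^sup>2) + C * (M powr (p / 2) * K2) * (1 / l powr p)"
      unfolding distrib_left[of C] by simp
    also have "\<dots> = K0 * (\<mu> + \<epsilon> + (C * (M * K1 * (\<mu> + 2)) / K0) * (1 / l\<^sup>2) + (C * (M powr (p / 2) * K2) / K0) * (1 / l powr p))"
      using K0 unfolding distrib_left[of K0] by simp
    also have "\<dots> \<le> K0 * (\<mu> + \<epsilon> + D * (1 / l\<^sup>2) + D * (1 / l powr p))"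
      using K0 D1 by (intro mult_left_mono add_mono order_refl mult_right_mono) auto
    finally have "K0 * ?R \<le> K0 * (\<mu> + \<epsilon> + D * (1 / l\<^sup>2 + 1 / l powr p))"
      by (simp add: distrib_left mult.commute add.assoc)
    then show "?R \<le> \<mu> + \<epsilon> + D * (1 / l\<^sup>2 + 1 / l powr p)" using K0 by simp
  qed
  with D0 show thesis by (rule that)
qed

text \<open>
  Every test function on a cylinder is a test function on the strip, with the same mass and energy.
\<close>

lemma rayleigh_inf_strip_le_cylinder:
  assumes "open \<omega>1" "\<omega>1 \<noteq> {}" "0 < l"
  shows "rayleigh_inf p (UNIV \<times> \<omega>2) A \<le> rayleigh_inf p (cylinder \<omega>1 \<omega>2 l) A"
proof -
  note cyl = open_cylinder[OF assms]
  show ?thesis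
  proof (rule rayleigh_inf_ge_test[OF cyl(1,2) p1 pos _ measurable_form_A[OF cyl(3)]])
    show "AE x in lebesgue_on (cylinder \<omega>1 \<omega>2 l). elliptic_form lam M (A x)"
      by (rule elliptic_A_subset[OF cyl(1,3)])
    fix \<phi> assume "\<phi> \<in> test_functions (cylinder \<omega>1 \<omega>2 l)"
    then have "\<phi> \<in> test_functions (UNIV \<times> \<omega>2)" using cyl(3) unfolding test_functions_def by blast
    then show "rayleigh_inf p (UNIV \<times> \<omega>2) A * Lp_mass p \<phi> \<le> energy p A \<phi>"
      by (rule rayleigh_inf_le_test[OF _ open_strip p0])
  qed
qed

end

section \<open>The eigenvalue estimate on long cylinders\<close>

text \<open>
  The bound on the operator norm becomes a bound on the quadratic form by the Cauchy--Schwarz inequality; the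
  symmetry of the block matrix comes from that of its diagonal blocks.
\<close>

lemma block_coefficientsI:
  fixes A12 :: "real^'k \<Rightarrow> real^'k^'m"
  assumes p: "2 \<le> p"
    and omega2: "open \<omega>2" "bounded \<omega>2" "\<omega>2 \<noteq> {}"
    and measurable:
      "A11 \<in> borel_measurable (lebesgue_on (UNIV \<times> \<omega>2))"
      "A12 \<in> borel_measurable (lebesgue_on \<omega>2)"
    and symmetric:
      "\<forall>x \<in> UNIV \<times> \<omega>2. transpose (A11 x) = A11 x"
      "\<forall>X2 \<in> \<omega>2. transpose (A22 X2) = A22 X2"
    and C1: "C1_on \<omega>2 A22"
    and positive: "0 < M" "0 < lam"
    and bounded: "AE x in lebesgue_on (UNIV \<times> \<omega>2). onorm (block_field A11 A12 A22 x) \<le> M"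
    and elliptic: "AE x in lebesgue_on (UNIV \<times> \<omega>2). \<forall>\<xi>. lam * (norm \<xi>)\<^sup>2 \<le> block_field A11 A12 A22 x \<xi> \<bullet> \<xi>"
  shows "block_coefficients p M lam \<omega>2 A11 A12 A22"
proof
  show "continuous_on \<omega>2 A22"
    using C1 unfolding C1_on_def
    by (metis continuous_at_imp_continuous_on has_derivative_continuous)
  have mem: "AE x in lebesgue_on (UNIV \<times> \<omega>2). x \<in> UNIV \<times> \<omega>2"
    by (rule AE_I2) simp
  show "AE x in lebesgue_on (UNIV \<times> \<omega>2). elliptic_form lam M (block_field A11 A12 A22 x)"
    using bounded elliptic mem
  proof eventually_elim
    case (elim x)
    let ?L = "block_field A11 A12 A22 x"
    have "transpose (A11 x) = A11 x" "transpose (A22 (snd x)) = A22 (snd x)"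
      using symmetric elim(3) by auto
    then have sym: "(A11 x *v a) \<bullet> b = (A11 x *v b) \<bullet> a" "(A22 (snd x) *v c) \<bullet> d = (A22 (snd x) *v d) \<bullet> c" for a b c d
      using transpose_inner[of "A11 x" a b] transpose_inner[of "A22 (snd x)" c d] by simp_all
    have "?L \<xi> \<bullet> \<eta> = ?L \<eta> \<bullet> \<xi>" for \<xi> \<eta>
      unfolding block_field_inner sym(1)[of "fst \<xi>"] sym(2)[of "snd \<xi>"] by simp
    moreover have "?L \<xi> \<bullet> \<xi> \<le> M * (norm \<xi>)\<^sup>2" for \<xi>
    proof -
      have "?L \<xi> \<bullet> \<xi> \<le> norm (?L \<xi>) * norm \<xi>" by (rule norm_cauchy_schwarz)
      also have "\<dots> \<le> onorm ?L * norm \<xi> * norm \<xi>"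
        by (intro mult_right_mono onorm linear_conv_bounded_linear[THEN iffD1] linear_block_field) simp
      also have "\<dots> \<le> M * norm \<xi> * norm \<xi>"
        using elim(1) by (intro mult_right_mono) auto
      finally show ?thesis by (simp add: power2_eq_square mult.assoc)
    qed
    ultimately show ?case
      using elim(2) linear_block_field unfolding elliptic_form_def by blast
  qed
qed (use assms in auto)

theorem theorem1p1:
  fixes p M lam :: real
    and \<omega>2 :: "(real^'k) set"
    and A11 :: "(real^'m) \<times> (real^'k) \<Rightarrow> real^'m^'m"
    and A12 :: "real^'k \<Rightarrow> real^'k^'m"
    and A22 :: "real^'k \<Rightarrow> real^'k^'k"
  defines "A \<equiv> block_field A11 A12 A22"
    and "\<mu> \<equiv> rayleigh_inf p \<omega>2 (\<lambda>X2 \<eta>. A22 X2 *v \<eta>)"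
    and "eig \<equiv> (\<lambda>\<omega>1 l. rayleigh_inf p (cylinder \<omega>1 \<omega>2 l) (block_field A11 A12 A22))"
    and "\<Lambda> \<equiv> rayleigh_inf p (UNIV \<times> \<omega>2) (block_field A11 A12 A22)"
  assumes p: "2 \<le> p"
    and omega2: "open \<omega>2" "bounded \<omega>2" "\<omega>2 \<noteq> {}"
    and measurable:
      "A11 \<in> borel_measurable (lebesgue_on (UNIV \<times> \<omega>2))"
      "A12 \<in> borel_measurable (lebesgue_on \<omega>2)"
    and symmetric:
      "\<forall>x \<in> UNIV \<times> \<omega>2. transpose (A11 x) = A11 x"
      "\<forall>X2 \<in> \<omega>2. transpose (A22 X2) = A22 X2"
    and C1: "C1_on \<omega>2 A22"
    and positive: "0 < M" "0 < lam"
    and bounded: "AE x in lebesgue_on (UNIV \<times> \<omega>2). onorm (A x) \<le> M"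
    and elliptic: "AE x in lebesgue_on (UNIV \<times> \<omega>2). \<forall>\<xi>. lam * (norm \<xi>)\<^sup>2 \<le> A x \<xi> \<bullet> \<xi>"
  shows "(\<exists>C. \<forall>\<omega>1 :: (real^'m) set. open \<omega>1 \<and> bounded \<omega>1 \<and> \<omega>1 \<noteq> {} \<longrightarrow>
            (\<forall>l>0. \<mu> \<le> eig \<omega>1 l) \<and>
            (\<exists>l0>0. \<forall>l\<ge>l0. eig \<omega>1 l \<le> \<mu> + C / l) \<and>
            (\<forall>l0>0. \<exists>C'. \<forall>l\<ge>l0. eig \<omega>1 l \<le> \<mu> + C' / l)) \<and>
         \<Lambda> = \<mu>"
proof -
  interpret bc: block_coefficients p M lam \<omega>2 A11 A12 A22
    by (rule block_coefficientsI[OF p omega2 measurable symmetric C1 positive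
          bounded[unfolded A_def] elliptic[unfolded A_def]])
  have lower: "\<mu> \<le> eig \<omega>1 l" if "open \<omega>1" "\<omega>1 \<noteq> {}" "0 < l" for \<omega>1 :: "(real^'m) set" and l
    unfolding \<mu>_def eig_def by (rule bc.mu_le_rayleigh_inf[OF bc.open_cylinder[OF that]])
  have upper: "\<exists>D\<ge>0. \<forall>l>0. eig \<omega>1 l \<le> \<mu> + D * (1 / l\<^sup>2 + 1 / l powr p)"
    if "open \<omega>1" "\<omega>1 \<noteq> {}" for \<omega>1 :: "(real^'m) set"
    unfolding \<mu>_def eig_def by (rule bc.rayleigh_inf_cylinder_le[OF that]) blast
  have large: "\<exists>l0>0. \<forall>l\<ge>l0. eig \<omega>1 l \<le> \<mu> + 1 / l" if o: "open \<omega>1" "\<omega>1 \<noteq> {}" for \<omega>1 :: "(real^'m) set"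
  proof -
    obtain D where D: "D \<ge> 0" "\<And>l. l > 0 \<Longrightarrow> eig \<omega>1 l \<le> \<mu> + D * (1 / l\<^sup>2 + 1 / l powr p)"
      using upper[OF o] by blast
    \<comment> \<open>The error is \<open>o(1 / l)\<close> for each \<open>\<omega>\<^sub>1\<close>, so the constant 1 serves for every \<open>\<omega>\<^sub>1\<close> once \<open>l\<close> is large.\<close>
    have "eig \<omega>1 l \<le> \<mu> + 1 / l" if l: "max 1 (2 * D) \<le> l" for l
    proof -
      have l1: "1 \<le> l" "2 * D \<le> l" using l by auto
      have "l powr 2 \<le> l powr p" using l1 p by (intro powr_mono) auto
      then have "1 / l powr p \<le> 1 / l\<^sup>2" using l1 by (intro divide_left_mono) (auto simp: powr_numeral)
      then have "D * (1 / l\<^sup>2 + 1 / l powr p) \<le> D * (1 / l\<^sup>2 + 1 / l\<^sup>2)"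
        using D(1) by (intro mult_left_mono add_left_mono) auto
      also have "\<dots> = 2 * D / l\<^sup>2" by simp
      also have "\<dots> \<le> l / l\<^sup>2" using l1 by (intro divide_right_mono) auto
      also have "\<dots> = 1 / l" using l1 by (simp add: power2_eq_square)
      finally show ?thesis using D(2)[of l] l1 by linarith
    qed
    then show ?thesis by (intro exI[of _ "max 1 (2 * D)"]) auto
  qed
  have all: "\<exists>C'. \<forall>l\<ge>l0. eig \<omega>1 l \<le> \<mu> + C' / l" if o: "open \<omega>1" "\<omega>1 \<noteq> {}" and l0: "0 < l0"
    for \<omega>1 :: "(real^'m) set" and l0
  proof -
    obtain D where D: "D \<ge> 0" "\<And>l. l > 0 \<Longrightarrow> eig \<omega>1 l \<le> \<mu> + D * (1 / l\<^sup>2 + 1 / l powr p)"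
      using upper[OF o] by blast
    have "eig \<omega>1 l \<le> \<mu> + (D * (1 / l0 + l0 powr (1 - p))) / l" if l: "l0 \<le> l" for l
    proof -
      have lp: "0 < l" using l l0 by simp
      have "1 / l\<^sup>2 \<le> 1 / l0 * (1 / l)"
        using l l0 lp by (simp add: power2_eq_square frac_le)
      moreover have "1 / l powr p \<le> l0 powr (1 - p) * (1 / l)"
      proof -
        have "1 / l powr p = l powr (1 - p) * (1 / l)" using lp by (simp add: powr_diff)
        also have "\<dots> \<le> l0 powr (1 - p) * (1 / l)"
          using l l0 lp p by (intro mult_right_mono powr_mono2') auto
        finally show ?thesis .
      qed
      ultimately have "1 / l\<^sup>2 + 1 / l powr p \<le> (1 / l0 + l0 powr (1 - p)) * (1 / l)"
        unfolding distrib_right by (rule add_mono)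
      then have "D * (1 / l\<^sup>2 + 1 / l powr p) \<le> D * ((1 / l0 + l0 powr (1 - p)) * (1 / l))"
        using D(1) by (rule mult_left_mono)
      then show ?thesis using D(2)[OF lp] by simp
    qed
    then show ?thesis by blast
  qed
  have "\<mu> \<le> \<Lambda>"
    unfolding \<mu>_def \<Lambda>_def using omega2(3) by (intro bc.mu_le_rayleigh_inf bc.open_strip) auto
  moreover have "\<Lambda> \<le> \<mu>"
  proof (rule field_le_epsilon)
    fix \<epsilon> :: real assume \<epsilon>: "0 < \<epsilon>"
    obtain l0 where l0: "l0 > 0" "\<forall>l\<ge>l0. eig (UNIV :: (real^'m) set) l \<le> \<mu> + 1 / l"
      using large[OF open_UNIV UNIV_not_empty] by blast
    define l where "l = max l0 (1 / \<epsilon>)"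
    have "0 < l" "l0 \<le> l" "1 / \<epsilon> \<le> l" using l0 \<epsilon> by (auto simp: l_def)
    then have "1 / l \<le> \<epsilon>" using \<epsilon> by (simp add: field_simps)
    have "\<Lambda> \<le> eig (UNIV :: (real^'m) set) l"
      unfolding \<Lambda>_def eig_def by (rule bc.rayleigh_inf_strip_le_cylinder[OF open_UNIV UNIV_not_empty \<open>0 < l\<close>])
    also have "\<dots> \<le> \<mu> + 1 / l" using l0(2) \<open>l0 \<le> l\<close> by blast
    finally show "\<Lambda> \<le> \<mu> + \<epsilon>" using \<open>1 / l \<le> \<epsilon>\<close> by linarith
  qed
  ultimately have eq: "\<Lambda> = \<mu>" by simp
  have "\<forall>\<omega>1 :: (real^'m) set. open \<omega>1 \<and> bounded \<omega>1 \<and> \<omega>1 \<noteq> {} \<longrightarrow>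
            (\<forall>l>0. \<mu> \<le> eig \<omega>1 l) \<and>
            (\<exists>l0>0. \<forall>l\<ge>l0. eig \<omega>1 l \<le> \<mu> + 1 / l) \<and>
            (\<forall>l0>0. \<exists>C'. \<forall>l\<ge>l0. eig \<omega>1 l \<le> \<mu> + C' / l)"
    using lower large all by blast
  with eq show ?thesis by blast
qed

end
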